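(* Let $\mathcal K$ be a simplicial complex on $[m]$. Then $\mathit{CH}^*(\mathcal Z_{\mathcal K})=(H^*(\mathcal Z_{\mathcal K}),d')$ is a commutative differential graded algebra. Therefore, the double cohomology $\mathit{HH}^*(\mathcal Z_{\mathcal K})=H(H^*(\mathcal Z_{\mathcal K}),d')$ is a graded commutative algebra, with the product induced from the cohomology product on $H^*(\mathcal Z_{\mathcal K})$.
   Context: $\mathcal K$ is a simplicial complex on the vertex set $[m]=\{1,\dots,m\}$ (containing $\varnothing$ and all singletons); $\mathcal K_I=\{J\in\mathcal K:J\subset I\}$ is the full subcomplex on $I\subset[m]$. Coefficients are $\mathbb Z$. $\mathcal Z_{\mathcal K}=\bigcup_{I\in\mathcal K}\{z\in(D^2)^m:|z_j|=1\text{ if }j\notin I\}$ is the moment-angle complex. Its cohomology ring is identified with the cohomology of the Koszul differential graded algebra $(\Lambda[u_1,\dots,u_m]\otimes\mathbb Z[\mathcal K],d)$, where $\mathbb Z[\mathcal K]=\mathbb Z[v_1,\dots,v_m]/(\prod_{i\in I}v_i: I\notin\mathcal K)$, $\mathrm{bideg}\,u_i=(-1,2)$, $\mathrm{bideg}\,v_i=(0,2)$, $du_i=v_i$, $dv_i=0$; the total degree of bidegree $(-k,2\ell)$ is $-k+2\ell$. Additively, $H^{-k,2\ell}(\mathcal Z_{\mathcal K})\cong\bigoplus_{|I|=\ell}\widetilde H^{\ell-k-1}(\mathcal K_I)$, the isomorphism being induced by sending the basis cochain $\alpha_{L,I}\in C^{|L|-1}(\mathcal K_I)$ dual to $L\in\mathcal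 K_I$ to $\varepsilon(L,I)u_{I\setminus L}v_L$, where $\varepsilon(L,I)=\prod_{i\in L}\varepsilon(i,I)$ and $\varepsilon(i,I)=(-1)^{\#\{r\in I:r<i\}}$. The differential $d':H^{-k,2\ell}(\mathcal Z_{\mathcal K})\to H^{-k+1,2\ell-2}(\mathcal Z_{\mathcal K})$ is given on $\widetilde H^p(\mathcal K_I)$ by $d'=(-1)^{p+1}\sum_{i\in I}\varepsilon(i,I)\psi_{p;i,I}$, where $\psi_{p;i,I}:\widetilde H^p(\mathcal K_I)\to\widetilde H^p(\mathcal K_{I\setminus\{i\}})$ is restriction; equivalently, it is induced by the derivation $d'$ of the Koszul algebra with $d'u_i=1$, $d'v_i=0$, which anticommutes with $d$. One has $(d')^2=0$; $d'$ changes the total degree by $-1$. "Commutative differential graded algebra" means that $H^*(\mathcal Z_{\mathcal K})$ is graded commutative and $d'(\alpha\beta)=(d'\alpha)\beta+(-1)^{|\alpha|}\alpha(d'\beta)$ with $|\alpha|$ the total degree. *)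

theory Defs
  imports "HOL-Algebra.QuotRing" "HOL-Library.Poly_Mapping" "HOL-Library.FuncSet"
begin

section \<open>Graded commutative rings and commutative differential graded algebras\<close>

text \<open>
  All algebras are over the integers, that is, they are (not necessarily commutative) rings with
  unit.  A grading is a family \<open>G\<close> of subgroups indexed by the (total) degree.
\<close>

locale graded_comm_ring = ring R for R (structure) +
  fixes G :: "int \<Rightarrow> 'a set"
  assumes deg_subgroup: "\<And>n. additive_subgroup (G n) R"
    and deg_decomp: "\<And>x. x \<in> carrier R \<Longrightarrow>
          \<exists>!f. (\<forall>n. f n \<in> G n) \<and> finite {n. f n \<noteq> \<zero>} \<and> x = (\<Oplus>n\<in>{n. f n \<noteq> \<zero>}. f n)"
    and deg_one: "\<one> \<in> G 0"
    and deg_mult: "\<And>p q x y. x \<in> G p \<Longrightarrow> y \<in> G q \<Longrightarrow> x \<otimes> y \<in> G (p + q)"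
    and graded_comm: "\<And>p q x y. x \<in> G p \<Longrightarrow> y \<in> G q \<Longrightarrow>
          x \<otimes> y = (if even (p * q) then y \<otimes> x else \<ominus> (y \<otimes> x))"

locale cdga = graded_comm_ring R G for R (structure) and G +
  fixes d :: "'a \<Rightarrow> 'a"
  assumes diff_add: "\<And>x y. x \<in> carrier R \<Longrightarrow> y \<in> carrier R \<Longrightarrow> d (x \<oplus> y) = d x \<oplus> d y"
    and diff_deg: "\<And>n x. x \<in> G n \<Longrightarrow> d x \<in> G (n - 1)"
    and diff_diff: "\<And>x. x \<in> carrier R \<Longrightarrow> d (d x) = \<zero>"
    and leibniz: "\<And>p x y. x \<in> G p \<Longrightarrow> y \<in> carrier R \<Longrightarrow>
          d (x \<otimes> y) = (d x \<otimes> y) \<oplus> (if even p then x \<otimes> d y else \<ominus> (x \<otimes> d y))"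

text \<open>The cohomology of a ring with differential, as the quotient ring of the cocycles.\<close>

definition cocycle_ring :: "('a, 'b) ring_scheme \<Rightarrow> ('a \<Rightarrow> 'a) \<Rightarrow> ('a, 'b) ring_scheme" where
  "cocycle_ring R d = R\<lparr>carrier := {x \<in> carrier R. d x = \<zero>\<^bsub>R\<^esub>}\<rparr>"

definition cohomology_ring :: "('a, 'b) ring_scheme \<Rightarrow> ('a \<Rightarrow> 'a) \<Rightarrow> 'a set ring" where
  "cohomology_ring R d = cocycle_ring R d Quot (d ` carrier R)"

definition cohomology_class :: "('a, 'b) ring_scheme \<Rightarrow> ('a \<Rightarrow> 'a) \<Rightarrow> 'a \<Rightarrow> 'a set" where
  "cohomology_class R d x = (d ` carrier R) +>\<^bsub>cocycle_ring R d\<^esub> x"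

definition cohomology_deg ::
    "('a, 'b) ring_scheme \<Rightarrow> (int \<Rightarrow> 'a set) \<Rightarrow> ('a \<Rightarrow> 'a) \<Rightarrow> int \<Rightarrow> 'a set set" where
  "cohomology_deg R G d n = cohomology_class R d ` (G n \<inter> carrier (cocycle_ring R d))"

text \<open>
  The map induced by \<open>f\<close> on cosets: \<open>f\<close> is a function of representatives (usually with values in
  cosets) which is constant on every coset it is applied to.
\<close>

definition induced :: "('a \<Rightarrow> 'b) \<Rightarrow> 'a set \<Rightarrow> 'b" where
  "induced f A = the_elem (f ` A)"


section \<open>Simplicial complexes and reduced cohomology of full subcomplexes\<close>

definition simplicial_complex :: "nat \<Rightarrow> nat set set \<Rightarrow> bool" where
  "simplicial_complex m K \<longleftrightarrow>
     K \<subseteq> Pow {1..m} \<and> {} \<in> K \<and> (\<forall>i\<in>{1..m}. {i} \<in> K) \<and> (\<forall>J\<in>K. \<forall>L. L \<subseteq> J \<longrightarrow> L \<in> K)"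

definition full_subcomplex :: "nat set set \<Rightarrow> nat set \<Rightarrow> nat set set" where
  "full_subcomplex K I = {J \<in> K. J \<subseteq> I}"

definition eps :: "nat \<Rightarrow> nat set \<Rightarrow> int" where
  "eps i I = (- 1) ^ card {r \<in> I. r < i}"

definition eps_set :: "nat set \<Rightarrow> nat set \<Rightarrow> int" where
  "eps_set L I = (\<Prod>i\<in>L. eps i I)"

text \<open>
  Reduced simplicial cochains of a complex \<open>X\<close> in dimension \<open>p \<ge> -1\<close>, the empty simplex having
  dimension \<open>-1\<close>.  A cochain \<open>c\<close> stands for the sum of the \<open>c L\<close>-fold multiples of the basis
  cochains dual to the simplices \<open>L\<close>, oriented by the order of the vertices.  Groups are in the
  multiplicative notation of the library.
\<close>

definition cochain_group :: "nat set set \<Rightarrow> int \<Rightarrow> (nat set \<Rightarrow> int) monoid" where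
  "cochain_group X p =
     \<lparr>carrier = {c. \<forall>L. c L \<noteq> 0 \<longrightarrow> L \<in> X \<and> int (card L) = p + 1},
      mult = (\<lambda>c c' L. c L + c' L), one = (\<lambda>L. 0)\<rparr>"

definition coboundary :: "nat set set \<Rightarrow> (nat set \<Rightarrow> int) \<Rightarrow> nat set \<Rightarrow> int" where
  "coboundary X c = (\<lambda>M. if M \<in> X then \<Sum>i\<in>M. eps i M * c (M - {i}) else 0)"

definition coboundaries :: "nat set set \<Rightarrow> int \<Rightarrow> (nat set \<Rightarrow> int) set" where
  "coboundaries X p = coboundary X ` carrier (cochain_group X (p - 1))"

definition reduced_cohomology :: "nat set set \<Rightarrow> int \<Rightarrow> (nat set \<Rightarrow> int) set monoid" where
  "reduced_cohomology X p =
     (cochain_group X p)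
       \<lparr>carrier := {c \<in> carrier (cochain_group X p). coboundary X c = (\<lambda>L. 0)}\<rparr>
     Mod coboundaries X p"

definition reduced_class :: "nat set set \<Rightarrow> int \<Rightarrow> (nat set \<Rightarrow> int) \<Rightarrow> (nat set \<Rightarrow> int) set" where
  "reduced_class X p c = coboundaries X p #>\<^bsub>cochain_group X p\<^esub> c"

definition restrict_cochain :: "nat set set \<Rightarrow> (nat set \<Rightarrow> int) \<Rightarrow> nat set \<Rightarrow> int" where
  "restrict_cochain Y c = (\<lambda>L. if L \<in> Y then c L else 0)"

text \<open>The restriction \<open>\<psi>\<^sub>p\<^sub>;\<^sub>i\<^sub>,\<^sub>I\<close> from the cohomology of \<open>K\<^sub>I\<close> to that of \<open>K\<close> on \<open>I - {i}\<close>.\<close>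

definition psi :: "nat set set \<Rightarrow> int \<Rightarrow> nat \<Rightarrow> nat set
    \<Rightarrow> (nat set \<Rightarrow> int) set \<Rightarrow> (nat set \<Rightarrow> int) set" where
  "psi K p i I =
     induced (\<lambda>c. reduced_class (full_subcomplex K (I - {i})) p
                    (restrict_cochain (full_subcomplex K (I - {i})) c))"


section \<open>The face ring\<close>

type_synonym mpoly = "(nat \<Rightarrow>\<^sub>0 nat) \<Rightarrow>\<^sub>0 int"

definition poly_ring :: "nat \<Rightarrow> mpoly ring" where
  "poly_ring m =
     \<lparr>carrier = {f. \<forall>a \<in> Poly_Mapping.keys f. Poly_Mapping.keys a \<subseteq> {1..m}},
      mult = (*), one = 1, zero = 0, add = (+)\<rparr>"

definition mvar :: "nat \<Rightarrow> mpoly" where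
  "mvar i = Poly_Mapping.single (Poly_Mapping.single i 1) 1"

definition stanley_reisner_ideal :: "nat \<Rightarrow> nat set set \<Rightarrow> mpoly set" where
  "stanley_reisner_ideal m K = Idl\<^bsub>poly_ring m\<^esub> {\<Prod>i\<in>I. mvar i | I. I \<subseteq> {1..m} \<and> I \<notin> K}"

definition face_ring :: "nat \<Rightarrow> nat set set \<Rightarrow> mpoly set ring" where
  "face_ring m K = poly_ring m Quot stanley_reisner_ideal m K"

definition face_class :: "nat \<Rightarrow> nat set set \<Rightarrow> mpoly \<Rightarrow> mpoly set" where
  "face_class m K f = stanley_reisner_ideal m K +>\<^bsub>poly_ring m\<^esub> f"

text \<open>Every variable has degree 2.\<close>

definition face_deg :: "nat \<Rightarrow> nat set set \<Rightarrow> int \<Rightarrow> mpoly set set" where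
  "face_deg m K n = face_class m K `
     {f \<in> carrier (poly_ring m). \<forall>a \<in> Poly_Mapping.keys f.
        int (2 * (\<Sum>i\<in>Poly_Mapping.keys a. Poly_Mapping.lookup a i)) = n}"


section \<open>The Koszul algebra\<close>

text \<open>
  The exterior algebra on \<open>u\<^sub>1, \<dots>, u\<^sub>m\<close> over a commutative ring \<open>S\<close>, that is, the tensor product of
  the integral exterior algebra with \<open>S\<close>.  It is free over \<open>S\<close> on the products \<open>u\<^sub>J\<close>, taken in
  increasing order, for \<open>J\<close> a subset of \<open>{1..m}\<close>; the function \<open>f\<close> stands for the sum of all
  \<open>u\<^sub>J \<otimes> f J\<close>.  The product \<open>u\<^sub>A u\<^sub>B\<close> is \<open>shuffle_sign A B\<close> times \<open>u\<close> indexed by the union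
  if \<open>A\<close> and \<open>B\<close> are disjoint, and 0 otherwise.
\<close>

definition shuffle_sign :: "nat set \<Rightarrow> nat set \<Rightarrow> int" where
  "shuffle_sign A B = (- 1) ^ card {(a, b). a \<in> A \<and> b \<in> B \<and> b < a}"

definition exterior_ring :: "nat \<Rightarrow> ('a, 'b) ring_scheme \<Rightarrow> (nat set \<Rightarrow> 'a) ring" where
  "exterior_ring m S =
     \<lparr>carrier = Pow {1..m} \<rightarrow>\<^sub>E carrier S,
      mult = (\<lambda>f g. \<lambda>J\<in>Pow {1..m}.
                \<Oplus>\<^bsub>S\<^esub>A\<in>Pow J. [shuffle_sign A (J - A)] \<cdot>\<^bsub>S\<^esub> (f A \<otimes>\<^bsub>S\<^esub> g (J - A))),
      one = (\<lambda>J\<in>Pow {1..m}. if J = {} then \<one>\<^bsub>S\<^esub> else \<zero>\<^bsub>S\<^esub>),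
      zero = (\<lambda>J\<in>Pow {1..m}. \<zero>\<^bsub>S\<^esub>),
      add = (\<lambda>f g. \<lambda>J\<in>Pow {1..m}. f J \<oplus>\<^bsub>S\<^esub> g J)\<rparr>"

text \<open>
  The \<open>S\<close>-linear derivation with \<open>u\<^sub>i \<mapsto> x i\<close>.  It takes \<open>u\<^sub>I\<close> to the sum over \<open>i \<in> I\<close> of
  \<open>eps i I\<close> times \<open>u\<close> indexed by \<open>I - {i}\<close>, times \<open>x i\<close>; below, \<open>I = insert i J\<close>.
\<close>

definition exterior_derivation ::
    "nat \<Rightarrow> ('a, 'b) ring_scheme \<Rightarrow> (nat \<Rightarrow> 'a) \<Rightarrow> (nat set \<Rightarrow> 'a) \<Rightarrow> nat set \<Rightarrow> 'a" where
  "exterior_derivation m S x f = (\<lambda>J\<in>Pow {1..m}.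
     \<Oplus>\<^bsub>S\<^esub>i\<in>{1..m} - J. [eps i (insert i J)] \<cdot>\<^bsub>S\<^esub> (x i \<otimes>\<^bsub>S\<^esub> f (insert i J)))"

definition koszul :: "nat \<Rightarrow> nat set set \<Rightarrow> (nat set \<Rightarrow> mpoly set) ring" where
  "koszul m K = exterior_ring m (face_ring m K)"

definition koszul_diff ::
    "nat \<Rightarrow> nat set set \<Rightarrow> (nat set \<Rightarrow> mpoly set) \<Rightarrow> nat set \<Rightarrow> mpoly set" where
  "koszul_diff m K = exterior_derivation m (face_ring m K) (\<lambda>i. face_class m K (mvar i))"

text \<open>
  Total degree.  An element \<open>u\<^sub>J v\<close> with \<open>v\<close> a product of \<open>q\<close> variables has bidegree
  \<open>(- card J, 2 * (card J + q))\<close>, hence total degree \<open>card J + 2 * q\<close>.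
\<close>

definition koszul_deg :: "nat \<Rightarrow> nat set set \<Rightarrow> int \<Rightarrow> (nat set \<Rightarrow> mpoly set) set" where
  "koszul_deg m K n =
     {f \<in> carrier (koszul m K). \<forall>J \<in> Pow {1..m}. f J \<in> face_deg m K (n - int (card J))}"

text \<open>The element \<open>u\<^sub>J v\<^sub>L\<close>.\<close>

definition koszul_elem :: "nat \<Rightarrow> nat set set \<Rightarrow> nat set \<Rightarrow> nat set \<Rightarrow> nat set \<Rightarrow> mpoly set" where
  "koszul_elem m K J L = (\<lambda>A\<in>Pow {1..m}.
     if A = J then face_class m K (\<Prod>i\<in>L. mvar i) else \<zero>\<^bsub>face_ring m K\<^esub>)"


section \<open>Cohomology and double cohomology of the moment-angle complex\<close>

text \<open>
  The integral cohomology ring of the moment-angle complex of \<open>K\<close>, identified with the cohomology of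
  the Koszul algebra, and its grading by total degree.
\<close>

type_synonym zk_class = "(nat set \<Rightarrow> mpoly set) set"

definition H_ZK :: "nat \<Rightarrow> nat set set \<Rightarrow> zk_class ring" where
  "H_ZK m K = cohomology_ring (koszul m K) (koszul_diff m K)"

definition H_ZK_deg :: "nat \<Rightarrow> nat set set \<Rightarrow> int \<Rightarrow> zk_class set" where
  "H_ZK_deg m K = cohomology_deg (koszul m K) (koszul_deg m K) (koszul_diff m K)"

text \<open>
  The map from the reduced cohomology of \<open>K\<^sub>I\<close> induced by sending the basis cochain dual to \<open>L\<close> to
  \<open>eps_set L I\<close> times the product of \<open>u\<close> indexed by \<open>I - L\<close> and \<open>v\<^sub>L\<close>.
\<close>

definition hochster_cochain ::
    "nat \<Rightarrow> nat set set \<Rightarrow> nat set \<Rightarrow> (nat set \<Rightarrow> int) \<Rightarrow> nat set \<Rightarrow> mpoly set" where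
  "hochster_cochain m K I c =
     (\<Oplus>\<^bsub>koszul m K\<^esub>L\<in>full_subcomplex K I.
        [(c L * eps_set L I)] \<cdot>\<^bsub>koszul m K\<^esub> (koszul_elem m K (I - L) L))"

definition hochster_summand ::
    "nat \<Rightarrow> nat set set \<Rightarrow> nat set \<Rightarrow> (nat set \<Rightarrow> int) set \<Rightarrow> zk_class" where
  "hochster_summand m K I =
     induced (\<lambda>c. cohomology_class (koszul m K) (koszul_diff m K) (hochster_cochain m K I c))"

text \<open>
  The isomorphism from the direct sum of all reduced cohomology groups of full subcomplexes, which
  vanish outside of the dimensions \<open>-1, \<dots>, m - 1\<close>.
\<close>

definition hochster_sum ::
    "nat \<Rightarrow> nat set set \<Rightarrow> (nat set \<times> int \<Rightarrow> (nat set \<Rightarrow> int) set) set" where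
  "hochster_sum m K =
     (\<Pi>\<^sub>E (I, p) \<in> Pow {1..m} \<times> {-1..<int m}.
        carrier (reduced_cohomology (full_subcomplex K I) p))"

definition hochster_iso ::
    "nat \<Rightarrow> nat set set \<Rightarrow> (nat set \<times> int \<Rightarrow> (nat set \<Rightarrow> int) set) \<Rightarrow> zk_class" where
  "hochster_iso m K y =
     (\<Oplus>\<^bsub>H_ZK m K\<^esub>I\<in>Pow {1..m}. \<Oplus>\<^bsub>H_ZK m K\<^esub>p\<in>{-1..<int m}.
        hochster_summand m K I (y (I, p)))"

text \<open>
  The differential: on the summand of \<open>(I, p)\<close> it is \<open>(-1)^(p + 1)\<close> times the sum over \<open>i \<in> I\<close> of
  \<open>eps i I\<close> times the restriction to \<open>I - {i}\<close>.
\<close>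

definition d_prime :: "nat \<Rightarrow> nat set set \<Rightarrow> zk_class \<Rightarrow> zk_class" where
  "d_prime m K \<alpha> = (let y = inv_into (hochster_sum m K) (hochster_iso m K) \<alpha> in
     \<Oplus>\<^bsub>H_ZK m K\<^esub>I\<in>Pow {1..m}. \<Oplus>\<^bsub>H_ZK m K\<^esub>p\<in>{-1..<int m}. \<Oplus>\<^bsub>H_ZK m K\<^esub>i\<in>I.
       [((- 1) ^ nat (p + 1) * eps i I)] \<cdot>\<^bsub>H_ZK m K\<^esub>
         (hochster_summand m K (I - {i}) (psi K p i I (y (I, p)))))"

definition HH_ZK :: "nat \<Rightarrow> nat set set \<Rightarrow> zk_class set ring" where
  "HH_ZK m K = cohomology_ring (H_ZK m K) (d_prime m K)"

definition HH_ZK_deg :: "nat \<Rightarrow> nat set set \<Rightarrow> int \<Rightarrow> zk_class set set" where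
  "HH_ZK_deg m K = cohomology_deg (H_ZK m K) (H_ZK_deg m K) (d_prime m K)"

end

theory Submission
  imports Defs "HOL-Algebra.Subrings"
begin

text \<open>
  Write \<open>\<Lambda>\<close> for the Koszul algebra, \<open>d\<close> for its differential (\<open>u\<^sub>i \<mapsto> v\<^sub>i\<close>, of degree 1) and \<open>d'\<close> for the
  derivation with \<open>u\<^sub>i \<mapsto> 1\<close> and \<open>v\<^sub>i \<mapsto> 0\<close>, of degree -1.  Both are instances of the derivation of an
  exterior algebra that is linear over the coefficients and has prescribed values on the generators
  \<open>u\<^sub>i\<close>.  Such a derivation is a combination of the contractions \<open>ext_partial i\<close>, which are
  derivations (\<open>ext_partial_leibniz\<close>) and anticommute (\<open>ext_partial_anticommute\<close>); hence both
  derivations have square zero and \<open>d d' = - d' d\<close>.  A derivation that anticommutes with \<open>d\<close> induces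
  a derivation of the cohomology ring, so that \<open>H(\<Lambda>, d)\<close> is a commutative differential graded algebra
  with the map induced by \<open>d'\<close> (\<open>cohomology_graded_diff_ring\<close>).  Its own cohomology is then again
  graded commutative, for the same reason as \<open>H(\<Lambda>, d)\<close> is (\<open>cohomology_graded_comm_ring\<close>).

  What remains is to see that \<open>d_prime\<close>, defined by restriction maps between full subcomplexes, is the
  map induced by \<open>d'\<close> (\<open>d_prime_class\<close>).  The cochain of \<open>\<Lambda>\<close> attached to a simplicial cochain \<open>c\<close> on
  \<open>K\<^sub>I\<close> is called \<open>hochster_poly I c\<close> below.  Comparing signs shows that \<open>d\<close> takes it to the cochain of
  the coboundary of \<open>c\<close> (\<open>hochster_chain_map\<close>), and that \<open>d'\<close> takes it to the alternating sum of the
  cochains of the restrictions of \<open>c\<close> to the subcomplexes on \<open>I - {i}\<close> (\<open>hochster_dprime\<close>).  So the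
  formula defining \<open>d_prime\<close> computes \<open>d'\<close> on the image of every family of reduced classes, whichever
  family is chosen as the preimage of a given class.

  Every class of \<open>\<Lambda>\<close> does have a preimage (\<open>hochster_surjective\<close>).  For each \<open>i\<close>, dividing by \<open>v\<^sub>i\<close> and
  multiplying by \<open>u\<^sub>i\<close> is a homotopy from the identity to the projection that discards the monomials
  divisible by \<open>v\<^sub>i\<^sup>2\<close> or \<open>u\<^sub>i v\<^sub>i\<close> (\<open>koszul_homotopy\<close>).  Composing these projections replaces any cocycle
  by a cohomologous combination of monomials \<open>u\<^sub>J v\<^sub>L\<close> with \<open>J\<close> and \<open>L\<close> disjoint
  (\<open>squarefree_representative\<close>).  Its part with \<open>J \<union> L = I\<close> and \<open>L\<close> of cardinality \<open>p + 1\<close> is the cochain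
  of a simplicial cocycle on \<open>K\<^sub>I\<close> of dimension \<open>p\<close>.

  All identities in \<open>\<Lambda>\<close> are proved for exterior forms with polynomial coefficients and transported
  along the surjection \<open>koszul_of\<close>.  Since the Stanley-Reisner ideal is spanned by monomials, equality
  in \<open>\<Lambda>\<close> means equality of the coefficients at all monomials supported on simplices
  (\<open>koszul_of_eq_iff\<close>).
\<close>

section \<open>Graded rings with a differential of odd degree\<close>

lemma additive_map_hom:
  assumes "abelian_group R" "abelian_group S" "\<And>x. x \<in> carrier R \<Longrightarrow> h x \<in> carrier S"
    and "\<And>x y. x \<in> carrier R \<Longrightarrow> y \<in> carrier R \<Longrightarrow> h (x \<oplus>\<^bsub>R\<^esub> y) = h x \<oplus>\<^bsub>S\<^esub> h y"
  shows "group_hom (add_monoid R) (add_monoid S) h"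
  using assms by (simp add: group_hom_def group_hom_axioms_def hom_def abelian_group.a_group)

lemma additive_map_zero:
  assumes "abelian_group R" "abelian_group S" "\<And>x. x \<in> carrier R \<Longrightarrow> h x \<in> carrier S"
    and "\<And>x y. x \<in> carrier R \<Longrightarrow> y \<in> carrier R \<Longrightarrow> h (x \<oplus>\<^bsub>R\<^esub> y) = h x \<oplus>\<^bsub>S\<^esub> h y"
  shows "h \<zero>\<^bsub>R\<^esub> = \<zero>\<^bsub>S\<^esub>"
  using group_hom.hom_one[OF additive_map_hom[OF assms]] by simp

lemma additive_map_minus:
  assumes "abelian_group R" "abelian_group S" "\<And>x. x \<in> carrier R \<Longrightarrow> h x \<in> carrier S"
    and "\<And>x y. x \<in> carrier R \<Longrightarrow> y \<in> carrier R \<Longrightarrow> h (x \<oplus>\<^bsub>R\<^esub> y) = h x \<oplus>\<^bsub>S\<^esub> h y"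
    and "x \<in> carrier R"
  shows "h (\<ominus>\<^bsub>R\<^esub> x) = \<ominus>\<^bsub>S\<^esub> h x"
  using group_hom.hom_inv[OF additive_map_hom[OF assms(1-4)]] assms(5)
  by (simp add: a_inv_def)

lemma additive_map_int_mult:
  assumes "abelian_group R" "abelian_group S" "\<And>x. x \<in> carrier R \<Longrightarrow> h x \<in> carrier S"
    and "\<And>x y. x \<in> carrier R \<Longrightarrow> y \<in> carrier R \<Longrightarrow> h (x \<oplus>\<^bsub>R\<^esub> y) = h x \<oplus>\<^bsub>S\<^esub> h y"
    and "x \<in> carrier R"
  shows "h ([(k::int)] \<cdot>\<^bsub>R\<^esub> x) = [k] \<cdot>\<^bsub>S\<^esub> h x"
  using group_hom.hom_int_pow[OF additive_map_hom[OF assms(1-4)]] assms(5)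
  by (simp add: add_pow_def)

lemma additive_map_finsum:
  assumes R: "abelian_group R" and S: "abelian_group S"
    and h: "\<And>x. x \<in> carrier R \<Longrightarrow> h x \<in> carrier S"
      "\<And>x y. x \<in> carrier R \<Longrightarrow> y \<in> carrier R \<Longrightarrow> h (x \<oplus>\<^bsub>R\<^esub> y) = h x \<oplus>\<^bsub>S\<^esub> h y"
    and f: "\<And>i. i \<in> A \<Longrightarrow> f i \<in> carrier R"
  shows "h (finsum R f A) = (\<Oplus>\<^bsub>S\<^esub>i\<in>A. h (f i))"
proof -
  interpret R: abelian_group R by fact
  interpret S: abelian_group S by fact
  show ?thesis using f
  proof (induction A rule: infinite_finite_induct)
    case (insert i A)
    then show ?case
      by (simp add: R.finsum_insert S.finsum_insert Pi_def h R.finsum_closed)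
  qed (simp_all add: R.finsum_infinite S.finsum_infinite R.finsum_empty S.finsum_empty
        additive_map_zero[OF R S h])
qed

text \<open>
  Two homogeneous decompositions of an element are compared on the union of their supports, where
  independence makes their difference vanish.
\<close>

lemma (in ring) deg_decompI:
  fixes G :: "int \<Rightarrow> 'a set"
  assumes G: "\<And>n. additive_subgroup (G n) R"
    and span: "\<exists>N f. finite N \<and> (\<forall>n\<in>N. f n \<in> G n) \<and> x = (\<Oplus>n\<in>N. f n)"
    and indep: "\<And>N f n. finite N \<Longrightarrow> (\<And>n. n \<in> N \<Longrightarrow> f n \<in> G n) \<Longrightarrow> (\<Oplus>n\<in>N. f n) = \<zero>
          \<Longrightarrow> n \<in> N \<Longrightarrow> f n = \<zero>"
  shows "\<exists>!f. (\<forall>n. f n \<in> G n) \<and> finite {n. f n \<noteq> \<zero>} \<and> x = (\<Oplus>n\<in>{n. f n \<noteq> \<zero>}. f n)"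
proof -
  have Gc: "y \<in> carrier R" if "y \<in> G n" for y n
    using additive_subgroup.a_Hcarr[OF G that] .
  have support: "(\<Oplus>n\<in>{n. f n \<noteq> \<zero>}. f n) = (\<Oplus>n\<in>N. f n)"
    if "\<And>n. f n \<in> G n" "finite N" "{n. f n \<noteq> \<zero>} \<subseteq> N" for f N
    using that Gc by (intro add.finprod_mono_neutral_cong_left) (auto simp: Pi_def)
  from span obtain N f where N: "finite N" "\<And>n. n \<in> N \<Longrightarrow> f n \<in> G n" "x = (\<Oplus>n\<in>N. f n)"
    by blast
  define f' where "f' = (\<lambda>n. if n \<in> N then f n else \<zero>)"
  have f'G: "f' n \<in> G n" for n
    using N(2) additive_subgroup.zero_closed[OF G] by (simp add: f'_def)
  have f'N: "{n. f' n \<noteq> \<zero>} \<subseteq> N" by (auto simp: f'_def)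
  have xN: "x = (\<Oplus>n\<in>N. f' n)"
    unfolding N(3) using Gc[OF f'G] by (intro add.finprod_cong') (auto simp: f'_def)
  show ?thesis
  proof (rule ex1I[of _ f'])
    from xN show "(\<forall>n. f' n \<in> G n) \<and> finite {n. f' n \<noteq> \<zero>} \<and> x = (\<Oplus>n\<in>{n. f' n \<noteq> \<zero>}. f' n)"
      using f'G support[OF f'G N(1) f'N] finite_subset[OF f'N N(1)] by simp
  next
    fix g assume g: "(\<forall>n. g n \<in> G n) \<and> finite {n. g n \<noteq> \<zero>} \<and> x = (\<Oplus>n\<in>{n. g n \<noteq> \<zero>}. g n)"
    define M where "M = N \<union> {n. g n \<noteq> \<zero>}"
    have M: "finite M" "{n. f' n \<noteq> \<zero>} \<subseteq> M" "{n. g n \<noteq> \<zero>} \<subseteq> M"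
      using g N(1) f'N by (auto simp: M_def)
    have xf: "x = (\<Oplus>n\<in>M. f' n)"
      using support[OF f'G M(1,2)] support[OF f'G N(1) f'N] xN by simp
    have xg: "x = (\<Oplus>n\<in>M. g n)" using support[of g M] M g by auto
    have gG: "g n \<in> G n" for n using g by blast
    have "(\<Oplus>n\<in>M. f' n \<ominus> g n) = (\<Oplus>n\<in>M. f' n) \<ominus> (\<Oplus>n\<in>M. g n)"
    proof -
      have "(\<Oplus>n\<in>M. f' n \<ominus> g n) = (\<Oplus>n\<in>M. f' n) \<oplus> (\<Oplus>n\<in>M. \<ominus> g n)"
        unfolding a_minus_def using Gc[OF f'G] Gc[OF gG] by (intro add.finprod_multf) auto
      also have "(\<Oplus>n\<in>M. \<ominus> g n) = \<ominus> (\<Oplus>n\<in>M. g n)"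
        using additive_map_finsum[where h="\<lambda>x. \<ominus> x" and R=R and S=R and A=M and f=g] Gc[OF gG]
        by (simp add: minus_add abelian_group_axioms)
      finally show ?thesis by (simp add: a_minus_def)
    qed
    also have "\<dots> = \<zero>"
    proof -
      have "(\<Oplus>n\<in>M. g n) \<in> carrier R" using Gc[OF gG] by (intro finsum_closed) auto
      then show ?thesis using xf xg by (simp add: r_neg a_minus_def)
    qed
    finally have z: "(\<Oplus>n\<in>M. f' n \<ominus> g n) = \<zero>" .
    have "f' n \<ominus> g n = \<zero>" if "n \<in> M" for n
      by (rule indep[OF M(1) _ z that])
        (auto simp: a_minus_def intro!: additive_subgroup.a_closed[OF G] f'G
          additive_subgroup.a_inv_closed[OF G] gG)
    moreover have "f' n = \<zero> \<and> g n = \<zero>" if "n \<notin> M" for n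
      using that M by blast
    ultimately show "g = f'"
      using r_right_minus_eq[OF Gc[OF f'G] Gc[OF gG]] by (intro ext) metis
  qed
qed

context graded_comm_ring begin

lemma deg_carrier: "x \<in> G n \<Longrightarrow> x \<in> carrier R"
  using additive_subgroup.a_Hcarr[OF deg_subgroup] .

lemma homogeneous_sum:
  assumes "x \<in> carrier R"
  obtains N f where "finite N" "\<And>n. f n \<in> G n" "x = (\<Oplus>n\<in>N. f n)"
  using deg_decomp[OF assms] by blast

lemma homogeneous_independent:
  assumes "finite N" "\<And>n. n \<in> N \<Longrightarrow> f n \<in> G n" "(\<Oplus>n\<in>N. f n) = \<zero>" "n \<in> N"
  shows "f n = \<zero>"
proof -
  \<comment> \<open>Extension by zero, to compare with the decomposition of zero whose components all vanish.\<close>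
  define f' where "f' = (\<lambda>n. if n \<in> N then f n else \<zero>)"
  have f'G: "f' n \<in> G n" for n
    using assms(2) additive_subgroup.zero_closed[OF deg_subgroup] by (simp add: f'_def)
  have sub: "{n. f' n \<noteq> \<zero>} \<subseteq> N" by (auto simp: f'_def)
  have "(\<Oplus>n\<in>{n. f' n \<noteq> \<zero>}. f' n) = (\<Oplus>n\<in>N. f n)"
    using assms sub deg_carrier
    by (intro add.finprod_mono_neutral_cong_left) (auto simp: f'_def Pi_def)
  then have 1: "(\<forall>n. f' n \<in> G n) \<and> finite {n. f' n \<noteq> \<zero>} \<and> \<zero> = (\<Oplus>n\<in>{n. f' n \<noteq> \<zero>}. f' n)"
    using f'G finite_subset[OF sub assms(1)] assms(3) by simp
  have 2: "(\<forall>n. \<zero> \<in> G n) \<and> finite {n::int. \<zero> \<noteq> \<zero>} \<and> \<zero> = (\<Oplus>n\<in>{n::int. \<zero> \<noteq> \<zero>}. \<zero>)"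
    using additive_subgroup.zero_closed[OF deg_subgroup] by (simp add: finsum_empty)
  have uniq: "a = b" if "\<exists>!x. P x" "P a" "P b" for P and a b :: "int \<Rightarrow> 'a"
    using that by blast
  have "f' = (\<lambda>_. \<zero>)"
    by (rule uniq[OF deg_decomp[OF zero_closed] 1 2])
  then show ?thesis using assms(4) unfolding f'_def by meson
qed

end

text \<open>
  The degree \<open>e\<close> is a parameter because the theory is applied to the Koszul differential, which
  raises degrees by 1, and to \<open>d'\<close>, which lowers them by 1.  The sign in the Leibniz rule is the usual
  one for all odd \<open>e\<close>.
\<close>

locale graded_diff_ring = graded_comm_ring R G for R (structure) and G +
  fixes d :: "'a \<Rightarrow> 'a" and e :: int
  assumes odd_degree: "odd e"
    and diff_add: "\<And>x y. x \<in> carrier R \<Longrightarrow> y \<in> carrier R \<Longrightarrow> d (x \<oplus> y) = d x \<oplus> d y"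
    and diff_deg: "\<And>n x. x \<in> G n \<Longrightarrow> d x \<in> G (n + e)"
    and diff_diff: "\<And>x. x \<in> carrier R \<Longrightarrow> d (d x) = \<zero>"
    and leibniz: "\<And>p x y. x \<in> G p \<Longrightarrow> y \<in> carrier R \<Longrightarrow>
          d (x \<otimes> y) = (d x \<otimes> y) \<oplus> (if even p then x \<otimes> d y else \<ominus> (x \<otimes> d y))"
begin

lemma G_zero: "\<zero> \<in> G n"
  using additive_subgroup.zero_closed[OF deg_subgroup] .

lemma G_add: "x \<in> G n \<Longrightarrow> y \<in> G n \<Longrightarrow> x \<oplus> y \<in> G n"
  using additive_subgroup.a_closed[OF deg_subgroup] .

lemma G_minus: "x \<in> G n \<Longrightarrow> \<ominus> x \<in> G n"
  using additive_subgroup.a_inv_closed[OF deg_subgroup] .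

text \<open>
  The axioms place \<open>d x\<close> in the carrier only for homogeneous \<open>x\<close>.  Closure in general is deduced from
  this lemma, which for that reason does not yet treat \<open>d\<close> as a homomorphism.
\<close>

lemma diff_finsum_homogeneous:
  assumes "finite N" "\<And>n. n \<in> N \<Longrightarrow> f n \<in> G n"
  shows "d (\<Oplus>n\<in>N. f n) = (\<Oplus>n\<in>N. d (f n)) \<and> d \<zero> = \<zero>"
proof -
  have z: "d \<zero> = \<zero>"
  proof -
    have "d \<zero> \<in> carrier R" using diff_deg[OF G_zero[of 0]] deg_carrier by blast
    moreover have "d \<zero> \<oplus> d \<zero> = d \<zero>" using diff_add[of \<zero> \<zero>] by simp
    ultimately show ?thesis using add.r_cancel_one by blast
  qed
  show ?thesis using assms
  proof (induction N)
    case empty then show ?case using z by (simp add: finsum_empty)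
  next
    case (insert n N)
    have f: "f i \<in> carrier R" "d (f i) \<in> carrier R" if "i \<in> insert n N" for i
      using insert(4)[OF that] diff_deg deg_carrier by blast+
    then show ?case using insert
      by (simp add: finsum_insert Pi_def diff_add finsum_closed)
  qed
qed

lemma diff_closed: assumes "x \<in> carrier R" shows "d x \<in> carrier R"
proof -
  obtain N f where N: "finite N" "\<And>n. f n \<in> G n" "x = (\<Oplus>n\<in>N. f n)"
    using homogeneous_sum[OF assms] by blast
  have "d x = (\<Oplus>n\<in>N. d (f n))" unfolding N(3) using diff_finsum_homogeneous N(1,2) by blast
  also have "\<dots> \<in> carrier R"
    using deg_carrier[OF diff_deg[OF N(2)]] by (intro finsum_closed) auto
  finally show ?thesis .
qed

lemma diff_zero: "d \<zero> = \<zero>"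
  using diff_finsum_homogeneous[of "{}"] by simp

lemma diff_minus: "x \<in> carrier R \<Longrightarrow> d (\<ominus> x) = \<ominus> d x"
  by (rule additive_map_minus) (auto simp: diff_closed diff_add abelian_group_axioms)

lemma diff_finsum: "(\<And>i. i \<in> A \<Longrightarrow> f i \<in> carrier R) \<Longrightarrow> d (\<Oplus>i\<in>A. f i) = (\<Oplus>i\<in>A. d (f i))"
  by (rule additive_map_finsum) (auto simp: diff_closed diff_add abelian_group_axioms)

lemma diff_one: "d \<one> = \<zero>"
proof -
  have "d \<one> \<oplus> d \<one> = d \<one>"
    using leibniz[OF deg_one one_closed] diff_closed[OF one_closed] by simp
  then show ?thesis using add.r_cancel_one diff_closed[OF one_closed] by blast
qed

text \<open>
  The Leibniz rule is an axiom for homogeneous left factors.  This induction extends its consequences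
  to all elements.
\<close>

lemma homogeneous_induct [consumes 1, case_names homogeneous add]:
  assumes "x \<in> carrier R" and "\<And>n y. y \<in> G n \<Longrightarrow> P y"
    and "\<And>y z. y \<in> carrier R \<Longrightarrow> z \<in> carrier R \<Longrightarrow> P y \<Longrightarrow> P z \<Longrightarrow> P (y \<oplus> z)"
  shows "P x"
proof -
  obtain N f where N: "finite N" "\<And>n. f n \<in> G n" "x = (\<Oplus>n\<in>N. f n)"
    using homogeneous_sum[OF assms(1)] by blast
  have "P (\<Oplus>n\<in>N. f n)" using N(1)
  proof induction
    case empty then show ?case using assms(2)[OF G_zero] by (simp add: finsum_empty)
  next
    case (insert n N)
    then show ?case using assms(2)[OF N(2)] assms(3) deg_carrier[OF N(2)]
      by (simp add: finsum_insert Pi_def finsum_closed)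
  qed
  then show ?thesis using N(3) by simp
qed

text \<open>
  The differentials of the components lie in different degrees, so they vanish separately.
\<close>

lemma cocycle_components:
  assumes "x \<in> carrier R" "d x = \<zero>"
  obtains N f where "finite N" "\<And>n. f n \<in> G n" "\<And>n. n \<in> N \<Longrightarrow> d (f n) = \<zero>" "x = (\<Oplus>n\<in>N. f n)"
proof -
  obtain N f where N: "finite N" "\<And>n. f n \<in> G n" "x = (\<Oplus>n\<in>N. f n)"
    using homogeneous_sum[OF assms(1)] by blast
  have fc: "d (f n) \<in> carrier R" for n using diff_deg[OF N(2)] deg_carrier by blast
  have "d (f n) = \<zero>" if "n \<in> N" for n
  proof -
    have "(\<Oplus>k\<in>(\<lambda>n. n + e) ` N. d (f (k - e))) = (\<Oplus>n\<in>N. d (f n))"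
      using add.finprod_reindex[of "\<lambda>k. d (f (k - e))" "\<lambda>n. n + e" N] fc by (simp add: Pi_def)
    also have "\<dots> = \<zero>"
      using assms(2) diff_finsum[of N f] deg_carrier[OF N(2)] unfolding N(3) by simp
    finally have "d (f ((n + e) - e)) = \<zero>"
      using N(1) that diff_deg[OF N(2)]
      by (intro homogeneous_independent[of "(\<lambda>n. n + e) ` N" "\<lambda>k. d (f (k - e))"]) fastforce+
    then show ?thesis by simp
  qed
  then show thesis using that N by blast
qed

definition cocycles :: "'a set" where "cocycles = {x \<in> carrier R. d x = \<zero>}"

lemma cocycle_ring_eq: "cocycle_ring R d = R\<lparr>carrier := cocycles\<rparr>"
  by (simp add: cocycle_ring_def cocycles_def)

lemma cocycle_mult:
  assumes "x \<in> cocycles" "y \<in> cocycles" shows "x \<otimes> y \<in> cocycles"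
proof -
  have x: "x \<in> carrier R" "d x = \<zero>" and y: "y \<in> carrier R" "d y = \<zero>"
    using assms by (auto simp: cocycles_def)
  obtain N f where N: "finite N" "\<And>n. f n \<in> G n" "\<And>n. n \<in> N \<Longrightarrow> d (f n) = \<zero>" "x = (\<Oplus>n\<in>N. f n)"
    using cocycle_components[OF x] by blast
  note fc = deg_carrier[OF N(2)]
  have "x \<otimes> y = (\<Oplus>n\<in>N. f n \<otimes> y)"
    unfolding N(4) using N(1) y fc by (intro finsum_ldistr) auto
  moreover have "d (f n \<otimes> y) = \<zero>" if "n \<in> N" for n
    using leibniz[OF N(2) y(1), of n] N(3)[OF that] y fc by simp
  ultimately have "d (x \<otimes> y) = \<zero>"
    using diff_finsum[of N "\<lambda>n. f n \<otimes> y"] y fc by (simp add: add.finprod_one_eqI)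
  then show ?thesis using x y by (simp add: cocycles_def)
qed

lemma cocycles_subring: "subring cocycles R"
  by (rule subringI)
    (auto simp: cocycle_mult, auto simp: cocycles_def diff_one diff_minus diff_add)

lemma cocycle_ring_is_ring: "ring (cocycle_ring R d)"
  unfolding cocycle_ring_eq using subring_is_ring[OF cocycles_subring] .

lemma leibniz_right_boundary:
  assumes "y \<in> carrier R" "x \<in> cocycles"
  shows "x \<otimes> d y \<in> d ` carrier R"
proof -
  have x: "x \<in> carrier R" "d x = \<zero>" using assms by (auto simp: cocycles_def)
  obtain N f where N: "finite N" "\<And>n. f n \<in> G n" "\<And>n. n \<in> N \<Longrightarrow> d (f n) = \<zero>" "x = (\<Oplus>n\<in>N. f n)"
    using cocycle_components[OF x] by blast
  note fc = deg_carrier[OF N(2)] and dy = diff_closed[OF assms(1)]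
  \<comment> \<open>The sign in the Leibniz rule depends on the degree, so it is moved into the primitive of each component.\<close>
  let ?g = "\<lambda>n. if even n then f n \<otimes> y else \<ominus> (f n \<otimes> y)"
  have "x \<otimes> d y = (\<Oplus>n\<in>N. f n \<otimes> d y)"
    unfolding N(4) using N(1) dy fc by (intro finsum_ldistr) auto
  also have "\<dots> = (\<Oplus>n\<in>N. d (?g n))"
  proof (intro add.finprod_cong' refl)
    fix n assume "n \<in> N"
    then show "f n \<otimes> d y = d (?g n)"
      using leibniz[OF N(2) assms(1), of n] N(3) fc assms(1) dy by (simp add: diff_minus)
  qed (auto simp: diff_closed fc assms)
  also have "\<dots> = d (\<Oplus>n\<in>N. ?g n)"
    by (rule diff_finsum[symmetric]) (auto simp: fc assms)
  finally show ?thesis using fc assms by (auto intro!: imageI finsum_closed)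
qed

lemma leibniz_left_boundary:
  assumes "y \<in> carrier R" "x \<in> cocycles"
  shows "d y \<otimes> x \<in> d ` carrier R"
proof -
  have x: "x \<in> carrier R" "d x = \<zero>" using assms by (auto simp: cocycles_def)
  have "d y \<otimes> x = d (y \<otimes> x)"
    using assms(1)
  proof (induction rule: homogeneous_induct)
    case (homogeneous n y)
    then show ?case
      using leibniz[OF homogeneous x(1)] x deg_carrier[OF homogeneous]
        diff_closed[OF deg_carrier[OF homogeneous]] by simp
  next
    case (add y z)
    then show ?case using x by (simp add: l_distr diff_add diff_closed)
  qed
  then show ?thesis using x assms by blast
qed

theorem boundaries_ideal: "ideal (d ` carrier R) (cocycle_ring R d)"
proof (rule idealI[OF cocycle_ring_is_ring])
  have sub: "d ` carrier R \<subseteq> cocycles" by (auto simp: cocycles_def diff_closed diff_diff)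
  interpret Z: ring "cocycle_ring R d" by (rule cocycle_ring_is_ring)
  show "subgroup (d ` carrier R) (add_monoid (cocycle_ring R d))"
  proof (rule group.subgroupI[OF abelian_group.a_group[OF Z.abelian_group_axioms]])
    show "d ` carrier R \<subseteq> carrier (add_monoid (cocycle_ring R d))"
      using sub by (simp add: cocycle_ring_eq)
    show "d ` carrier R \<noteq> {}" by auto
    fix b assume "b \<in> d ` carrier R"
    then obtain x where x: "x \<in> carrier R" "b = d x" by blast
    have "b \<in> cocycles" using sub x by blast
    have "\<ominus>\<^bsub>cocycle_ring R d\<^esub> b = \<ominus> b"
    proof (rule Z.minus_equality)
      show "\<ominus> b \<oplus>\<^bsub>cocycle_ring R d\<^esub> b = \<zero>\<^bsub>cocycle_ring R d\<^esub>"
        using x by (simp add: cocycle_ring_eq diff_closed l_neg)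
    qed (use \<open>b \<in> cocycles\<close> subringE(5)[OF cocycles_subring] in \<open>auto simp: cocycle_ring_eq\<close>)
    then show "inv\<^bsub>add_monoid (cocycle_ring R d)\<^esub> b \<in> d ` carrier R"
      using x diff_minus[of x] by (auto simp: a_inv_def intro!: image_eqI[of _ d "\<ominus> x"])
    fix c assume "c \<in> d ` carrier R"
    then obtain y where y: "y \<in> carrier R" "c = d y" by blast
    show "b \<otimes>\<^bsub>add_monoid (cocycle_ring R d)\<^esub> c \<in> d ` carrier R"
      using x y diff_add[of x y] by (auto simp: cocycle_ring_eq intro!: image_eqI[of _ d "x \<oplus> y"])
  qed
  fix b z assume "b \<in> d ` carrier R" "z \<in> carrier (cocycle_ring R d)"
  then show "z \<otimes>\<^bsub>cocycle_ring R d\<^esub> b \<in> d ` carrier R"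
    and "b \<otimes>\<^bsub>cocycle_ring R d\<^esub> z \<in> d ` carrier R"
    using leibniz_left_boundary leibniz_right_boundary by (auto simp: cocycle_ring_eq)
qed

abbreviation H :: "'a set ring" where "H \<equiv> cohomology_ring R d"
abbreviation cls :: "'a \<Rightarrow> 'a set" where "cls \<equiv> cohomology_class R d"
abbreviation H_deg :: "int \<Rightarrow> 'a set set" where "H_deg \<equiv> cohomology_deg R G d"

lemma cohomology_is_ring: "ring H"
  unfolding cohomology_ring_def by (rule ideal.quotient_is_ring[OF boundaries_ideal])

lemma class_hom: "cls \<in> ring_hom (cocycle_ring R d) H"
  unfolding cohomology_ring_def cohomology_class_def[abs_def]
  using ideal.rcos_ring_hom[OF boundaries_ideal] .

lemma cohomology_carrier: "carrier H = cls ` cocycles"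
  by (auto simp: cohomology_ring_def FactRing_def A_RCOSETS_def' cohomology_class_def cocycle_ring_eq)

lemma cocycle_carrier: "x \<in> cocycles \<Longrightarrow> x \<in> carrier R"
  by (simp add: cocycles_def)

lemma boundary_cocycle: "x \<in> carrier R \<Longrightarrow> d x \<in> cocycles"
  by (simp add: cocycles_def diff_closed diff_diff)

lemma cocycle_closed:
  "\<zero> \<in> cocycles" "\<one> \<in> cocycles"
  "x \<in> cocycles \<Longrightarrow> \<ominus> x \<in> cocycles"
  "x \<in> cocycles \<Longrightarrow> y \<in> cocycles \<Longrightarrow> x \<oplus> y \<in> cocycles"
  by (auto simp: cocycles_def diff_zero diff_one diff_minus diff_add)

lemma cocycle_finsum: "(\<And>i. i \<in> A \<Longrightarrow> f i \<in> cocycles) \<Longrightarrow> (\<Oplus>i\<in>A. f i) \<in> cocycles"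
  by (induction A rule: infinite_finite_induct)
    (auto simp: finsum_infinite finsum_empty finsum_insert cocycle_closed cocycle_carrier Pi_def)

lemma class_closed: "x \<in> cocycles \<Longrightarrow> cls x \<in> carrier H"
  by (simp add: cohomology_carrier)

lemma class_add: "x \<in> cocycles \<Longrightarrow> y \<in> cocycles \<Longrightarrow> cls (x \<oplus> y) = cls x \<oplus>\<^bsub>H\<^esub> cls y"
  using ring_hom_add[OF class_hom] by (simp add: cocycle_ring_eq)

lemma class_mult: "x \<in> cocycles \<Longrightarrow> y \<in> cocycles \<Longrightarrow> cls (x \<otimes> y) = cls x \<otimes>\<^bsub>H\<^esub> cls y"
  using ring_hom_mult[OF class_hom] by (simp add: cocycle_ring_eq)

lemma class_one: "cls \<one> = \<one>\<^bsub>H\<^esub>"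
  using ring_hom_one[OF class_hom] by (simp add: cocycle_ring_eq)

lemma class_zero: "cls \<zero> = \<zero>\<^bsub>H\<^esub>"
  using ring_hom_zero[OF class_hom cocycle_ring_is_ring cohomology_is_ring]
  by (simp add: cocycle_ring_eq)

lemma class_group_hom: "group_hom (add_monoid (cocycle_ring R d)) (add_monoid H) cls"
  by (intro additive_map_hom)
    (simp_all add: cohomology_is_ring cocycle_ring_is_ring ring.is_abelian_group,
      simp_all add: cocycle_ring_eq class_closed class_add)

lemma class_int_mult:
  assumes "x \<in> cocycles" shows "cls ([(k::int)] \<cdot> x) = [k] \<cdot>\<^bsub>H\<^esub> cls x"
proof -
  have "[k] \<cdot>\<^bsub>cocycle_ring R d\<^esub> x = [k] \<cdot> x"
    using add.int_pow_consistent[OF subring.axioms(1)[OF cocycles_subring], of x k] assms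
    by (simp add: add_pow_def cocycle_ring_eq)
  then show ?thesis
    using group_hom.hom_int_pow[OF class_group_hom, of x k] assms
    by (simp add: add_pow_def cocycle_ring_eq)
qed

lemma class_minus:
  assumes "x \<in> cocycles" shows "cls (\<ominus> x) = \<ominus>\<^bsub>H\<^esub> cls x"
proof -
  interpret H: ring H by (rule cohomology_is_ring)
  have "cls (\<ominus> x) \<oplus>\<^bsub>H\<^esub> cls x = \<zero>\<^bsub>H\<^esub>"
    using class_add[of "\<ominus> x" x] assms cocycle_closed(3) cocycle_carrier
    by (simp add: l_neg class_zero)
  then show ?thesis
    using H.minus_equality assms cocycle_closed(3) class_closed by metis
qed

lemma class_finsum:
  assumes "\<And>i. i \<in> A \<Longrightarrow> f i \<in> cocycles"
  shows "cls (\<Oplus>i\<in>A. f i) = (\<Oplus>\<^bsub>H\<^esub>i\<in>A. cls (f i))"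
proof -
  interpret H: ring H by (rule cohomology_is_ring)
  show ?thesis using assms
  proof (induction A rule: infinite_finite_induct)
    case (insert i A)
    then show ?case
      by (simp add: finsum_insert H.finsum_insert Pi_def cocycle_carrier class_closed
          class_add cocycle_finsum)
  qed (simp_all add: finsum_infinite finsum_empty H.finsum_infinite H.finsum_empty class_zero)
qed

lemma class_eq_iff:
  assumes "x \<in> cocycles" "y \<in> cocycles"
  shows "cls x = cls y \<longleftrightarrow> x \<ominus> y \<in> d ` carrier R"
proof -
  interpret Z: ring "cocycle_ring R d" by (rule cocycle_ring_is_ring)
  have "\<ominus>\<^bsub>cocycle_ring R d\<^esub> y = \<ominus> y"
    using assms cocycle_closed(3)[OF assms(2)]
    by (intro Z.minus_equality) (auto simp: cocycle_ring_eq l_neg cocycle_carrier)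
  then have "x \<ominus>\<^bsub>cocycle_ring R d\<^esub> y = x \<ominus> y"
    by (simp add: a_minus_def, simp add: cocycle_ring_eq)
  then show ?thesis
    using Z.quotient_eq_iff_same_a_r_cos[OF boundaries_ideal, of x y] assms
    by (simp add: cohomology_class_def cocycle_ring_eq)
qed

lemma class_boundary: "x \<in> carrier R \<Longrightarrow> cls (d x) = \<zero>\<^bsub>H\<^esub>"
  using class_eq_iff[OF boundary_cocycle cocycle_closed(1)]
  by (simp add: class_zero[symmetric] a_minus_def diff_closed)

lemma H_deg_eq: "H_deg n = cls ` (G n \<inter> cocycles)"
  by (simp add: cohomology_deg_def cocycle_ring_eq)

lemma H_deg_subgroup: "additive_subgroup (H_deg n) H"
proof -
  interpret H: ring H by (rule cohomology_is_ring)
  show ?thesis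
  proof (rule additive_subgroup.intro, rule group.subgroupI[OF abelian_group.a_group[OF H.abelian_group_axioms]])
    show "H_deg n \<subseteq> carrier (add_monoid H)" by (auto simp: H_deg_eq class_closed)
    show "H_deg n \<noteq> {}" using G_zero cocycle_closed(1) by (auto simp: H_deg_eq)
    fix a assume "a \<in> H_deg n"
    then obtain x where x: "x \<in> G n" "x \<in> cocycles" "a = cls x" by (auto simp: H_deg_eq)
    have "inv\<^bsub>add_monoid H\<^esub> a = cls (\<ominus> x)"
      unfolding class_minus[OF x(2)] x(3) a_inv_def[of H] ..
    then show "inv\<^bsub>add_monoid H\<^esub> a \<in> H_deg n"
      using x G_minus cocycle_closed(3) by (auto simp: H_deg_eq)
    fix b assume "b \<in> H_deg n"
    then obtain y where y: "y \<in> G n" "y \<in> cocycles" "b = cls y" by (auto simp: H_deg_eq)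
    show "a \<otimes>\<^bsub>add_monoid H\<^esub> b \<in> H_deg n"
      using x y class_add[OF x(2) y(2)] G_add cocycle_closed(4)
      by (auto simp: H_deg_eq intro!: image_eqI[of _ cls "x \<oplus> y"])
  qed
qed

text \<open>If a sum of homogeneous cocycles of different degrees is a boundary, comparing degrees
  shows that each of them is the boundary of a homogeneous element.\<close>

lemma H_deg_independent:
  assumes N: "finite N" and f: "\<And>n. n \<in> N \<Longrightarrow> f n \<in> H_deg n"
    and z: "(\<Oplus>\<^bsub>H\<^esub>n\<in>N. f n) = \<zero>\<^bsub>H\<^esub>" and n: "n \<in> N"
  shows "f n = \<zero>\<^bsub>H\<^esub>"
proof -
  interpret H: ring H by (rule cohomology_is_ring)
  have "\<forall>n\<in>N. \<exists>x. x \<in> G n \<inter> cocycles \<and> f n = cls x" using f by (auto simp: H_deg_eq)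
  then obtain x0 where x0: "\<And>n. n \<in> N \<Longrightarrow> x0 n \<in> G n" "\<And>n. n \<in> N \<Longrightarrow> x0 n \<in> cocycles"
    "\<And>n. n \<in> N \<Longrightarrow> f n = cls (x0 n)" by (metis IntD1 IntD2)
  define x where "x = (\<lambda>n. if n \<in> N then x0 n else \<zero>)"
  have x: "x n \<in> G n" "x n \<in> cocycles" "x n \<in> carrier R" for n
    using x0 G_zero by (auto simp: x_def cocycle_closed cocycle_carrier)
  have "cls (\<Oplus>n\<in>N. x n) = (\<Oplus>\<^bsub>H\<^esub>n\<in>N. f n)"
    unfolding class_finsum[OF x(2)]
  proof (intro H.add.finprod_cong' refl funcsetI)
    fix n assume "n \<in> N"
    then show "cls (x n) = f n" "f n \<in> carrier H"
      using x0 class_closed by (auto simp: x_def)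
  qed
  then have "cls (\<Oplus>n\<in>N. x n) = cls \<zero>" using z by (simp add: class_zero)
  moreover have "(\<Oplus>n\<in>N. x n) \<in> cocycles" by (rule cocycle_finsum) (rule x(2))
  ultimately have "(\<Oplus>n\<in>N. x n) \<ominus> \<zero> \<in> d ` carrier R"
    using class_eq_iff[OF _ cocycle_closed(1)] by blast
  then obtain y where y: "y \<in> carrier R" "(\<Oplus>n\<in>N. x n) = d y"
    using x by (auto simp: a_minus_def finsum_closed)
  obtain M g0 where g0: "finite M" "\<And>n. g0 n \<in> G n" "y = (\<Oplus>n\<in>M. g0 n)"
    using homogeneous_sum[OF y(1)] by blast
  \<comment> \<open>Reindexed by the degree of the boundary instead of that of its primitive.\<close>
  define b where "b = (\<lambda>n. if n - e \<in> M then d (g0 (n - e)) else \<zero>)"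
  have b: "b n \<in> G n" "b n \<in> d ` carrier R" "b n \<in> carrier R" for n
    using diff_deg[OF g0(2), of "n - e"] G_zero deg_carrier[OF g0(2)]
    by (auto simp: b_def diff_closed diff_zero intro: image_eqI[of _ d \<zero>])
  define T where "T = N \<union> (\<lambda>n. n + e) ` M"
  have T: "finite T" "N \<subseteq> T" "(\<lambda>n. n + e) ` M \<subseteq> T" using N g0(1) by (auto simp: T_def)
  have xT: "(\<Oplus>n\<in>T. x n) = (\<Oplus>n\<in>N. x n)"
    using x T by (intro add.finprod_mono_neutral_cong_right) (auto simp: x_def Pi_def)
  have "(\<Oplus>n\<in>T. b n) = (\<Oplus>n\<in>(\<lambda>n. n + e) ` M. b n)"
    using b T by (intro add.finprod_mono_neutral_cong_right) (auto simp: b_def Pi_def image_iff)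
  also have "\<dots> = (\<Oplus>n\<in>M. b (n + e))"
    using b(3) by (intro add.finprod_reindex) auto
  also have "\<dots> = (\<Oplus>n\<in>M. d (g0 n))"
    using diff_closed[OF deg_carrier[OF g0(2)]] by (intro add.finprod_cong') (auto simp: b_def)
  also have "\<dots> = d y"
    unfolding g0(3) using deg_carrier[OF g0(2)] by (rule diff_finsum[symmetric])
  finally have bT: "(\<Oplus>n\<in>T. b n) = d y" .
  have "(\<Oplus>n\<in>T. x n \<oplus> \<ominus> b n) = (\<Oplus>n\<in>T. x n) \<oplus> (\<Oplus>n\<in>T. \<ominus> b n)"
    using x b by (intro add.finprod_multf) auto
  also have "(\<Oplus>n\<in>T. \<ominus> b n) = \<ominus> (\<Oplus>n\<in>T. b n)"
    by (rule additive_map_finsum[symmetric])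
      (auto simp: minus_add abelian_group_axioms b)
  finally have sum0: "(\<Oplus>n\<in>T. x n \<oplus> \<ominus> b n) = \<zero>"
    unfolding xT bT y(2) using diff_closed[OF y(1)] by (simp add: r_neg)
  have "x n \<oplus> \<ominus> b n = \<zero>"
    by (rule homogeneous_independent[OF T(1) _ sum0])
      (use x b n T in \<open>auto intro!: G_add G_minus\<close>)
  then have "x n \<ominus> \<zero> \<in> d ` carrier R"
    using x(3)[of n] b(2,3)[of n] r_right_minus_eq by (auto simp: a_minus_def)
  then have "cls (x n) = \<zero>\<^bsub>H\<^esub>"
    using class_eq_iff[OF x(2) cocycle_closed(1)] class_zero by simp
  then show ?thesis using x0 n by (simp add: x_def)
qed

text \<open>
  Each property is inherited from representatives; the decomposition of a class comes from the
  homogeneous components of a representing cocycle.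
\<close>

theorem cohomology_graded_comm_ring: "graded_comm_ring H H_deg"
proof -
  interpret H: ring H by (rule cohomology_is_ring)
  show ?thesis
  proof (intro graded_comm_ring.intro graded_comm_ring_axioms.intro)
    show "ring H" by (rule cohomology_is_ring)
    show "additive_subgroup (H_deg n) H" for n by (rule H_deg_subgroup)
    fix a assume "a \<in> carrier H"
    then obtain x where x: "x \<in> carrier R" "d x = \<zero>" "a = cls x"
      by (auto simp: cohomology_carrier cocycles_def)
    obtain N f where N: "finite N" "\<And>n. f n \<in> G n" "\<And>n. n \<in> N \<Longrightarrow> d (f n) = \<zero>" "x = (\<Oplus>n\<in>N. f n)"
      using cocycle_components[OF x(1,2)] by blast
    have fZ: "f n \<in> cocycles" if "n \<in> N" for n
      using N(2,3) that deg_carrier by (auto simp: cocycles_def)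
    have "a = (\<Oplus>\<^bsub>H\<^esub>n\<in>N. cls (f n))"
      unfolding x(3) N(4) by (rule class_finsum) (rule fZ)
    moreover have "\<forall>n\<in>N. cls (f n) \<in> H_deg n" using N(2) fZ by (auto simp: H_deg_eq)
    ultimately have "\<exists>N f. finite N \<and> (\<forall>n\<in>N. f n \<in> H_deg n) \<and> a = (\<Oplus>\<^bsub>H\<^esub>n\<in>N. f n)"
      using N(1) by (intro exI[of _ N] exI[of _ "\<lambda>n. cls (f n)"]) simp
    then show "\<exists>!f. (\<forall>n. f n \<in> H_deg n) \<and> finite {n. f n \<noteq> \<zero>\<^bsub>H\<^esub>} \<and> a = (\<Oplus>\<^bsub>H\<^esub>n\<in>{n. f n \<noteq> \<zero>\<^bsub>H\<^esub>}. f n)"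
    proof (rule H.deg_decompI[OF H_deg_subgroup])
      fix N f n assume "finite N" "\<And>n. n \<in> N \<Longrightarrow> f n \<in> H_deg n" "(\<Oplus>\<^bsub>H\<^esub>n\<in>N. f n) = \<zero>\<^bsub>H\<^esub>" "n \<in> N"
      then show "f n = \<zero>\<^bsub>H\<^esub>" using H_deg_independent[where f=f and N=N] by blast
    qed
  next
    show "\<one>\<^bsub>H\<^esub> \<in> H_deg 0"
      using deg_one cocycle_closed(2) by (auto simp: class_one[symmetric] H_deg_eq)
  next
    fix p q a b assume "a \<in> H_deg p" "b \<in> H_deg q"
    then obtain x y where x: "x \<in> G p" "x \<in> cocycles" "a = cls x"
      and y: "y \<in> G q" "y \<in> cocycles" "b = cls y" by (auto simp: H_deg_eq)
    show "a \<otimes>\<^bsub>H\<^esub> b \<in> H_deg (p + q)"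
      using x y deg_mult cocycle_mult by (auto simp: H_deg_eq class_mult[symmetric])
    show "a \<otimes>\<^bsub>H\<^esub> b = (if even (p * q) then b \<otimes>\<^bsub>H\<^esub> a else \<ominus>\<^bsub>H\<^esub> (b \<otimes>\<^bsub>H\<^esub> a))"
      using graded_comm[OF x(1) y(1)] x y
      by (simp add: class_mult[symmetric] class_minus[symmetric] cocycle_mult)
  qed
qed

text \<open>A derivation that anticommutes with the differential maps cocycles to cocycles and
  boundaries to boundaries; the Leibniz rule passes to the classes.\<close>

theorem cohomology_graded_diff_ring:
  assumes d': "graded_diff_ring R G d' e'"
    and anti: "\<And>x. x \<in> carrier R \<Longrightarrow> d (d' x) = \<ominus> d' (d x)"
    and D: "\<And>x. x \<in> cocycles \<Longrightarrow> D (cls x) = cls (d' x)"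
  shows "graded_diff_ring H H_deg D e'"
proof -
  interpret d': graded_diff_ring R G d' e' by fact
  interpret H: graded_comm_ring H H_deg by (rule cohomology_graded_comm_ring)
  have Z: "d' x \<in> cocycles" if "x \<in> cocycles" for x
    using that anti[of x] by (auto simp: cocycles_def d'.diff_closed d'.diff_zero)
  show ?thesis
  proof
    show "odd e'" by (rule d'.odd_degree)
    show "D (a \<oplus>\<^bsub>H\<^esub> b) = D a \<oplus>\<^bsub>H\<^esub> D b" if "a \<in> carrier H" "b \<in> carrier H" for a b
    proof -
      from that obtain x y where "x \<in> cocycles" "a = cls x" "y \<in> cocycles" "b = cls y"
        by (auto simp: cohomology_carrier)
      then show ?thesis
        by (simp add: class_add[symmetric] D cocycle_closed d'.diff_add cocycle_carrier Z)
    qed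
    show "D a \<in> H_deg (n + e')" if "a \<in> H_deg n" for a n
      using that Z d'.diff_deg by (auto simp: H_deg_eq D)
    show "D (D a) = \<zero>\<^bsub>H\<^esub>" if "a \<in> carrier H" for a
      using that Z by (auto simp: cohomology_carrier D d'.diff_diff cocycle_carrier class_zero)
    fix p a b assume "a \<in> H_deg p" "b \<in> carrier H"
    then obtain x y where x: "x \<in> G p" "x \<in> cocycles" "a = cls x"
      and y: "y \<in> cocycles" "b = cls y" by (auto simp: H_deg_eq cohomology_carrier)
    show "D (a \<otimes>\<^bsub>H\<^esub> b) = D a \<otimes>\<^bsub>H\<^esub> b \<oplus>\<^bsub>H\<^esub>
        (if even p then a \<otimes>\<^bsub>H\<^esub> D b else \<ominus>\<^bsub>H\<^esub> (a \<otimes>\<^bsub>H\<^esub> D b))"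
      using d'.leibniz[OF x(1) cocycle_carrier[OF y(1)]] x y Z
      by (simp add: class_mult[symmetric] class_minus[symmetric] class_add[symmetric] D
          cocycle_mult cocycle_closed)
  qed
qed

end

lemma cdga_iff_graded_diff_ring: "cdga R G d \<longleftrightarrow> graded_diff_ring R G d (-1)"
  by (simp add: cdga_def graded_diff_ring_def cdga_axioms_def graded_diff_ring_axioms_def)

section \<open>Signs\<close>

text \<open>
  One factor for each inversion.  In this form the sign is visibly multiplicative in both arguments.
\<close>

lemma shuffle_sign_prod:
  assumes "finite A" "finite B"
  shows "shuffle_sign A B = (\<Prod>a\<in>A. \<Prod>b\<in>B. if b < a then - 1 else 1)"
proof -
  have "(\<Prod>a\<in>A. \<Prod>b\<in>B. if b < a then - 1 else (1::int))
      = (\<Prod>p\<in>A \<times> B. if snd p < fst p then - 1 else 1)"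
    by (simp add: prod.cartesian_product case_prod_beta)
  also have "\<dots> = (\<Prod>p\<in>{p \<in> A \<times> B. snd p < fst p}. - 1)"
    by (subst prod.inter_filter) (use assms in auto)
  also have "{p \<in> A \<times> B. snd p < fst p} = {(a, b). a \<in> A \<and> b \<in> B \<and> b < a}" by auto
  finally show ?thesis by (simp add: shuffle_sign_def)
qed

lemma shuffle_sign_empty [simp]: "shuffle_sign {} B = 1" "shuffle_sign A {} = 1"
  by (simp_all add: shuffle_sign_def)

lemma shuffle_sign_Un_left:
  "finite A \<Longrightarrow> finite B \<Longrightarrow> finite C \<Longrightarrow> A \<inter> B = {} \<Longrightarrow>
    shuffle_sign (A \<union> B) C = shuffle_sign A C * shuffle_sign B C"
  by (simp add: shuffle_sign_prod prod.union_disjoint)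

lemma shuffle_sign_Un_right:
  "finite A \<Longrightarrow> finite B \<Longrightarrow> finite C \<Longrightarrow> B \<inter> C = {} \<Longrightarrow>
    shuffle_sign A (B \<union> C) = shuffle_sign A B * shuffle_sign A C"
  by (simp add: shuffle_sign_prod prod.union_disjoint prod.distrib)

lemma shuffle_sign_insert_left:
  "finite A \<Longrightarrow> finite C \<Longrightarrow> i \<notin> A \<Longrightarrow>
    shuffle_sign (insert i A) C = shuffle_sign {i} C * shuffle_sign A C"
  using shuffle_sign_Un_left[of "{i}" A C] by simp

lemma shuffle_sign_insert_right:
  "finite A \<Longrightarrow> finite B \<Longrightarrow> i \<notin> B \<Longrightarrow>
    shuffle_sign A (insert i B) = shuffle_sign A {i} * shuffle_sign A B"
  using shuffle_sign_Un_right[of A "{i}" B] by simp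

lemma shuffle_sign_square [simp]: "shuffle_sign A B * shuffle_sign A B = 1"
  by (simp add: shuffle_sign_def power_mult_distrib[symmetric])

lemma shuffle_sign_square' [simp]: "shuffle_sign A B * (shuffle_sign A B * x) = x"
  by (simp add: mult.assoc[symmetric])

text \<open>
  A pair of distinct numbers is an inversion in exactly one of its two orders.
\<close>

lemma shuffle_sign_swap:
  assumes "finite A" "finite B" "A \<inter> B = {}"
  shows "shuffle_sign A B = (- 1) ^ (card A * card B) * shuffle_sign B A"
proof -
  have "shuffle_sign A B * shuffle_sign B A
      = (\<Prod>a\<in>A. \<Prod>b\<in>B. (if b < a then - 1 else 1) * (if a < b then - 1 else 1))"
    using assms prod.swap[of "\<lambda>b a. if a < b then - 1 else (1::int)" A B]
    by (simp add: shuffle_sign_prod prod.distrib)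
  also have "\<dots> = (\<Prod>a\<in>A. \<Prod>b\<in>B. - 1)"
    using assms(3) by (intro prod.cong refl) auto
  also have "\<dots> = (- 1) ^ (card A * card B)" by (simp flip: power_mult add: mult.commute)
  finally show ?thesis
    by (metis mult.assoc mult.right_neutral shuffle_sign_square)
qed

lemma shuffle_sign_singletons [simp]: "shuffle_sign {i} {i} = 1"
  by (simp add: shuffle_sign_prod)

lemma shuffle_sign_singletons_swap: "i \<noteq> k \<Longrightarrow> shuffle_sign {i} {k} = - shuffle_sign {k} {i}"
  using shuffle_sign_swap[of "{i}" "{k}"] by simp

text \<open>
  With the next lemma this expresses every sign of the theory, simplicial or exterior, by a single
  bimultiplicative function.
\<close>

lemma eps_eq_shuffle_sign: "eps i I = shuffle_sign {i} I"
proof -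
  have "{(a, b). a \<in> {i} \<and> b \<in> I \<and> b < a} = Pair i ` {r \<in> I. r < i}" by auto
  then show ?thesis by (simp add: eps_def shuffle_sign_def card_image inj_on_def)
qed

lemma eps_set_eq_shuffle_sign:
  "finite L \<Longrightarrow> finite I \<Longrightarrow> eps_set L I = shuffle_sign L I"
  by (simp add: eps_set_def eps_eq_shuffle_sign shuffle_sign_prod)

section \<open>Exterior algebra over a commutative ring\<close>

type_synonym 'a ext = "nat set \<Rightarrow> 'a"

text \<open>
  The product of \<open>exterior_ring\<close>, for coefficients in a commutative ring type, where the arithmetic of
  finite sums is available.
\<close>

definition ext_mult :: "'a::comm_ring_1 ext \<Rightarrow> 'a ext \<Rightarrow> 'a ext" where
  "ext_mult F G J = (\<Sum>A\<in>Pow J. of_int (shuffle_sign A (J - A)) * (F A * G (J - A)))"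

text \<open>
  Contraction with the dual of \<open>u\<^sub>i\<close>.
\<close>

definition ext_partial :: "nat \<Rightarrow> 'a::comm_ring_1 ext \<Rightarrow> 'a ext" where
  "ext_partial i F J = (if i \<in> J then 0 else of_int (shuffle_sign {i} J) * F (insert i J))"

definition ext_deriv :: "nat \<Rightarrow> (nat \<Rightarrow> 'a) \<Rightarrow> 'a::comm_ring_1 ext \<Rightarrow> 'a ext" where
  "ext_deriv m x F J = (\<Sum>i\<in>{1..m}. x i * ext_partial i F J)"

text \<open>
  The sign by which an odd derivation passes the left factor of a product.
\<close>

definition ext_parity :: "'a::comm_ring_1 ext \<Rightarrow> 'a ext" where
  "ext_parity F J = (- 1) ^ card J * F J"

text \<open>
  Both sides are sums over the ordered partitions of \<open>J\<close> into three blocks, and multiplicativity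
  gives both of them the product of the signs of the three pairs of blocks.
\<close>

lemma ext_mult_assoc:
  assumes "finite J"
  shows "ext_mult (ext_mult F G) E J = ext_mult F (ext_mult G E) J"
proof -
  let ?s = "\<lambda>A B. of_int (shuffle_sign A B)"
  have fin: "finite A" if "A \<subseteq> J" for A using that assms finite_subset by blast
  have "ext_mult (ext_mult F G) E J
      = (\<Sum>(A, B)\<in>Sigma (Pow J) Pow. ?s A (J - A) * ?s B (A - B) * (F B * G (A - B) * E (J - A)))"
    unfolding ext_mult_def using assms fin
    by (subst sum.Sigma[symmetric]) (auto simp: sum_distrib_left sum_distrib_right algebra_simps)
  also have "\<dots> = (\<Sum>(B, C)\<in>Sigma (Pow J) (\<lambda>B. Pow (J - B)).
      ?s B (J - B) * ?s C (J - B - C) * (F B * G C * E (J - B - C)))"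
  proof (rule sum.reindex_bij_witness[where j="\<lambda>(A, B). (B, A - B)" and i="\<lambda>(B, C). (B \<union> C, B)"],
      goal_cases)
    case (5 p)
    obtain A B where p: "p = (A, B)" "B \<subseteq> A" "A \<subseteq> J" using 5 by auto
    let ?C = "A - B" let ?E = "J - A"
    have eqs: "A = B \<union> ?C" "J - B = ?C \<union> ?E" "J - B - ?C = ?E" using p by auto
    have 1: "shuffle_sign A ?E = shuffle_sign B ?E * shuffle_sign ?C ?E"
      using p fin by (subst eqs(1), intro shuffle_sign_Un_left) auto
    have 2: "shuffle_sign B (J - B) = shuffle_sign B ?C * shuffle_sign B ?E"
      using p fin by (subst eqs(2), intro shuffle_sign_Un_right) auto
    show ?case unfolding p(1) prod.case eqs(3) 1 2 by (simp add: algebra_simps)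
  qed auto
  also have "\<dots> = ext_mult F (ext_mult G E) J"
    unfolding ext_mult_def using assms
    by (subst sum.Sigma[symmetric]) (auto simp: sum_distrib_left sum_distrib_right algebra_simps)
  finally show ?thesis .
qed

lemma ext_mult_one_left:
  assumes "finite J" shows "ext_mult (\<lambda>J. if J = {} then 1 else 0) F J = F J"
proof -
  have "ext_mult (\<lambda>J. if J = {} then 1 else 0) F J = (\<Sum>A\<in>Pow J. if A = {} then F J else 0)"
    unfolding ext_mult_def by (intro sum.cong) auto
  then show ?thesis using assms by simp
qed

lemma ext_mult_one_right:
  assumes "finite J" shows "ext_mult F (\<lambda>J. if J = {} then 1 else 0) J = F J"
proof -
  have "ext_mult F (\<lambda>J. if J = {} then 1 else 0) J = (\<Sum>A\<in>Pow J. if A = J then F J else 0)"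
    unfolding ext_mult_def by (intro sum.cong) auto
  then show ?thesis using assms by simp
qed

text \<open>
  The exponent \<open>n\<close> has the parity of the product of the degrees when \<open>F\<close> and \<open>G\<close> are
  homogeneous modulo 2.
\<close>

lemma ext_mult_swap:
  assumes "finite J"
    and "\<And>A B. A \<subseteq> J \<Longrightarrow> F A \<noteq> 0 \<Longrightarrow> B \<subseteq> J \<Longrightarrow> G B \<noteq> 0 \<Longrightarrow> even (card A * card B) = even n"
  shows "ext_mult F G J = (- 1) ^ n * ext_mult G F J"
proof -
  have "ext_mult F G J = (\<Sum>A\<in>Pow J. (- 1) ^ n * (of_int (shuffle_sign (J - A) A) * (G (J - A) * F A)))"
    unfolding ext_mult_def
  proof (intro sum.cong refl)
    fix A assume "A \<in> Pow J"
    then have A: "finite A" "finite (J - A)" "A \<inter> (J - A) = {}" "A \<subseteq> J"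
      using assms(1) finite_subset by auto
    show "of_int (shuffle_sign A (J - A)) * (F A * G (J - A))
        = (- 1) ^ n * (of_int (shuffle_sign (J - A) A) * (G (J - A) * F A))"
    proof (cases "F A = 0 \<or> G (J - A) = 0")
      case False
      then have "(- 1) ^ (card A * card (J - A)) = ((- 1) ^ n :: int)"
        using assms(2)[of A "J - A"] A(4) by (simp add: minus_one_power_iff)
      then show ?thesis using shuffle_sign_swap[OF A(1-3)] by (simp add: algebra_simps)
    qed auto
  qed
  also have "\<dots> = (- 1) ^ n * ext_mult G F J"
    unfolding ext_mult_def sum_distrib_left
    by (rule sum.reindex_bij_witness[where i="\<lambda>A. J - A" and j="\<lambda>A. J - A"])
      (auto simp: double_diff)
  finally show ?thesis .
qed

text \<open>
  If \<open>i\<close> is not in \<open>J\<close>, the terms of the product over \<open>insert i J\<close> split according to the factor that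
  contains \<open>u\<^sub>i\<close>.  If \<open>i\<close> is in \<open>J\<close>, the left side is zero, and the right side cancels in pairs:
  this reflects \<open>u\<^sub>i u\<^sub>i = 0\<close>.
\<close>

lemma ext_partial_leibniz:
  assumes "finite J"
  shows "ext_partial i (ext_mult F G) J
    = ext_mult (ext_partial i F) G J + ext_mult (ext_parity F) (ext_partial i G) J"
proof (cases "i \<in> J")
  case False
  let ?t = "\<lambda>A. of_int (shuffle_sign A (insert i J - A)) * (F A * G (insert i J - A))"
  have "ext_partial i (ext_mult F G) J = of_int (shuffle_sign {i} J) * (\<Sum>A\<in>Pow (insert i J). ?t A)"
    using False by (simp add: ext_partial_def ext_mult_def)
  also have "(\<Sum>A\<in>Pow (insert i J). ?t A) = (\<Sum>A\<in>Pow J. ?t A) + (\<Sum>A\<in>insert i ` Pow J. ?t A)"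
    unfolding Pow_insert using assms False by (intro sum.union_disjoint) auto
  also have "(\<Sum>A\<in>insert i ` Pow J. ?t A) = (\<Sum>A\<in>Pow J. ?t (insert i A))"
    using False by (intro sum.reindex[unfolded o_def]) (auto simp: inj_on_def)
  finally have *: "ext_partial i (ext_mult F G) J
      = (\<Sum>A\<in>Pow J. of_int (shuffle_sign {i} J) * ?t (insert i A))
        + (\<Sum>A\<in>Pow J. of_int (shuffle_sign {i} J) * ?t A)"
    by (simp add: sum_distrib_left algebra_simps)
  have sgnJ: "shuffle_sign {i} J = shuffle_sign {i} A * shuffle_sign {i} (J - A)" 
    "finite A" "finite (J - A)" "i \<notin> A" "i \<notin> J - A" if "A \<subseteq> J" for A
    using that assms False finite_subset[OF that assms] shuffle_sign_Un_right[of "{i}" A "J - A"]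
    by (auto simp: Un_absorb1)
  show ?thesis unfolding *
  proof (intro arg_cong2[where f="(+)"])
    show "(\<Sum>A\<in>Pow J. of_int (shuffle_sign {i} J) * ?t (insert i A)) = ext_mult (ext_partial i F) G J"
      unfolding ext_mult_def
    proof (intro sum.cong refl)
      fix A assume "A \<in> Pow J"
      then have A: "A \<subseteq> J" by simp
      have e: "insert i J - insert i A = J - A" using False by auto
      show "of_int (shuffle_sign {i} J) * ?t (insert i A)
          = of_int (shuffle_sign A (J - A)) * (ext_partial i F A * G (J - A))"
        using sgnJ[OF A] shuffle_sign_insert_left[of A "J - A" i]
        by (simp add: e ext_partial_def of_int_mult[symmetric] algebra_simps del: of_int_mult)
    qed
    show "(\<Sum>A\<in>Pow J. of_int (shuffle_sign {i} J) * ?t A) = ext_mult (ext_parity F) (ext_partial i G) J"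
      unfolding ext_mult_def
    proof (intro sum.cong refl)
      fix A assume "A \<in> Pow J"
      then have A: "A \<subseteq> J" by simp
      have e: "insert i J - A = insert i (J - A)" using False A by auto
      have "shuffle_sign A {i} = (- 1) ^ card A * shuffle_sign {i} A"
        using shuffle_sign_swap[of A "{i}"] sgnJ[OF A] by simp
      then have s: "shuffle_sign {i} J * shuffle_sign A (insert i (J - A))
        = shuffle_sign A (J - A) * ((- 1) ^ card A * shuffle_sign {i} (J - A))"
        using sgnJ[OF A] shuffle_sign_insert_right[of A "J - A" i] by (simp add: algebra_simps)
      show "of_int (shuffle_sign {i} J) * ?t A
          = of_int (shuffle_sign A (J - A)) * (ext_parity F A * ext_partial i G (J - A))"
        using arg_cong[OF s, of "\<lambda>x. of_int x * (F A * G (insert i (J - A)))"] sgnJ(5)[OF A] False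
        by (simp add: e ext_partial_def ext_parity_def algebra_simps)
    qed
  qed
next
  case True
  let ?s = "\<lambda>A B. of_int (shuffle_sign A B)"
  define J0 where "J0 = J - {i}"
  have J: "J = insert i J0" "i \<notin> J0" "finite J0" using True assms by (auto simp: J0_def)
  let ?t = "\<lambda>A. ?s A (J - A) * (ext_partial i F A * G (J - A))"
  let ?u = "\<lambda>A. ?s A (J - A) * (ext_parity F A * ext_partial i G (J - A))"
  have split: "(\<Sum>A\<in>Pow J. h A) = (\<Sum>A\<in>Pow J0. h A) + (\<Sum>A\<in>Pow J0. h (insert i A))"
    for h :: "nat set \<Rightarrow> 'a"
  proof -
    have "(\<Sum>A\<in>Pow J. h A) = (\<Sum>A\<in>Pow J0. h A) + (\<Sum>A\<in>insert i ` Pow J0. h A)"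
      unfolding J(1) Pow_insert using J by (intro sum.union_disjoint) auto
    also have "(\<Sum>A\<in>insert i ` Pow J0. h A) = (\<Sum>A\<in>Pow J0. h (insert i A))"
      using J by (intro sum.reindex[unfolded o_def]) (auto simp: inj_on_def)
    finally show ?thesis .
  qed
  have "?t (insert i A) = 0" for A by (simp add: ext_partial_def)
  moreover have "?u A = 0" if "A \<in> Pow J0" for A using that J by (auto simp: ext_partial_def)
  moreover have "?t A + ?u (insert i A) = 0" if "A \<in> Pow J0" for A
  proof -
    let ?B = "J0 - A"
    have A: "finite A" "finite ?B" "i \<notin> A" "i \<notin> ?B"
      using that J finite_subset by auto
    have e: "J - A = insert i ?B" "J - insert i A = ?B" using that J by auto
    have s1: "shuffle_sign A (insert i ?B) = (- 1) ^ card A * shuffle_sign {i} A * shuffle_sign A ?B"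
      using shuffle_sign_insert_right[of A ?B i] shuffle_sign_swap[of A "{i}"] A by simp
    have s2: "shuffle_sign (insert i A) ?B = shuffle_sign {i} ?B * shuffle_sign A ?B"
      using shuffle_sign_insert_left[of A ?B i] A by simp
    have s: "shuffle_sign A (insert i ?B) * shuffle_sign {i} A
        = - (shuffle_sign (insert i A) ?B * ((- 1) ^ card (insert i A) * shuffle_sign {i} ?B))"
      unfolding s1 s2 using A by (simp add: algebra_simps)
    show ?thesis
      using arg_cong[OF s, of "\<lambda>x. of_int x * (F (insert i A) * G (insert i ?B))"] A
      by (simp add: e ext_partial_def ext_parity_def algebra_simps)
  qed
  ultimately have "(\<Sum>A\<in>Pow J. ?t A) + (\<Sum>A\<in>Pow J. ?u A) = 0"
    by (simp add: split sum.distrib[symmetric])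
  then show ?thesis using True by (simp add: ext_partial_def ext_mult_def)
qed

lemma ext_partial_anticommute:
  assumes "finite J"
  shows "ext_partial i (ext_partial k F) J = - ext_partial k (ext_partial i F) J"
proof (cases "i = k \<or> i \<in> J \<or> k \<in> J")
  case True
  then show ?thesis by (auto simp: ext_partial_def)
next
  case False
  then have s: "shuffle_sign {i} J * shuffle_sign {k} (insert i J)
      = - (shuffle_sign {k} J * shuffle_sign {i} (insert k J))"
    using assms shuffle_sign_insert_right[of "{k}" J i] shuffle_sign_insert_right[of "{i}" J k]
      shuffle_sign_singletons_swap[of i k] by simp
  show ?thesis
    using arg_cong[OF s, of "\<lambda>x. of_int x * F (insert k (insert i J))"] False
    by (simp add: ext_partial_def insert_commute algebra_simps)
qed

lemma ext_partial_linear: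
  "ext_partial i (\<lambda>J. F J + G J) J = ext_partial i F J + ext_partial i G J"
  "ext_partial i (\<lambda>J. c * F J) J = c * ext_partial i F J"
  "ext_partial i (\<lambda>J. \<Sum>k\<in>S. E k J) J = (\<Sum>k\<in>S. ext_partial i (E k) J)"
  by (auto simp: ext_partial_def algebra_simps sum_distrib_left)

lemma ext_deriv_anticommute:
  assumes "finite J"
  shows "ext_deriv m x (ext_deriv m y F) J = - ext_deriv m y (ext_deriv m x F) J"
proof -
  have *: "ext_deriv m x (ext_deriv m y F) J
      = (\<Sum>i\<in>{1..m}. \<Sum>k\<in>{1..m}. x i * y k * ext_partial i (ext_partial k F) J)" for x y
    unfolding ext_deriv_def[abs_def] ext_partial_linear
    by (simp add: sum_distrib_left mult.assoc)
  have "ext_deriv m y (ext_deriv m x F) J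
      = (\<Sum>i\<in>{1..m}. \<Sum>k\<in>{1..m}. y k * x i * ext_partial k (ext_partial i F) J)"
    unfolding * by (rule sum.swap)
  also have "\<dots> = (\<Sum>i\<in>{1..m}. \<Sum>k\<in>{1..m}. - (x i * y k * ext_partial i (ext_partial k F) J))"
  proof (intro sum.cong refl)
    fix i k
    show "y k * x i * ext_partial k (ext_partial i F) J = - (x i * y k * ext_partial i (ext_partial k F) J)"
      using ext_partial_anticommute[OF assms, of k i F] by (simp add: mult.commute)
  qed
  finally show ?thesis by (simp add: * sum_negf)
qed

lemma ext_deriv_leibniz:
  assumes "finite J"
  shows "ext_deriv m x (ext_mult F G) J
    = ext_mult (ext_deriv m x F) G J + ext_mult (ext_parity F) (ext_deriv m x G) J"
proof -
  have "ext_deriv m x (ext_mult F G) J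
      = (\<Sum>i\<in>{1..m}. x i * ext_mult (ext_partial i F) G J)
        + (\<Sum>i\<in>{1..m}. x i * ext_mult (ext_parity F) (ext_partial i G) J)"
    by (simp add: ext_deriv_def ext_partial_leibniz[OF assms] algebra_simps sum.distrib)
  also have "(\<Sum>i\<in>{1..m}. x i * ext_mult (ext_partial i F) G J) = ext_mult (ext_deriv m x F) G J"
    unfolding ext_mult_def ext_deriv_def sum_distrib_left sum_distrib_right
    by (subst sum.swap) (simp add: algebra_simps)
  also have "(\<Sum>i\<in>{1..m}. x i * ext_mult (ext_parity F) (ext_partial i G) J)
      = ext_mult (ext_parity F) (ext_deriv m x G) J"
    unfolding ext_mult_def ext_deriv_def sum_distrib_left sum_distrib_right
    by (subst sum.swap) (simp add: algebra_simps)
  finally show ?thesis .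
qed

section \<open>The face ring\<close>

abbreviation (input) "lookup \<equiv> Poly_Mapping.lookup"
abbreviation (input) "keys \<equiv> Poly_Mapping.keys"
abbreviation (input) "single \<equiv> Poly_Mapping.single"

lemma lookup_single_times:
  fixes f :: mpoly
  shows "lookup (single b c * f) a
    = (if \<exists>a'. a = b + a' then c * lookup f (a - b) else 0)"
proof -
  have "lookup (single b c * f) a
      = c * (\<Sum>q. lookup f q when a = b + q)"
    by (simp add: lookup_mult lookup_single when_mult mult_when)
  also have "(\<Sum>q. lookup f q when a = b + q)
      = (if \<exists>a'. a = b + a' then lookup f (a - b) else 0)"
  proof (cases "\<exists>a'. a = b + a'")
    case True
    then obtain a' where a': "a = b + a'" by blast
    then have "(\<lambda>q. lookup f q when a = b + q) = (\<lambda>q. lookup f q when q = a')"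
      by (auto simp: when_def)
    then show ?thesis using a' by simp
  next
    case False
    then show ?thesis by (simp add: when_def)
  qed
  finally show ?thesis by simp
qed

lemma lookup_of_int_times [simp]:
  fixes f :: mpoly
  shows "lookup (of_int k * f) a = k * lookup f a"
proof -
  have "single 0 (of_int k :: int) = (of_int k :: mpoly)" by (rule single_of_int)
  then show ?thesis using lookup_single_times[of 0 k f a] by simp
qed

text \<open>
  Multiplication by \<open>v\<^sub>i\<close> shifts coefficients, because distinct monomials have distinct multiples.
\<close>

lemma lookup_mvar_times:
  "lookup (mvar i * f) a
    = (if i \<in> keys a then lookup f (a - single i 1) else 0)"
proof -
  have "(\<exists>a'. a = single i 1 + a') \<longleftrightarrow> i \<in> keys a"
  proof
    assume "i \<in> keys a"
    then have "a = single i 1 + (a - single i 1)"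
      by (intro poly_mapping_eqI)
        (auto simp: lookup_add lookup_minus lookup_single when_def in_keys_iff)
    then show "\<exists>a'. a = single i 1 + a'" by blast
  qed (auto simp: in_keys_iff lookup_add)
  then show ?thesis by (simp add: mvar_def lookup_single_times)
qed

lemma keys_plus_nat:
  fixes a b :: "nat \<Rightarrow>\<^sub>0 nat"
  shows "keys (a + b) = keys a \<union> keys b"
  by (auto simp: in_keys_iff lookup_add)

lemma keys_times_elim:
  fixes f g :: mpoly
  assumes "a \<in> keys (f * g)"
  obtains b c where "b \<in> keys f" "c \<in> keys g" "a = b + c"
  using assms keys_mult[of f g] by blast

lemma keys_of_int_times:
  fixes f :: mpoly shows "keys (of_int k * f) \<subseteq> keys f"
  by (auto simp: in_keys_iff)

text \<open>
  The exponent vector of \<open>v\<^sub>L\<close>.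
\<close>

definition face_monomial :: "nat set \<Rightarrow> (nat \<Rightarrow>\<^sub>0 nat)" where
  "face_monomial L = (\<Sum>i\<in>L. single i 1)"

lemma lookup_face_monomial: "finite L \<Longrightarrow> lookup (face_monomial L) i = (if i \<in> L then 1 else 0)"
  by (simp add: face_monomial_def lookup_sum lookup_single when_def)

lemma keys_face_monomial: "finite L \<Longrightarrow> keys (face_monomial L) = L"
  by (auto simp: in_keys_iff lookup_face_monomial split: if_splits)

lemma prod_mvar: "finite L \<Longrightarrow> (\<Prod>i\<in>L. mvar i) = single (face_monomial L) 1"
proof (induction L rule: finite_induct)
  case empty then show ?case by (simp add: face_monomial_def)
next
  case (insert i L)
  then show ?case by (simp add: mvar_def mult_single face_monomial_def)
qed

definition monomial_degree :: "(nat \<Rightarrow>\<^sub>0 nat) \<Rightarrow> nat" where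
  "monomial_degree a = (\<Sum>i\<in>keys a. lookup a i)"

lemma monomial_degree_plus: "monomial_degree (a + b) = monomial_degree a + monomial_degree b"
proof -
  have *: "monomial_degree c = (\<Sum>i\<in>keys a \<union> keys b. lookup c i)"
    if "keys c \<subseteq> keys a \<union> keys b" for c
    unfolding monomial_degree_def using that by (intro sum.mono_neutral_left) (auto simp: in_keys_iff)
  show ?thesis
    using *[of "a + b"] *[of a] *[of b] by (simp add: keys_plus_nat lookup_add sum.distrib)
qed

lemma poly_ring_sel [simp]:
  "mult (poly_ring m) = (*)" "one (poly_ring m) = 1" "zero (poly_ring m) = 0"
  "add (poly_ring m) = (+)"
  by (simp_all add: poly_ring_def)

lemma poly_carrier_iff:
  "f \<in> carrier (poly_ring m) \<longleftrightarrow> (\<forall>a\<in>keys f. keys a \<subseteq> {1..m})"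
  by (simp add: poly_ring_def)

lemma poly_carrier_mult:
  assumes "f \<in> carrier (poly_ring m)" "g \<in> carrier (poly_ring m)"
  shows "f * g \<in> carrier (poly_ring m)"
  unfolding poly_carrier_iff
proof
  fix a assume "a \<in> keys (f * g)"
  then obtain b c where "b \<in> keys f" "c \<in> keys g" "a = b + c"
    by (rule keys_times_elim)
  then show "keys a \<subseteq> {1..m}"
    using assms by (simp add: poly_carrier_iff keys_plus_nat)
qed

lemma poly_carrier_add:
  "f \<in> carrier (poly_ring m) \<Longrightarrow> g \<in> carrier (poly_ring m) \<Longrightarrow> f + g \<in> carrier (poly_ring m)"
  unfolding poly_carrier_iff by (blast dest: subsetD[OF keys_add])

lemma poly_carrier_uminus: "f \<in> carrier (poly_ring m) \<Longrightarrow> - f \<in> carrier (poly_ring m)"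
  unfolding poly_carrier_iff by simp

lemma poly_carrier_of_int_mult:
  "f \<in> carrier (poly_ring m) \<Longrightarrow> of_int k * f \<in> carrier (poly_ring m)"
  unfolding poly_carrier_iff by (blast dest: subsetD[OF keys_of_int_times])

lemma poly_carrier_zero_one: "0 \<in> carrier (poly_ring m)" "1 \<in> carrier (poly_ring m)"
  unfolding poly_carrier_iff by simp_all

lemma poly_carrier_diff:
  "f \<in> carrier (poly_ring m) \<Longrightarrow> g \<in> carrier (poly_ring m) \<Longrightarrow> f - g \<in> carrier (poly_ring m)"
  using poly_carrier_add[of f m "- g"] poly_carrier_uminus[of g m] by simp

lemmas poly_carrier_closed = poly_carrier_zero_one poly_carrier_uminus poly_carrier_add
  poly_carrier_diff poly_carrier_mult poly_carrier_of_int_mult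

lemma poly_carrier_sum:
  "(\<And>i. i \<in> A \<Longrightarrow> f i \<in> carrier (poly_ring m)) \<Longrightarrow> sum f A \<in> carrier (poly_ring m)"
  by (induction A rule: infinite_finite_induct) (auto simp: poly_carrier_closed)

lemma poly_ring_cring: "cring (poly_ring m)"
proof (intro cringI abelian_groupI comm_monoidI)
  fix f assume "f \<in> carrier (poly_ring m)"
  then show "\<exists>g\<in>carrier (poly_ring m). g \<oplus>\<^bsub>poly_ring m\<^esub> f = \<zero>\<^bsub>poly_ring m\<^esub>"
    by (intro bexI[of _ "- f"]) (auto simp: poly_carrier_closed)
qed (auto simp: poly_carrier_closed algebra_simps)

lemma poly_ring_minus: "f \<in> carrier (poly_ring m) \<Longrightarrow> \<ominus>\<^bsub>poly_ring m\<^esub> f = - f"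
proof -
  interpret cring "poly_ring m" by (rule poly_ring_cring)
  assume "f \<in> carrier (poly_ring m)"
  then show ?thesis by (intro minus_equality) (auto simp: poly_carrier_closed)
qed

lemma poly_ring_int_mult:
  assumes "f \<in> carrier (poly_ring m)"
  shows "[(k::int)] \<cdot>\<^bsub>poly_ring m\<^esub> f = of_int k * f"
proof -
  interpret cring "poly_ring m" by (rule poly_ring_cring)
  have nat: "[(n::nat)] \<cdot>\<^bsub>poly_ring m\<^esub> f = of_nat n * f" for n
    using assms by (induction n) (auto simp: add.nat_pow_Suc algebra_simps)
  show ?thesis
  proof (cases "k \<ge> 0")
    case True
    then show ?thesis using nat[of "nat k"] by (metis add_pow_int_ge nat_0_le of_int_of_nat_eq)
  next
    case False
    then have "[k] \<cdot>\<^bsub>poly_ring m\<^esub> f = \<ominus>\<^bsub>poly_ring m\<^esub> ([nat (- k)] \<cdot>\<^bsub>poly_ring m\<^esub> f)"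
      by (simp add: add_pow_int_lt)
    also have "\<dots> = - (of_int (- k) * f)"
      using False nat[of "nat (- k)"] poly_ring_minus[of "of_int (- k) * f" m]
      by (simp add: poly_carrier_closed assms del: of_int_minus)
    finally show ?thesis by simp
  qed
qed

lemma poly_sum_monomials:
  fixes f :: mpoly
  shows "f = (\<Sum>a\<in>keys f. single a (lookup f a))"
  by (intro poly_mapping_eqI) (auto simp: lookup_sum lookup_single when_def in_keys_iff)

locale complex_on =
  fixes m :: nat and K :: "nat set set"
  assumes complex: "simplicial_complex m K"
begin

lemma face_subset: "L \<in> K \<Longrightarrow> L \<subseteq> {1..m}"
  using complex by (auto simp: simplicial_complex_def)

lemma face_finite: "L \<in> K \<Longrightarrow> finite L"
  using face_subset finite_subset by blast

lemma face_down: "J \<in> K \<Longrightarrow> L \<subseteq> J \<Longrightarrow> L \<in> K"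
  using complex by (auto simp: simplicial_complex_def)

text \<open>
  The generators are monomials, so a polynomial is in the ideal exactly if all of its monomials are; and
  a monomial is a multiple of some \<open>v\<^sub>I\<close> with \<open>I\<close> a non-simplex exactly if its support is a non-simplex,
  as \<open>K\<close> is closed under subsets.
\<close>

lemma stanley_reisner_ideal_eq:
  "stanley_reisner_ideal m K
    = {f \<in> carrier (poly_ring m). \<forall>a\<in>keys f. keys a \<notin> K}"
  (is "_ = ?I")
proof
  interpret P: cring "poly_ring m" by (rule poly_ring_cring)
  let ?S = "{\<Prod>i\<in>I. mvar i | I. I \<subseteq> {1..m} \<and> I \<notin> K}"
  have gens: "?S \<subseteq> ?I"
  proof
    fix f assume "f \<in> ?S"
    then obtain I where I: "f = (\<Prod>i\<in>I. mvar i)" "I \<subseteq> {1..m}" "I \<notin> K" by blast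
    then have "finite I" using finite_subset by blast
    then show "f \<in> ?I" using I by (simp add: prod_mvar poly_carrier_iff keys_face_monomial)
  qed
  then have Sc: "?S \<subseteq> carrier (poly_ring m)" by blast
  have ideal: "ideal ?I (poly_ring m)"
  proof (rule idealI)
    show "ring (poly_ring m)" by (rule P.ring_axioms)
    show "subgroup ?I (add_monoid (poly_ring m))"
    proof (rule group.subgroupI[OF abelian_group.a_group[OF P.abelian_group_axioms]])
      show "?I \<noteq> {}" using poly_carrier_zero_one(1) by (auto intro!: exI[of _ 0])
      fix f assume f: "f \<in> ?I"
      have "inv\<^bsub>add_monoid (poly_ring m)\<^esub> f = - f"
        using poly_ring_minus[of f m] f by (simp add: a_inv_def)
      then show "inv\<^bsub>add_monoid (poly_ring m)\<^esub> f \<in> ?I" using f by (auto simp: poly_carrier_closed)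
      fix g assume "g \<in> ?I"
      then show "f \<otimes>\<^bsub>add_monoid (poly_ring m)\<^esub> g \<in> ?I"
        using f keys_add[of f g] by (auto simp: poly_carrier_closed)
    qed auto
    fix f g assume f: "f \<in> ?I" and g: "g \<in> carrier (poly_ring m)"
    have "keys a \<notin> K" if a: "a \<in> keys (f * g)" for a
    proof -
      obtain b c where "b \<in> keys f" "a = b + c" using keys_times_elim[OF a] by blast
      then show ?thesis using f face_down by (auto simp: keys_plus_nat)
    qed
    then show "f \<otimes>\<^bsub>poly_ring m\<^esub> g \<in> ?I" "g \<otimes>\<^bsub>poly_ring m\<^esub> f \<in> ?I"
      using f g by (auto simp: poly_carrier_closed mult.commute)
  qed
  show "stanley_reisner_ideal m K \<subseteq> ?I"
    unfolding stanley_reisner_ideal_def by (rule P.genideal_minimal[OF ideal gens])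
  interpret I: ideal "stanley_reisner_ideal m K" "poly_ring m"
    unfolding stanley_reisner_ideal_def by (rule P.genideal_ideal[OF Sc])
  show "?I \<subseteq> stanley_reisner_ideal m K"
  proof
    fix f assume f: "f \<in> ?I"
    have mon: "single a c \<in> stanley_reisner_ideal m K"
      if a: "a \<in> keys f" for a c
    proof -
      let ?L = "keys a"
      have L: "?L \<subseteq> {1..m}" "?L \<notin> K" using f a by (auto simp: poly_carrier_iff)
      have eq: "a = (a - face_monomial ?L) + face_monomial ?L"
        by (intro poly_mapping_eqI) (auto simp: lookup_add lookup_minus lookup_face_monomial in_keys_iff)
      have "(\<Prod>i\<in>?L. mvar i) \<in> stanley_reisner_ideal m K"
        unfolding stanley_reisner_ideal_def using P.genideal_self[OF Sc] L by blast
      moreover have "single (a - face_monomial ?L) c \<in> carrier (poly_ring m)"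
        using L(1) by (auto simp: poly_carrier_iff in_keys_iff lookup_minus split: if_splits)
      ultimately have "single (a - face_monomial ?L) c * (\<Prod>i\<in>?L. mvar i) \<in> stanley_reisner_ideal m K"
        using I.I_l_closed by force
      moreover have "single (a - face_monomial ?L) c * (\<Prod>i\<in>?L. mvar i) = single a c"
        using eq by (simp add: prod_mvar mult_single)
      ultimately show ?thesis by simp
    qed
    have sums: "sum g A \<in> stanley_reisner_ideal m K"
      if "\<And>a. a \<in> A \<Longrightarrow> g a \<in> stanley_reisner_ideal m K" for g and A :: "(nat \<Rightarrow>\<^sub>0 nat) set"
      using that I.zero_closed I.a_closed
      by (induction A rule: infinite_finite_induct) auto
    have "(\<Sum>a\<in>keys f. single a (lookup f a))
        \<in> stanley_reisner_ideal m K"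
      by (rule sums) (rule mon)
    then show "f \<in> stanley_reisner_ideal m K"
      unfolding poly_sum_monomials[symmetric] .
  qed
qed

lemma stanley_reisner_ideal: "ideal (stanley_reisner_ideal m K) (poly_ring m)"
proof -
  interpret P: cring "poly_ring m" by (rule poly_ring_cring)
  have "(\<Prod>i\<in>I. mvar i) \<in> carrier (poly_ring m)" if "I \<subseteq> {1..m}" for I
    using that finite_subset[OF that] by (simp add: prod_mvar poly_carrier_iff keys_face_monomial)
  then show ?thesis
    unfolding stanley_reisner_ideal_def by (intro P.genideal_ideal) auto
qed

lemma face_ring_is_ring: "ring (face_ring m K)"
  unfolding face_ring_def by (rule ideal.quotient_is_ring[OF stanley_reisner_ideal])

abbreviation fc :: "mpoly \<Rightarrow> mpoly set" where "fc \<equiv> face_class m K"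

lemma face_class_hom: "fc \<in> ring_hom (poly_ring m) (face_ring m K)"
  unfolding face_ring_def face_class_def[abs_def]
  using ideal.rcos_ring_hom[OF stanley_reisner_ideal] .

lemma face_ring_carrier: "carrier (face_ring m K) = fc ` carrier (poly_ring m)"
  by (auto simp: face_ring_def FactRing_def A_RCOSETS_def' face_class_def)

lemma face_class_closed: "f \<in> carrier (poly_ring m) \<Longrightarrow> fc f \<in> carrier (face_ring m K)"
  by (simp add: face_ring_carrier)

lemma face_class_add:
  "f \<in> carrier (poly_ring m) \<Longrightarrow> g \<in> carrier (poly_ring m) \<Longrightarrow>
    fc (f + g) = fc f \<oplus>\<^bsub>face_ring m K\<^esub> fc g"
  using ring_hom_add[OF face_class_hom] by simp

lemma face_class_mult:
  "f \<in> carrier (poly_ring m) \<Longrightarrow> g \<in> carrier (poly_ring m) \<Longrightarrow>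
    fc (f * g) = fc f \<otimes>\<^bsub>face_ring m K\<^esub> fc g"
  using ring_hom_mult[OF face_class_hom] by simp

lemma face_class_one: "fc 1 = \<one>\<^bsub>face_ring m K\<^esub>"
  using ring_hom_one[OF face_class_hom] by simp

lemma face_class_zero: "fc 0 = \<zero>\<^bsub>face_ring m K\<^esub>"
  using ring_hom_zero[OF face_class_hom cring.axioms(1)[OF poly_ring_cring] face_ring_is_ring] by simp

lemma face_class_int_mult:
  assumes "f \<in> carrier (poly_ring m)"
  shows "fc (of_int k * f) = [(k::int)] \<cdot>\<^bsub>face_ring m K\<^esub> fc f"
  unfolding poly_ring_int_mult[OF assms, symmetric]
  by (rule additive_map_int_mult)
    (simp_all add: assms face_class_closed face_class_add ring.is_abelian_group
      face_ring_is_ring cring.axioms(1)[OF poly_ring_cring])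

lemma face_class_sum:
  assumes "\<And>i. i \<in> A \<Longrightarrow> f i \<in> carrier (poly_ring m)"
  shows "fc (sum f A) = (\<Oplus>\<^bsub>face_ring m K\<^esub>i\<in>A. fc (f i))"
proof -
  interpret F: ring "face_ring m K" by (rule face_ring_is_ring)
  show ?thesis using assms
    by (induction A rule: infinite_finite_induct)
      (auto simp: face_class_zero face_class_add face_class_closed poly_carrier_sum
        F.finsum_infinite F.finsum_empty F.finsum_insert Pi_def)
qed

text \<open>
  The face ring is free on the monomials supported on simplices.  This is the criterion by which all
  later equations between cosets are verified.
\<close>

lemma face_class_eq_iff:
  assumes "f \<in> carrier (poly_ring m)" "g \<in> carrier (poly_ring m)"
  shows "fc f = fc g \<longleftrightarrow>
    (\<forall>a. keys a \<in> K \<longrightarrow> lookup f a = lookup g a)"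
proof -
  interpret P: cring "poly_ring m" by (rule poly_ring_cring)
  have "f \<ominus>\<^bsub>poly_ring m\<^esub> g = f - g" using assms by (simp add: a_minus_def poly_ring_minus)
  then have "fc f = fc g \<longleftrightarrow> f - g \<in> stanley_reisner_ideal m K"
    using P.quotient_eq_iff_same_a_r_cos[OF stanley_reisner_ideal assms] by (simp add: face_class_def)
  then show ?thesis
    using assms by (auto simp: stanley_reisner_ideal_eq poly_carrier_closed in_keys_iff lookup_minus)
qed

end

section \<open>The Koszul algebra with polynomial coefficients\<close>

lemma ext_mult_infinite: "infinite J \<Longrightarrow> ext_mult F G J = 0"
  by (simp add: ext_mult_def finite_Pow_iff)

text \<open>
  Forms are total functions that vanish outside of the subsets of \<open>{1..m}\<close>, in contrast to the elements
  of \<open>exterior_ring\<close>, which are undefined there.  Zero as default value makes sums and derivations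
  of forms pointwise operations without side conditions.
\<close>

definition ext_poly_carrier :: "nat \<Rightarrow> mpoly ext set" where
  "ext_poly_carrier m = {F. \<forall>J. F J \<in> carrier (poly_ring m) \<and> (F J \<noteq> 0 \<longrightarrow> J \<subseteq> {1..m})}"

definition ext_poly_ring :: "nat \<Rightarrow> mpoly ext ring" where
  "ext_poly_ring m = \<lparr>carrier = ext_poly_carrier m, mult = ext_mult,
     one = (\<lambda>J. if J = {} then 1 else 0), zero = (\<lambda>J. 0), add = (\<lambda>F G J. F J + G J)\<rparr>"

lemma ext_poly_ring_sel [simp]:
  "carrier (ext_poly_ring m) = ext_poly_carrier m"
  "mult (ext_poly_ring m) = ext_mult" "one (ext_poly_ring m) = (\<lambda>J. if J = {} then 1 else 0)"
  "zero (ext_poly_ring m) = (\<lambda>J. 0)" "add (ext_poly_ring m) = (\<lambda>F G J. F J + G J)"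
  by (simp_all add: ext_poly_ring_def)

lemma ext_poly_coeff: "F \<in> ext_poly_carrier m \<Longrightarrow> F J \<in> carrier (poly_ring m)"
  by (simp add: ext_poly_carrier_def)

lemma ext_poly_outside: "F \<in> ext_poly_carrier m \<Longrightarrow> \<not> J \<subseteq> {1..m} \<Longrightarrow> F J = 0"
  by (auto simp: ext_poly_carrier_def)

lemma ext_polyI:
  "(\<And>J. F J \<in> carrier (poly_ring m)) \<Longrightarrow> (\<And>J. \<not> J \<subseteq> {1..m} \<Longrightarrow> F J = 0) \<Longrightarrow>
    F \<in> ext_poly_carrier m"
  unfolding ext_poly_carrier_def by blast

lemma ext_poly_zero: "(\<lambda>J. 0) \<in> ext_poly_carrier m"
  by (simp add: ext_poly_carrier_def poly_carrier_closed)

lemma ext_poly_one: "(\<lambda>J. if J = {} then 1 else 0) \<in> ext_poly_carrier m"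
  by (simp add: ext_poly_carrier_def poly_carrier_closed)

lemma ext_poly_add:
  "F \<in> ext_poly_carrier m \<Longrightarrow> G \<in> ext_poly_carrier m \<Longrightarrow> (\<lambda>J. F J + G J) \<in> ext_poly_carrier m"
  by (intro ext_polyI) (simp_all add: poly_carrier_add ext_poly_coeff ext_poly_outside)

lemma ext_poly_uminus: "F \<in> ext_poly_carrier m \<Longrightarrow> (\<lambda>J. - F J) \<in> ext_poly_carrier m"
  by (auto simp: ext_poly_carrier_def poly_carrier_closed)

lemma ext_poly_sum:
  "(\<And>i. i \<in> A \<Longrightarrow> F i \<in> ext_poly_carrier m) \<Longrightarrow> (\<lambda>J. \<Sum>i\<in>A. F i J) \<in> ext_poly_carrier m"
  by (induction A rule: infinite_finite_induct) (auto simp: ext_poly_zero ext_poly_add)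

lemma ext_poly_mult:
  assumes "F \<in> ext_poly_carrier m" "G \<in> ext_poly_carrier m"
  shows "ext_mult F G \<in> ext_poly_carrier m"
proof -
  have "ext_mult F G J = 0" if "\<not> J \<subseteq> {1..m}" for J
    unfolding ext_mult_def
  proof (rule sum.neutral, rule ballI)
    fix A assume "A \<in> Pow J"
    then have "\<not> A \<subseteq> {1..m} \<or> \<not> J - A \<subseteq> {1..m}" using that by blast
    then have "F A = 0 \<or> G (J - A) = 0"
      using ext_poly_outside[OF assms(1), of A] ext_poly_outside[OF assms(2), of "J - A"] by blast
    then show "of_int (shuffle_sign A (J - A)) * (F A * G (J - A)) = 0" by auto
  qed
  moreover have "ext_mult F G J \<in> carrier (poly_ring m)" for J
    unfolding ext_mult_def using assms
    by (intro poly_carrier_sum poly_carrier_of_int_mult poly_carrier_mult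
        ext_poly_coeff[OF assms(1)] ext_poly_coeff[OF assms(2)])
  ultimately show ?thesis by (intro ext_polyI)
qed

lemma ext_poly_finite: "F \<in> ext_poly_carrier m \<Longrightarrow> infinite J \<Longrightarrow> F J = 0"
  using ext_poly_outside[of F m J] finite_subset[of J "{1..m}"] by auto

lemma ext_mult_add:
  "ext_mult (\<lambda>J. F J + G J) E = (\<lambda>J. ext_mult F E J + ext_mult G E J)"
  "ext_mult E (\<lambda>J. F J + G J) = (\<lambda>J. ext_mult E F J + ext_mult E G J)"
  by (simp_all add: ext_mult_def[abs_def] sum.distrib[symmetric] algebra_simps)

lemma ext_poly_ring_is_ring: "ring (ext_poly_ring m)"
proof (intro ringI abelian_groupI monoidI, goal_cases)
  case (6 F)
  then show ?case
    by (intro bexI[of _ "\<lambda>J. - F J"]) (auto simp: ext_poly_uminus)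
next
  case (9 F G E)
  have "ext_mult (ext_mult F G) E J = ext_mult F (ext_mult G E) J" for J
    by (cases "finite J") (simp_all add: ext_mult_assoc ext_mult_infinite)
  then show ?case by auto
next
  case (10 F)
  then have "ext_mult (\<lambda>J. if J = {} then 1 else 0) F J = F J" for J
    by (cases "finite J") (simp_all add: ext_mult_one_left ext_mult_infinite ext_poly_finite)
  then show ?case by auto
next
  case (11 F)
  then have "ext_mult F (\<lambda>J. if J = {} then 1 else 0) J = F J" for J
    by (cases "finite J") (simp_all add: ext_mult_one_right ext_mult_infinite ext_poly_finite)
  then show ?case by auto
qed (auto simp: ext_poly_zero ext_poly_one ext_poly_add ext_poly_mult ext_mult_add add_ac)

lemma ext_poly_finsum:
  assumes "\<And>i. i \<in> A \<Longrightarrow> F i \<in> ext_poly_carrier m"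
  shows "(\<Oplus>\<^bsub>ext_poly_ring m\<^esub>i\<in>A. F i) = (\<lambda>J. \<Sum>i\<in>A. F i J)"
proof -
  interpret E: ring "ext_poly_ring m" by (rule ext_poly_ring_is_ring)
  show ?thesis using assms
    by (induction A rule: infinite_finite_induct)
      (auto simp: E.finsum_infinite E.finsum_empty E.finsum_insert Pi_def)
qed

lemma ext_partial_outside:
  "F \<in> ext_poly_carrier m \<Longrightarrow> \<not> J \<subseteq> {1..m} \<Longrightarrow> ext_partial i F J = 0"
  by (simp add: ext_partial_def ext_poly_outside)

lemma ext_deriv_closed:
  assumes "\<And>i. i \<in> {1..m} \<Longrightarrow> x i \<in> carrier (poly_ring m)" "F \<in> ext_poly_carrier m"
  shows "ext_deriv m x F \<in> ext_poly_carrier m"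
proof -
  have "ext_partial i F J \<in> carrier (poly_ring m)" for i J
    using assms(2) by (auto simp: ext_partial_def poly_carrier_closed ext_poly_coeff)
  then have "ext_deriv m x F J \<in> carrier (poly_ring m)" for J
    unfolding ext_deriv_def using assms by (intro poly_carrier_sum poly_carrier_mult) auto
  moreover have "ext_deriv m x F J = 0" if "\<not> J \<subseteq> {1..m}" for J
    using ext_partial_outside[OF assms(2) that] by (simp add: ext_deriv_def)
  ultimately show ?thesis by (intro ext_polyI)
qed

text \<open>
  Anticommuting with itself, the derivation has a square with \<open>2 d d = 0\<close>, and there is no torsion.
\<close>

lemma ext_deriv_square:
  fixes F :: "mpoly ext"
  assumes "F \<in> ext_poly_carrier m" "\<And>i. i \<in> {1..m} \<Longrightarrow> x i \<in> carrier (poly_ring m)"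
  shows "ext_deriv m x (ext_deriv m x F) = (\<lambda>J. 0)"
proof
  fix J
  show "ext_deriv m x (ext_deriv m x F) J = 0"
  proof (cases "finite J")
    case True
    let ?f = "ext_deriv m x (ext_deriv m x F) J"
    have "lookup ?f a = - lookup ?f a" for a
      using ext_deriv_anticommute[OF True, of m x x F] lookup_uminus by metis
    then show ?thesis by (intro poly_mapping_eqI) simp
  next
    case False
    have "ext_deriv m x (ext_deriv m x F) \<in> ext_poly_carrier m"
      by (intro ext_deriv_closed assms)
    then show ?thesis using False by (rule ext_poly_finite)
  qed
qed

text \<open>
  The form \<open>u\<^sub>J v\<close> has total degree \<open>card J\<close> plus twice the polynomial degree of \<open>v\<close>.
\<close>

definition ext_poly_deg :: "nat \<Rightarrow> int \<Rightarrow> mpoly ext set" where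
  "ext_poly_deg m n = {F \<in> ext_poly_carrier m.
     \<forall>J. \<forall>a\<in>keys (F J). int (card J) + 2 * int (monomial_degree a) = n}"

lemma ext_poly_degI:
  assumes "F \<in> ext_poly_carrier m"
    and "\<And>J a. J \<subseteq> {1..m} \<Longrightarrow> a \<in> keys (F J) \<Longrightarrow> int (card J) + 2 * int (monomial_degree a) = n"
  shows "F \<in> ext_poly_deg m n"
proof -
  have "int (card J) + 2 * int (monomial_degree a) = n" if "a \<in> keys (F J)" for J a
  proof (cases "J \<subseteq> {1..m}")
    case True
    then show ?thesis using assms(2) that by blast
  next
    case False
    then show ?thesis using ext_poly_outside[OF assms(1), of J] that by simp
  qed
  then show ?thesis unfolding ext_poly_deg_def using assms(1) by blast
qed

lemma ext_poly_degD:
  "F \<in> ext_poly_deg m n \<Longrightarrow> a \<in> keys (F J) \<Longrightarrow> int (card J) + 2 * int (monomial_degree a) = n"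
  by (simp add: ext_poly_deg_def)

lemma ext_poly_deg_carrier: "F \<in> ext_poly_deg m n \<Longrightarrow> F \<in> ext_poly_carrier m"
  by (simp add: ext_poly_deg_def)

lemma ext_poly_deg_zero: "(\<lambda>J. 0) \<in> ext_poly_deg m n"
  by (simp add: ext_poly_deg_def ext_poly_zero)

lemma ext_poly_deg_add:
  assumes "F \<in> ext_poly_deg m n" "G \<in> ext_poly_deg m n"
  shows "(\<lambda>J. F J + G J) \<in> ext_poly_deg m n"
proof (rule ext_poly_degI)
  show "(\<lambda>J. F J + G J) \<in> ext_poly_carrier m"
    using assms by (intro ext_poly_add ext_poly_deg_carrier)
  fix J a assume "a \<in> keys (F J + G J)"
  then have "a \<in> keys (F J) \<union> keys (G J)" by (rule subsetD[OF keys_add])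
  then show "int (card J) + 2 * int (monomial_degree a) = n"
    using ext_poly_degD[OF assms(1), of a J] ext_poly_degD[OF assms(2), of a J] by blast
qed

lemma ext_poly_deg_uminus: "F \<in> ext_poly_deg m n \<Longrightarrow> (\<lambda>J. - F J) \<in> ext_poly_deg m n"
  using ext_poly_uminus[of F m] by (simp add: ext_poly_deg_def)

lemma ext_poly_deg_mult:
  assumes F: "F \<in> ext_poly_deg m p" and G: "G \<in> ext_poly_deg m q"
  shows "ext_mult F G \<in> ext_poly_deg m (p + q)"
proof (rule ext_poly_degI)
  show "ext_mult F G \<in> ext_poly_carrier m"
    using F G by (intro ext_poly_mult ext_poly_deg_carrier)
  fix J a assume J: "J \<subseteq> {1..m}" and a: "a \<in> keys (ext_mult F G J)"
  then have "finite J" using finite_subset by blast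
  from a have "a \<in> (\<Union>A\<in>Pow J. keys (of_int (shuffle_sign A (J - A)) * (F A * G (J - A))))"
    unfolding ext_mult_def by (rule subsetD[OF keys_sum])
  then obtain A where A: "A \<subseteq> J" "a \<in> keys (of_int (shuffle_sign A (J - A)) * (F A * G (J - A)))"
    by blast
  have "a \<in> keys (F A * G (J - A))" by (rule subsetD[OF keys_of_int_times A(2)])
  then obtain b c where "b \<in> keys (F A)" "c \<in> keys (G (J - A))" "a = b + c"
    by (rule keys_times_elim)
  moreover have "card A + card (J - A) = card J"
    using A(1) \<open>finite J\<close> by (simp add: card_Diff_subset card_mono finite_subset)
  ultimately show "int (card J) + 2 * int (monomial_degree a) = p + q"
    using ext_poly_degD[OF F, of b A] ext_poly_degD[OF G, of c "J - A"] by (simp add: monomial_degree_plus)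
qed

lemma ext_poly_deg_parity:
  assumes "F \<in> ext_poly_deg m p" "F J \<noteq> 0" shows "even (card J) = even p"
proof -
  obtain a where "a \<in> keys (F J)" using assms(2) by (metis all_not_in_conv keys_eq_empty)
  then have "p = int (card J) + 2 * int (monomial_degree a)" using ext_poly_degD[OF assms(1)] by simp
  then show ?thesis by simp
qed

lemma ext_poly_graded_comm:
  assumes F: "F \<in> ext_poly_deg m p" and G: "G \<in> ext_poly_deg m q"
  shows "ext_mult F G = (if even (p * q) then ext_mult G F else (\<lambda>J. - ext_mult G F J))"
proof
  fix J
  show "ext_mult F G J = (if even (p * q) then ext_mult G F else (\<lambda>J. - ext_mult G F J)) J"
  proof (cases "finite J")
    case True
    have "ext_mult F G J = (- 1) ^ (if even (p * q) then 0 else 1) * ext_mult G F J"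
      using True ext_poly_deg_parity[OF F] ext_poly_deg_parity[OF G] by (intro ext_mult_swap) auto
    then show ?thesis by simp
  qed (simp add: ext_mult_infinite)
qed

lemma ext_deriv_deg:
  assumes x: "\<And>i. i \<in> {1..m} \<Longrightarrow> x i \<in> carrier (poly_ring m)"
    "\<And>i a. i \<in> {1..m} \<Longrightarrow> a \<in> keys (x i) \<Longrightarrow> 2 * int (monomial_degree a) = e + 1"
    and F: "F \<in> ext_poly_deg m n"
  shows "ext_deriv m x F \<in> ext_poly_deg m (n + e)"
proof (rule ext_poly_degI)
  show "ext_deriv m x F \<in> ext_poly_carrier m"
    using x(1) F by (intro ext_deriv_closed ext_poly_deg_carrier)
  fix J a assume J: "J \<subseteq> {1..m}" and a: "a \<in> keys (ext_deriv m x F J)"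
  from a have "a \<in> (\<Union>i\<in>{1..m}. keys (x i * ext_partial i F J))"
    unfolding ext_deriv_def by (rule subsetD[OF keys_sum])
  then obtain i where i: "i \<in> {1..m}" "a \<in> keys (x i * ext_partial i F J)"
    by blast
  then obtain b c where bc: "b \<in> keys (x i)" "c \<in> keys (ext_partial i F J)" "a = b + c"
    by (elim keys_times_elim)
  then have "i \<notin> J" "c \<in> keys (F (insert i J))"
    by (auto simp: ext_partial_def split: if_splits dest!: subsetD[OF keys_of_int_times])
  moreover have "finite J" using J finite_subset by blast
  ultimately show "int (card J) + 2 * int (monomial_degree a) = n + e"
    using ext_poly_degD[OF F, of c "insert i J"] x(2)[OF i(1) bc(1)] bc(3) by (simp add: monomial_degree_plus)
qed

lemma ext_deriv_leibniz_deg: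
  assumes x: "\<And>i. i \<in> {1..m} \<Longrightarrow> x i \<in> carrier (poly_ring m)"
    and F: "F \<in> ext_poly_deg m p" and G: "G \<in> ext_poly_carrier m"
  shows "ext_deriv m x (ext_mult F G) = (\<lambda>J. ext_mult (ext_deriv m x F) G J
    + (if even p then ext_mult F (ext_deriv m x G) J else - ext_mult F (ext_deriv m x G) J))"
proof
  fix J
  note Fc = ext_poly_deg_carrier[OF F]
  show "ext_deriv m x (ext_mult F G) J = ext_mult (ext_deriv m x F) G J
    + (if even p then ext_mult F (ext_deriv m x G) J else - ext_mult F (ext_deriv m x G) J)"
  proof (cases "finite J")
    case True
    have "ext_parity F A = (if even p then 1 else - 1) * F A" for A
      using ext_poly_deg_parity[OF F, of A] by (cases "F A = 0") (auto simp: ext_parity_def)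
    then have "ext_mult (ext_parity F) (ext_deriv m x G) J
        = (if even p then 1 else - 1) * ext_mult F (ext_deriv m x G) J"
      by (simp add: ext_mult_def sum_negf)
    then show ?thesis using ext_deriv_leibniz[OF True, of m x F G] by simp
  next
    case False
    have "ext_deriv m x (ext_mult F G) J = 0"
      by (rule ext_poly_finite[OF ext_deriv_closed[OF x ext_poly_mult[OF Fc G]] False])
    then show ?thesis using False by (simp add: ext_mult_infinite)
  qed
qed

section \<open>The Koszul algebra over the face ring\<close>

context complex_on begin

text \<open>
  Reduction of the coefficients modulo the Stanley-Reisner ideal, a surjective ring homomorphism onto
  the Koszul algebra.
\<close>

definition koszul_of :: "mpoly ext \<Rightarrow> nat set \<Rightarrow> mpoly set" where
  "koszul_of F = (\<lambda>J\<in>Pow {1..m}. fc (F J))"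

lemma koszul_sel:
  "carrier (koszul m K) = Pow {1..m} \<rightarrow>\<^sub>E carrier (face_ring m K)"
  "mult (koszul m K) = (\<lambda>f g. \<lambda>J\<in>Pow {1..m}. \<Oplus>\<^bsub>face_ring m K\<^esub>A\<in>Pow J.
      [shuffle_sign A (J - A)] \<cdot>\<^bsub>face_ring m K\<^esub> (f A \<otimes>\<^bsub>face_ring m K\<^esub> g (J - A)))"
  "one (koszul m K) = (\<lambda>J\<in>Pow {1..m}. if J = {} then \<one>\<^bsub>face_ring m K\<^esub> else \<zero>\<^bsub>face_ring m K\<^esub>)"
  "zero (koszul m K) = (\<lambda>J\<in>Pow {1..m}. \<zero>\<^bsub>face_ring m K\<^esub>)"
  "add (koszul m K) = (\<lambda>f g. \<lambda>J\<in>Pow {1..m}. f J \<oplus>\<^bsub>face_ring m K\<^esub> g J)"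
  by (simp_all add: koszul_def exterior_ring_def)

lemma koszul_of_closed: "F \<in> ext_poly_carrier m \<Longrightarrow> koszul_of F \<in> carrier (koszul m K)"
  by (simp add: koszul_of_def koszul_sel face_class_closed ext_poly_coeff)

lemma koszul_of_apply: "J \<subseteq> {1..m} \<Longrightarrow> koszul_of F J = fc (F J)"
  by (simp add: koszul_of_def)

lemma koszul_of_surj:
  assumes "f \<in> carrier (koszul m K)"
  obtains F where "F \<in> ext_poly_carrier m" "f = koszul_of F"
proof -
  have "f J \<in> fc ` carrier (poly_ring m)" if "J \<in> Pow {1..m}" for J
    using PiE_mem[OF assms[unfolded koszul_sel] that] by (simp add: face_ring_carrier)
  then have "\<forall>J\<in>Pow {1..m}. \<exists>p. p \<in> carrier (poly_ring m) \<and> f J = fc p" by blast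
  then obtain p where p: "\<forall>J\<in>Pow {1..m}. p J \<in> carrier (poly_ring m) \<and> f J = fc (p J)" by metis
  define F where "F = (\<lambda>J. if J \<subseteq> {1..m} then p J else 0)"
  have "F \<in> ext_poly_carrier m"
    by (rule ext_polyI) (use p in \<open>auto simp: F_def poly_carrier_closed\<close>)
  moreover have "f J = koszul_of F J" for J
    using p assms PiE_arb[of f "Pow {1..m}" "\<lambda>_. carrier (face_ring m K)" J]
    by (cases "J \<subseteq> {1..m}") (auto simp: F_def koszul_of_def koszul_sel)
  ultimately show thesis using that by blast
qed

lemma koszul_of_eq_iff:
  assumes "F \<in> ext_poly_carrier m" "G \<in> ext_poly_carrier m"
  shows "koszul_of F = koszul_of G \<longleftrightarrow> (\<forall>J a. J \<subseteq> {1..m} \<longrightarrow> keys a \<in> K \<longrightarrow>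
    lookup (F J) a = lookup (G J) a)"
proof -
  have "koszul_of F = koszul_of G \<longleftrightarrow> (\<forall>J. J \<subseteq> {1..m} \<longrightarrow> fc (F J) = fc (G J))"
    by (auto simp: koszul_of_def fun_eq_iff restrict_def)
  then show ?thesis
    using face_class_eq_iff[OF ext_poly_coeff[OF assms(1)] ext_poly_coeff[OF assms(2)]] by auto
qed

lemma koszul_of_hom: "koszul_of \<in> ring_hom (ext_poly_ring m) (koszul m K)"
proof (rule ring_hom_memI)
  show "koszul_of F \<in> carrier (koszul m K)" if "F \<in> carrier (ext_poly_ring m)" for F
    using that koszul_of_closed by simp
  show "koszul_of \<one>\<^bsub>ext_poly_ring m\<^esub> = \<one>\<^bsub>koszul m K\<^esub>"
    by (rule HOL.ext) (simp add: koszul_of_def koszul_sel face_class_one face_class_zero restrict_def)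
  fix F G assume "F \<in> carrier (ext_poly_ring m)" "G \<in> carrier (ext_poly_ring m)"
  then have F: "F J \<in> carrier (poly_ring m)" and G: "G J \<in> carrier (poly_ring m)" for J
    by (simp_all add: ext_poly_coeff)
  show "koszul_of (F \<oplus>\<^bsub>ext_poly_ring m\<^esub> G) = koszul_of F \<oplus>\<^bsub>koszul m K\<^esub> koszul_of G"
    by (rule HOL.ext) (simp add: koszul_of_def koszul_sel face_class_add F G restrict_def)
  show "koszul_of (F \<otimes>\<^bsub>ext_poly_ring m\<^esub> G) = koszul_of F \<otimes>\<^bsub>koszul m K\<^esub> koszul_of G"
  proof
    fix J
    show "koszul_of (F \<otimes>\<^bsub>ext_poly_ring m\<^esub> G) J = (koszul_of F \<otimes>\<^bsub>koszul m K\<^esub> koszul_of G) J"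
    proof (cases "J \<subseteq> {1..m}")
      case True
      interpret S: ring "face_ring m K" by (rule face_ring_is_ring)
      have "fc (ext_mult F G J) = (\<Oplus>\<^bsub>face_ring m K\<^esub>A\<in>Pow J.
          fc (of_int (shuffle_sign A (J - A)) * (F A * G (J - A))))"
        unfolding ext_mult_def
        by (rule face_class_sum) (simp add: poly_carrier_of_int_mult poly_carrier_mult F G)
      also have "\<dots> = (\<Oplus>\<^bsub>face_ring m K\<^esub>A\<in>Pow J.
          [shuffle_sign A (J - A)] \<cdot>\<^bsub>face_ring m K\<^esub> (koszul_of F A \<otimes>\<^bsub>face_ring m K\<^esub> koszul_of G (J - A)))"
      proof (rule S.add.finprod_cong', rule refl, rule funcsetI)
        fix A assume "A \<in> Pow J"
        then have A: "A \<subseteq> {1..m}" "J - A \<subseteq> {1..m}" using True by auto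
        show "fc (of_int (shuffle_sign A (J - A)) * (F A * G (J - A)))
            = [shuffle_sign A (J - A)] \<cdot>\<^bsub>face_ring m K\<^esub> (koszul_of F A \<otimes>\<^bsub>face_ring m K\<^esub> koszul_of G (J - A))"
          using A by (simp add: koszul_of_apply face_class_int_mult face_class_mult poly_carrier_mult F G)
        show "[shuffle_sign A (J - A)] \<cdot>\<^bsub>face_ring m K\<^esub> (koszul_of F A \<otimes>\<^bsub>face_ring m K\<^esub> koszul_of G (J - A))
            \<in> carrier (face_ring m K)"
          using A by (simp add: koszul_of_apply face_class_closed F G)
      qed
      finally show ?thesis using True by (simp add: koszul_of_apply koszul_sel)
    qed (simp add: koszul_of_def koszul_sel)
  qed
qed

lemma koszul_is_ring: "ring (koszul m K)"
proof -
  interpret E: ring "ext_poly_ring m" by (rule ext_poly_ring_is_ring)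
  have "koszul_of ` carrier (ext_poly_ring m) = carrier (koszul m K)"
    by (auto simp: koszul_of_closed elim!: koszul_of_surj)
  moreover have "koszul_of \<zero>\<^bsub>ext_poly_ring m\<^esub> = \<zero>\<^bsub>koszul m K\<^esub>"
    by (auto simp: koszul_of_def koszul_sel face_class_zero)
  ultimately show ?thesis using E.ring_hom_imp_img_ring[OF koszul_of_hom] by simp
qed

lemma koszul_of_add:
  "F \<in> ext_poly_carrier m \<Longrightarrow> G \<in> ext_poly_carrier m \<Longrightarrow>
    koszul_of F \<oplus>\<^bsub>koszul m K\<^esub> koszul_of G = koszul_of (\<lambda>J. F J + G J)"
  using ring_hom_add[OF koszul_of_hom, of F G] by simp

lemma koszul_of_mult:
  "F \<in> ext_poly_carrier m \<Longrightarrow> G \<in> ext_poly_carrier m \<Longrightarrow>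
    koszul_of F \<otimes>\<^bsub>koszul m K\<^esub> koszul_of G = koszul_of (ext_mult F G)"
  using ring_hom_mult[OF koszul_of_hom, of F G] by simp

lemma koszul_of_one: "\<one>\<^bsub>koszul m K\<^esub> = koszul_of (\<lambda>J. if J = {} then 1 else 0)"
  using ring_hom_one[OF koszul_of_hom] by simp

lemma koszul_of_zero: "\<zero>\<^bsub>koszul m K\<^esub> = koszul_of (\<lambda>J. 0)"
  using ring_hom_zero[OF koszul_of_hom ext_poly_ring_is_ring koszul_is_ring] by simp

lemma koszul_of_minus:
  assumes "F \<in> ext_poly_carrier m"
  shows "\<ominus>\<^bsub>koszul m K\<^esub> koszul_of F = koszul_of (\<lambda>J. - F J)"
proof -
  interpret k: ring "koszul m K" by (rule koszul_is_ring)
  show ?thesis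
    using assms ext_poly_uminus[OF assms]
    by (intro k.minus_equality) (simp_all add: koszul_of_add koszul_of_closed koszul_of_zero)
qed

lemma koszul_of_finsum:
  assumes "\<And>i. i \<in> A \<Longrightarrow> F i \<in> ext_poly_carrier m"
  shows "(\<Oplus>\<^bsub>koszul m K\<^esub>i\<in>A. koszul_of (F i)) = koszul_of (\<lambda>J. \<Sum>i\<in>A. F i J)"
proof -
  have "koszul_of (\<Oplus>\<^bsub>ext_poly_ring m\<^esub>i\<in>A. F i) = (\<Oplus>\<^bsub>koszul m K\<^esub>i\<in>A. koszul_of (F i))"
    by (rule additive_map_finsum[where h=koszul_of and R="ext_poly_ring m" and S="koszul m K" and f=F])
      (simp_all add: assms koszul_of_closed koszul_of_add ring.is_abelian_group ext_poly_ring_is_ring koszul_is_ring)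
  then show ?thesis using ext_poly_finsum[OF assms, of A] by simp
qed

lemma koszul_of_int_mult:
  assumes "F \<in> ext_poly_carrier m"
  shows "[(k::int)] \<cdot>\<^bsub>koszul m K\<^esub> koszul_of F = koszul_of (\<lambda>J. of_int k * F J)"
proof -
  interpret k: ring "koszul m K" by (rule koszul_is_ring)
  have nat: "[(n::nat)] \<cdot>\<^bsub>koszul m K\<^esub> koszul_of F = koszul_of (\<lambda>J. of_nat n * F J)
      \<and> (\<lambda>J. of_nat n * F J) \<in> ext_poly_carrier m" for n
  proof (induction n)
    case 0
    then show ?case using ext_poly_zero by (simp add: koszul_of_zero)
  next
    case (Suc n)
    then show ?case
      using assms ext_poly_add[of "\<lambda>J. of_nat n * F J" m F]
      by (simp add: k.add.nat_pow_Suc koszul_of_add algebra_simps)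
  qed
  show ?thesis
  proof (cases "k \<ge> 0")
    case True
    then have "k = int (nat k)" by simp
    then show ?thesis using nat[of "nat k"] by (metis add_pow_int_ge True of_int_of_nat_eq)
  next
    case False
    then have "[k] \<cdot>\<^bsub>koszul m K\<^esub> koszul_of F = \<ominus>\<^bsub>koszul m K\<^esub> ([nat (- k)] \<cdot>\<^bsub>koszul m K\<^esub> koszul_of F)"
      by (simp add: add_pow_int_lt)
    also have "\<dots> = koszul_of (\<lambda>J. - (of_int (- k) * F J))"
      using False nat[of "nat (- k)"] koszul_of_minus by (simp add: of_nat_nat del: of_int_minus)
    finally show ?thesis by simp
  qed
qed

lemma koszul_of_ext_deriv:
  assumes x: "\<And>i. i \<in> {1..m} \<Longrightarrow> x i \<in> carrier (poly_ring m)" and F: "F \<in> ext_poly_carrier m"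
  shows "exterior_derivation m (face_ring m K) (\<lambda>i. fc (x i)) (koszul_of F) = koszul_of (ext_deriv m x F)"
proof
  fix J
  let ?S = "face_ring m K"
  show "exterior_derivation m ?S (\<lambda>i. fc (x i)) (koszul_of F) J = koszul_of (ext_deriv m x F) J"
  proof (cases "J \<subseteq> {1..m}")
    case True
    interpret S: ring ?S by (rule face_ring_is_ring)
    let ?t = "\<lambda>i. of_int (shuffle_sign {i} J) * (x i * F (insert i J))"
    have fin: "finite J" using True finite_subset by blast
    have "ext_deriv m x F J = (\<Sum>i\<in>{1..m} - J. ?t i)"
      unfolding ext_deriv_def
      by (rule sum.mono_neutral_cong_right) (auto simp: ext_partial_def algebra_simps)
    moreover have "fc (\<Sum>i\<in>{1..m} - J. ?t i) = (\<Oplus>\<^bsub>?S\<^esub>i\<in>{1..m} - J. fc (?t i))"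
      by (rule face_class_sum)
        (simp add: x ext_poly_coeff[OF F] poly_carrier_of_int_mult poly_carrier_mult)
    moreover have "\<dots> = (\<Oplus>\<^bsub>?S\<^esub>i\<in>{1..m} - J.
        [eps i (insert i J)] \<cdot>\<^bsub>?S\<^esub> (fc (x i) \<otimes>\<^bsub>?S\<^esub> koszul_of F (insert i J)))"
    proof (rule S.add.finprod_cong', rule refl, rule funcsetI)
      fix i assume i: "i \<in> {1..m} - J"
      have e: "eps i (insert i J) = shuffle_sign {i} J"
        using i fin by (simp add: eps_eq_shuffle_sign shuffle_sign_insert_right)
      show "fc (?t i) = [eps i (insert i J)] \<cdot>\<^bsub>?S\<^esub> (fc (x i) \<otimes>\<^bsub>?S\<^esub> koszul_of F (insert i J))"
        using i True by (simp add: e koszul_of_apply face_class_int_mult face_class_mult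
            poly_carrier_mult x ext_poly_coeff[OF F])
      show "[eps i (insert i J)] \<cdot>\<^bsub>?S\<^esub> (fc (x i) \<otimes>\<^bsub>?S\<^esub> koszul_of F (insert i J)) \<in> carrier ?S"
        using i True by (simp add: koszul_of_apply face_class_closed x ext_poly_coeff[OF F])
    qed
    ultimately show ?thesis using True by (simp add: exterior_derivation_def koszul_of_apply)
  qed (simp add: exterior_derivation_def koszul_of_def)
qed

lemma koszul_deg_eq: "koszul_deg m K n = koszul_of ` ext_poly_deg m n"
proof
  have hom: "f \<in> face_deg m K (n - int (card J)) \<longleftrightarrow> (\<exists>p \<in> carrier (poly_ring m). f = fc p \<and>
      (\<forall>a\<in>keys p. int (card J) + 2 * int (monomial_degree a) = n))" for f J
    unfolding face_deg_def monomial_degree_def by (auto simp: algebra_simps)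
  show "koszul_of ` ext_poly_deg m n \<subseteq> koszul_deg m K n"
  proof
    fix f assume "f \<in> koszul_of ` ext_poly_deg m n"
    then obtain F where F: "F \<in> ext_poly_deg m n" "f = koszul_of F" by blast
    note Fc = ext_poly_deg_carrier[OF F(1)]
    have "koszul_of F J \<in> face_deg m K (n - int (card J))" if "J \<subseteq> {1..m}" for J
      unfolding hom koszul_of_apply[OF that]
      using ext_poly_coeff[OF Fc, of J] ext_poly_degD[OF F(1), of _ J] by blast
    then show "f \<in> koszul_deg m K n" using F koszul_of_closed[OF Fc] by (simp add: koszul_deg_def)
  qed
  show "koszul_deg m K n \<subseteq> koszul_of ` ext_poly_deg m n"
  proof
    fix f assume f: "f \<in> koszul_deg m K n"
    then have "\<forall>J\<in>Pow {1..m}. \<exists>p. p \<in> carrier (poly_ring m) \<and> f J = fc p \<and>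
      (\<forall>a\<in>keys p. int (card J) + 2 * int (monomial_degree a) = n)"
      unfolding koszul_deg_def hom by blast
    then obtain p where p: "\<forall>J\<in>Pow {1..m}. p J \<in> carrier (poly_ring m) \<and> f J = fc (p J) \<and>
      (\<forall>a\<in>keys (p J). int (card J) + 2 * int (monomial_degree a) = n)" by metis
    define F where "F = (\<lambda>J. if J \<subseteq> {1..m} then p J else 0)"
    have Fc: "F \<in> ext_poly_carrier m"
      by (rule ext_polyI) (use p in \<open>auto simp: F_def poly_carrier_closed\<close>)
    have "F \<in> ext_poly_deg m n"
      by (rule ext_poly_degI[OF Fc]) (use p in \<open>auto simp: F_def\<close>)
    moreover have "f J = koszul_of F J" for J
      using p f PiE_arb[of f "Pow {1..m}" "\<lambda>_. carrier (face_ring m K)" J]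
      by (cases "J \<subseteq> {1..m}") (auto simp: F_def koszul_of_def koszul_sel koszul_deg_def)
    ultimately show "f \<in> koszul_of ` ext_poly_deg m n" by blast
  qed
qed

definition ext_poly_part :: "int \<Rightarrow> mpoly ext \<Rightarrow> mpoly ext" where
  "ext_poly_part n F J =
    Poly_Mapping.mapp (\<lambda>a c. if int (card J) + 2 * int (monomial_degree a) = n then c else 0) (F J)"

lemma lookup_part: "lookup (ext_poly_part n F J) a
    = (if int (card J) + 2 * int (monomial_degree a) = n then lookup (F J) a else 0)"
  by (simp add: ext_poly_part_def lookup_mapp when_def in_keys_iff)

lemma ext_poly_part_deg:
  assumes "F \<in> ext_poly_carrier m" shows "ext_poly_part n F \<in> ext_poly_deg m n"
proof (rule ext_poly_degI)
  have sub: "keys (ext_poly_part n F J) \<subseteq> keys (F J)" for J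
    by (auto simp: in_keys_iff lookup_part split: if_splits)
  show "ext_poly_part n F \<in> ext_poly_carrier m"
  proof (rule ext_polyI)
    show "ext_poly_part n F J \<in> carrier (poly_ring m)" for J
      using ext_poly_coeff[OF assms, of J] sub[of J] unfolding poly_carrier_iff by blast
    show "ext_poly_part n F J = 0" if "\<not> J \<subseteq> {1..m}" for J
      using ext_poly_outside[OF assms that] sub[of J] by simp
  qed
qed (auto simp: in_keys_iff lookup_part split: if_splits)

lemma koszul_deg_span:
  assumes "f \<in> carrier (koszul m K)"
  shows "\<exists>N g. finite N \<and> (\<forall>n\<in>N. g n \<in> koszul_deg m K n) \<and> f = (\<Oplus>\<^bsub>koszul m K\<^esub>n\<in>N. g n)"
proof -
  obtain F where F: "F \<in> ext_poly_carrier m" "f = koszul_of F" using koszul_of_surj[OF assms] by blast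
  define N where "N = (\<lambda>(J, a). int (card J) + 2 * int (monomial_degree a)) `
    (SIGMA J : Pow {1..m}. keys (F J))"
  have fin: "finite N" unfolding N_def by (intro finite_imageI finite_SigmaI) auto
  have "(\<lambda>J. \<Sum>n\<in>N. ext_poly_part n F J) = F"
  proof
    fix J
    show "(\<Sum>n\<in>N. ext_poly_part n F J) = F J"
    proof (rule poly_mapping_eqI)
      fix a
      let ?n = "int (card J) + 2 * int (monomial_degree a)"
      have "lookup (F J) a = 0" if "?n \<notin> N"
        using that ext_poly_outside[OF F(1), of J] unfolding N_def
        by (cases "J \<subseteq> {1..m}") (force simp: in_keys_iff)+
      then show "lookup (\<Sum>n\<in>N. ext_poly_part n F J) a = lookup (F J) a"
        using fin by (auto simp: lookup_sum lookup_part)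
    qed
  qed
  then have "f = (\<Oplus>\<^bsub>koszul m K\<^esub>n\<in>N. koszul_of (ext_poly_part n F))"
    using koszul_of_finsum[of N "\<lambda>n. ext_poly_part n F"] ext_poly_deg_carrier[OF ext_poly_part_deg[OF F(1)]] F(2)
    by simp
  moreover have "koszul_of (ext_poly_part n F) \<in> koszul_deg m K n" for n
    unfolding koszul_deg_eq by (rule imageI) (rule ext_poly_part_deg[OF F(1)])
  ultimately show ?thesis
    using fin by (intro exI[of _ N] exI[of _ "\<lambda>n. koszul_of (ext_poly_part n F)"]) simp
qed

text \<open>
  Forms of different degrees have no monomial in common, and equality in the Koszul algebra is checked
  on monomials.
\<close>

lemma koszul_deg_independent:
  assumes N: "finite N" and g: "\<And>n. n \<in> N \<Longrightarrow> g n \<in> koszul_deg m K n"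
    and z: "(\<Oplus>\<^bsub>koszul m K\<^esub>n\<in>N. g n) = \<zero>\<^bsub>koszul m K\<^esub>" and n: "n \<in> N"
  shows "g n = \<zero>\<^bsub>koszul m K\<^esub>"
proof -
  interpret k: ring "koszul m K" by (rule koszul_is_ring)
  have "\<forall>n\<in>N. \<exists>F. F \<in> ext_poly_deg m n \<and> g n = koszul_of F" using g unfolding koszul_deg_eq by blast
  then obtain F where F: "\<And>n. n \<in> N \<Longrightarrow> F n \<in> ext_poly_deg m n" "\<And>n. n \<in> N \<Longrightarrow> g n = koszul_of (F n)"
    by metis
  note Fc = ext_poly_deg_carrier[OF F(1)]
  have "(\<Oplus>\<^bsub>koszul m K\<^esub>n\<in>N. g n) = (\<Oplus>\<^bsub>koszul m K\<^esub>n\<in>N. koszul_of (F n))"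
    by (rule k.add.finprod_cong', rule refl, rule funcsetI) (simp_all add: F(2) koszul_of_closed Fc)
  also have "\<dots> = koszul_of (\<lambda>J. \<Sum>n\<in>N. F n J)" by (rule koszul_of_finsum) (rule Fc)
  finally have "koszul_of (\<lambda>J. \<Sum>n\<in>N. F n J) = koszul_of (\<lambda>J. 0)" using z by (simp add: koszul_of_zero)
  then have 0: "(\<Sum>i\<in>N. lookup (F i J) a) = 0"
    if "J \<subseteq> {1..m}" "keys a \<in> K" for J a
    using koszul_of_eq_iff[OF ext_poly_sum[of N F, OF Fc] ext_poly_zero] that by (simp add: lookup_sum)
  have "lookup (F n J) a = 0" if "J \<subseteq> {1..m}" "keys a \<in> K" for J a
  proof (rule ccontr)
    assume nz: "lookup (F n J) a \<noteq> 0"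
    have "lookup (F i J) a = 0" if "i \<in> N" "i \<noteq> n" for i
      using nz ext_poly_degD[OF F(1)[OF n], of a J] ext_poly_degD[OF F(1)[OF that(1)], of a J] that(2)
      by (auto simp: in_keys_iff)
    then have "(\<Sum>i\<in>N. lookup (F i J) a) = lookup (F n J) a"
      using N n by (simp add: sum.remove[OF N n])
    then show False using 0[OF that] nz by simp
  qed
  then have "koszul_of (F n) = koszul_of (\<lambda>J. 0)"
    using koszul_of_eq_iff[OF Fc[OF n] ext_poly_zero] by simp
  then show ?thesis using F(2)[OF n] koszul_of_zero by simp
qed

theorem koszul_graded_comm_ring: "graded_comm_ring (koszul m K) (koszul_deg m K)"
proof -
  interpret k: ring "koszul m K" by (rule koszul_is_ring)
  have sub: "additive_subgroup (koszul_deg m K n) (koszul m K)" for n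
  proof (rule additive_subgroup.intro,
      rule group.subgroupI[OF abelian_group.a_group[OF k.abelian_group_axioms]])
    show "koszul_deg m K n \<subseteq> carrier (add_monoid (koszul m K))" by (auto simp: koszul_deg_def)
    show "koszul_deg m K n \<noteq> {}" using ext_poly_deg_zero by (auto simp: koszul_deg_eq)
    fix f assume "f \<in> koszul_deg m K n"
    then obtain F where F: "F \<in> ext_poly_deg m n" "f = koszul_of F" by (auto simp: koszul_deg_eq)
    have "inv\<^bsub>add_monoid (koszul m K)\<^esub> f = koszul_of (\<lambda>J. - F J)"
      unfolding koszul_of_minus[OF ext_poly_deg_carrier[OF F(1)], symmetric] F(2) a_inv_def[of "koszul m K"] ..
    then show "inv\<^bsub>add_monoid (koszul m K)\<^esub> f \<in> koszul_deg m K n"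
      using ext_poly_deg_uminus[OF F(1)] by (auto simp: koszul_deg_eq)
    fix g assume "g \<in> koszul_deg m K n"
    then obtain G where G: "G \<in> ext_poly_deg m n" "g = koszul_of G" by (auto simp: koszul_deg_eq)
    have "f \<oplus>\<^bsub>koszul m K\<^esub> g = koszul_of (\<lambda>J. F J + G J)"
      using F G by (simp add: koszul_of_add ext_poly_deg_carrier)
    then show "f \<otimes>\<^bsub>add_monoid (koszul m K)\<^esub> g \<in> koszul_deg m K n"
      using ext_poly_deg_add[OF F(1) G(1)] by (simp add: koszul_deg_eq)
  qed
  show ?thesis
  proof (intro graded_comm_ring.intro graded_comm_ring_axioms.intro)
    show "ring (koszul m K)" by (rule koszul_is_ring)
    show "additive_subgroup (koszul_deg m K n) (koszul m K)" for n by (rule sub)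
    fix f assume "f \<in> carrier (koszul m K)"
    from koszul_deg_span[OF this]
    show "\<exists>!g. (\<forall>n. g n \<in> koszul_deg m K n) \<and> finite {n. g n \<noteq> \<zero>\<^bsub>koszul m K\<^esub>} \<and>
        f = (\<Oplus>\<^bsub>koszul m K\<^esub>n\<in>{n. g n \<noteq> \<zero>\<^bsub>koszul m K\<^esub>}. g n)"
    proof (rule k.deg_decompI[OF sub])
      fix N g n assume "finite N" "\<And>n. n \<in> N \<Longrightarrow> g n \<in> koszul_deg m K n"
        "(\<Oplus>\<^bsub>koszul m K\<^esub>n\<in>N. g n) = \<zero>\<^bsub>koszul m K\<^esub>" "n \<in> N"
      then show "g n = \<zero>\<^bsub>koszul m K\<^esub>" using koszul_deg_independent[where g=g and N=N] by blast
    qed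
  next
    have "(\<lambda>J. if J = {} then 1 else 0) \<in> ext_poly_deg m 0"
      by (rule ext_poly_degI[OF ext_poly_one]) (auto simp: monomial_degree_def split: if_splits)
    then show "\<one>\<^bsub>koszul m K\<^esub> \<in> koszul_deg m K 0" by (simp add: koszul_of_one koszul_deg_eq)
  next
    fix p q f g assume "f \<in> koszul_deg m K p" "g \<in> koszul_deg m K q"
    then obtain F G where F: "F \<in> ext_poly_deg m p" "f = koszul_of F"
      and G: "G \<in> ext_poly_deg m q" "g = koszul_of G" by (auto simp: koszul_deg_eq)
    note Fc = ext_poly_deg_carrier[OF F(1)] and Gc = ext_poly_deg_carrier[OF G(1)]
    show "f \<otimes>\<^bsub>koszul m K\<^esub> g \<in> koszul_deg m K (p + q)"
      using ext_poly_deg_mult[OF F(1) G(1)] by (simp add: F(2) G(2) koszul_of_mult Fc Gc koszul_deg_eq)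
    show "f \<otimes>\<^bsub>koszul m K\<^esub> g =
        (if even (p * q) then g \<otimes>\<^bsub>koszul m K\<^esub> f else \<ominus>\<^bsub>koszul m K\<^esub> (g \<otimes>\<^bsub>koszul m K\<^esub> f))"
      using ext_poly_graded_comm[OF F(1) G(1)]
      by (simp add: F(2) G(2) koszul_of_mult Fc Gc koszul_of_minus ext_poly_mult)
  qed
qed

text \<open>
  Taking \<open>x i = v\<^sub>i\<close> with \<open>e = 1\<close> gives the Koszul differential, and \<open>x i = 1\<close> with \<open>e = -1\<close> gives \<open>d'\<close>.
\<close>

theorem koszul_derivation:
  assumes x: "\<And>i. i \<in> {1..m} \<Longrightarrow> x i \<in> carrier (poly_ring m)"
    "\<And>i a. i \<in> {1..m} \<Longrightarrow> a \<in> keys (x i) \<Longrightarrow> 2 * int (monomial_degree a) = e + 1"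
    and e: "odd e"
  shows "graded_diff_ring (koszul m K) (koszul_deg m K)
    (exterior_derivation m (face_ring m K) (\<lambda>i. fc (x i))) e"
proof (intro graded_diff_ring.intro graded_diff_ring_axioms.intro)
  let ?d = "exterior_derivation m (face_ring m K) (\<lambda>i. fc (x i))"
  have dk: "?d (koszul_of F) = koszul_of (ext_deriv m x F)" if "F \<in> ext_poly_carrier m" for F
    using x(1) that by (rule koszul_of_ext_deriv)
  have dc: "ext_deriv m x F \<in> ext_poly_carrier m" if "F \<in> ext_poly_carrier m" for F
    using x(1) that by (rule ext_deriv_closed)
  show "graded_comm_ring (koszul m K) (koszul_deg m K)" by (rule koszul_graded_comm_ring)
  show "odd e" by (rule e)
  show "?d (f \<oplus>\<^bsub>koszul m K\<^esub> g) = ?d f \<oplus>\<^bsub>koszul m K\<^esub> ?d g"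
    if fg: "f \<in> carrier (koszul m K)" "g \<in> carrier (koszul m K)" for f g
  proof -
    obtain F G where F: "F \<in> ext_poly_carrier m" "f = koszul_of F"
      and G: "G \<in> ext_poly_carrier m" "g = koszul_of G" using koszul_of_surj fg by metis
    have "ext_deriv m x (\<lambda>J. F J + G J) = (\<lambda>J. ext_deriv m x F J + ext_deriv m x G J)"
      by (simp add: ext_deriv_def[abs_def] ext_partial_linear algebra_simps sum.distrib)
    then show ?thesis
      using F G by (simp add: koszul_of_add dk ext_poly_add dc)
  qed
  show "?d f \<in> koszul_deg m K (n + e)" if f: "f \<in> koszul_deg m K n" for f n
  proof -
    obtain F where F: "F \<in> ext_poly_deg m n" "f = koszul_of F" using f by (auto simp: koszul_deg_eq)
    have "ext_deriv m x F \<in> ext_poly_deg m (n + e)" using x F(1) by (rule ext_deriv_deg)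
    then show ?thesis using F by (simp add: dk ext_poly_deg_carrier koszul_deg_eq)
  qed
  show "?d (?d f) = \<zero>\<^bsub>koszul m K\<^esub>" if f: "f \<in> carrier (koszul m K)" for f
  proof -
    obtain F where F: "F \<in> ext_poly_carrier m" "f = koszul_of F" using koszul_of_surj f by metis
    have "ext_deriv m x (ext_deriv m x F) = (\<lambda>J. 0)" using F(1) x(1) by (rule ext_deriv_square)
    then show ?thesis using F by (simp add: dk dc koszul_of_zero)
  qed
  show "?d (f \<otimes>\<^bsub>koszul m K\<^esub> g) = ?d f \<otimes>\<^bsub>koszul m K\<^esub> g \<oplus>\<^bsub>koszul m K\<^esub>
      (if even p then f \<otimes>\<^bsub>koszul m K\<^esub> ?d g else \<ominus>\<^bsub>koszul m K\<^esub> (f \<otimes>\<^bsub>koszul m K\<^esub> ?d g))"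
    if f: "f \<in> koszul_deg m K p" and g: "g \<in> carrier (koszul m K)" for p f g
  proof -
    obtain F where F: "F \<in> ext_poly_deg m p" "f = koszul_of F" using f by (auto simp: koszul_deg_eq)
    obtain G where G: "G \<in> ext_poly_carrier m" "g = koszul_of G" using koszul_of_surj g by metis
    note Fc = ext_poly_deg_carrier[OF F(1)]
    have "ext_deriv m x (ext_mult F G) = (\<lambda>J. ext_mult (ext_deriv m x F) G J
        + (if even p then ext_mult F (ext_deriv m x G) J else - ext_mult F (ext_deriv m x G) J))"
      using x(1) F(1) G(1) by (rule ext_deriv_leibniz_deg)
    then show ?thesis
      by (simp add: F(2) G(2) dk dc Fc G(1) koszul_of_mult ext_poly_mult koszul_of_add koszul_of_minus ext_poly_uminus
          split: if_split)
  qed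
qed

end

section \<open>Contraction onto squarefree monomials\<close>

abbreviation expo :: "nat \<Rightarrow> (nat \<Rightarrow>\<^sub>0 nat)" where
  "expo i \<equiv> single i 1"

lemma lookup_koszul_deriv:
  "lookup (ext_deriv m mvar F J) a
    = (\<Sum>k\<in>{1..m}. if k \<in> keys a \<and> k \<notin> J
        then shuffle_sign {k} J * lookup (F (insert k J)) (a - expo k) else 0)"
  by (auto simp: ext_deriv_def lookup_sum lookup_mvar_times ext_partial_def intro!: sum.cong)

text \<open>
  Division by \<open>v\<^sub>i\<close>, where monomials not divisible by the square of \<open>v\<^sub>i\<close> are sent to zero.  Requiring the square
  means that the support of a monomial does not change, so that the Stanley-Reisner ideal is preserved.
\<close>

definition lower :: "nat \<Rightarrow> mpoly \<Rightarrow> mpoly" where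
  "lower i f = Poly_Mapping.mapp (\<lambda>a c. if i \<in> keys a then c else 0)
     (Poly_Mapping.map_key (\<lambda>a. a + expo i) f)"

lemma lookup_lower:
  "lookup (lower i f) a
    = (if i \<in> keys a then lookup f (a + expo i) else 0)"
proof -
  have "inj (\<lambda>a :: nat \<Rightarrow>\<^sub>0 nat. a + expo i)" by (simp add: inj_on_def)
  then show ?thesis
    by (simp add: lower_def lookup_mapp map_key.rep_eq when_def in_keys_iff)
qed

text \<open>
  The operator \<open>v\<^sub>i\<^sup>r \<mapsto> u\<^sub>i v\<^sub>i\<^sup>r\<^sup>-\<^sup>1\<close> for \<open>r \<ge> 2\<close>, extended by linearity over the other variables.
\<close>

definition koszul_htpy :: "nat \<Rightarrow> mpoly ext \<Rightarrow> mpoly ext" where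
  "koszul_htpy i F J = (if i \<in> J then of_int (shuffle_sign {i} J) * lower i (F (J - {i})) else 0)"

lemma lookup_htpy:
  "lookup (koszul_htpy i F J) a = (if i \<in> J \<and> i \<in> keys a
    then shuffle_sign {i} J * lookup (F (J - {i})) (a + expo i) else 0)"
  by (simp add: koszul_htpy_def lookup_lower)

text \<open>
  Divisibility of the monomial \<open>u\<^sub>J v\<^sup>a\<close> by \<open>v\<^sub>i\<^sup>2\<close> or by \<open>u\<^sub>i v\<^sub>i\<close>.
\<close>

definition excess :: "nat \<Rightarrow> nat set \<Rightarrow> (nat \<Rightarrow>\<^sub>0 nat) \<Rightarrow> bool" where
  "excess i J a \<longleftrightarrow> lookup a i \<ge> 2 \<or> i \<in> J \<and> i \<in> keys a"

definition koszul_trunc :: "nat \<Rightarrow> mpoly ext \<Rightarrow> mpoly ext" where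
  "koszul_trunc i F J = Poly_Mapping.mapp (\<lambda>a c. if excess i J a then 0 else c) (F J)"

lemma lookup_trunc:
  "lookup (koszul_trunc i F J) a
    = (if excess i J a then 0 else lookup (F J) a)"
  by (simp add: koszul_trunc_def lookup_mapp when_def in_keys_iff)

text \<open>
  In the variable \<open>i\<close> alone, the Koszul differential matches \<open>u\<^sub>i v\<^sub>i\<^sup>r\<close> with \<open>v\<^sub>i\<^sup>r\<^sup>+\<^sup>1\<close>, and the homotopy inverts
  this for \<open>r \<ge> 1\<close>; what is left over are the monomials \<open>1\<close>, \<open>u\<^sub>i\<close> and \<open>v\<^sub>i\<close>.  The parts of the
  differential in the other variables anticommute with the homotopy.
\<close>

lemma koszul_homotopy:
  assumes J: "finite J" and i: "i \<in> {1..m}"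
  shows "ext_deriv m mvar (koszul_htpy i F) J + koszul_htpy i (ext_deriv m mvar F) J
    = F J - koszul_trunc i F J"
proof (rule poly_mapping_eqI)
  fix a
  let ?l = lookup and ?k = keys
  let ?dh = "ext_deriv m mvar (koszul_htpy i F) J" and ?hd = "koszul_htpy i (ext_deriv m mvar F) J"
  have dh: "?l ?dh a = (\<Sum>k\<in>{1..m}. if k \<in> ?k a \<and> k \<notin> J then shuffle_sign {k} J *
      (if i \<in> insert k J \<and> i \<in> ?k (a - expo k) then shuffle_sign {i} (insert k J) *
        ?l (F (insert k J - {i})) (a - expo k + expo i) else 0) else 0)"
    by (simp only: lookup_koszul_deriv lookup_htpy)
  have "?l ?dh a + ?l ?hd a = (if excess i J a then ?l (F J) a else 0)"
  proof (cases "i \<in> J")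
    case iJ: True
    define J0 where "J0 = J - {i}"
    have J0: "J = insert i J0" "i \<notin> J0" "finite J0" using iJ J by (auto simp: J0_def)
    show ?thesis
    proof (cases "i \<in> ?k a")
      \<comment> \<open>The term \<open>k = i\<close> of \<open>?hd\<close> returns the coefficient of \<open>F\<close>; its other terms cancel those of \<open>?dh\<close>.\<close>
      case True
      let ?u = "\<lambda>k. if k \<in> ?k a \<and> k \<notin> J then shuffle_sign {i} J * (shuffle_sign {k} J0 *
        ?l (F (insert k J0)) (a - expo k + expo i)) else 0"
      let ?v = "\<lambda>k. if k \<in> ?k (a + expo i) \<and> k \<notin> J0
        then shuffle_sign {k} J0 * ?l (F (insert k J0)) (a + expo i - expo k) else 0"
      have 1: "?l ?dh a = (\<Sum>k\<in>{1..m} - {i}. - ?u k)"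
        unfolding dh
      proof (rule sum.mono_neutral_cong_right)
        fix k assume k: "k \<in> {1..m} - {i}"
        show "(if k \<in> ?k a \<and> k \<notin> J then shuffle_sign {k} J *
          (if i \<in> insert k J \<and> i \<in> ?k (a - expo k) then shuffle_sign {i} (insert k J) *
          ?l (F (insert k J - {i})) (a - expo k + expo i) else 0) else 0) = - ?u k"
        proof (cases "k \<in> ?k a \<and> k \<notin> J")
          case kJ: True
          have s: "shuffle_sign {k} J * shuffle_sign {i} (insert k J)
              = - (shuffle_sign {i} J * shuffle_sign {k} J0)"
            using kJ k J0 J shuffle_sign_insert_right[of "{k}" J0 i] shuffle_sign_insert_right[of "{i}" J k]
              shuffle_sign_singletons_swap[of k i] by simp
          have e: "insert k J - {i} = insert k J0" using J0 k by auto
          have "i \<in> ?k (a - expo k)"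
            using True k by (simp add: in_keys_iff lookup_minus lookup_single)
          then show ?thesis
            using kJ iJ e arg_cong[OF s, of "\<lambda>x. x * ?l (F (insert k J0)) (a - expo k + expo i)"]
            by (simp add: mult.assoc)
        qed auto
      qed (use i iJ in auto)
      have "?l ?hd a = shuffle_sign {i} J * (\<Sum>k\<in>{1..m}. ?v k)"
        by (simp only: lookup_htpy lookup_koszul_deriv J0_def[symmetric] iJ True if_True simp_thms)
      also have "(\<Sum>k\<in>{1..m}. ?v k) = ?v i + (\<Sum>k\<in>{1..m} - {i}. ?v k)"
        using i by (intro sum.remove) auto
      also have "?v i = shuffle_sign {i} J * ?l (F J) a"
        using J0 shuffle_sign_insert_right[of "{i}" J0 i] True by (simp add: in_keys_iff lookup_add)
      also have "(\<Sum>k\<in>{1..m} - {i}. ?v k) = (\<Sum>k\<in>{1..m} - {i}. shuffle_sign {i} J * ?u k)"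
      proof (rule sum.cong[OF refl])
        fix k assume k: "k \<in> {1..m} - {i}"
        have "k \<in> ?k (a + expo i) \<longleftrightarrow> k \<in> ?k a"
          using k by (simp add: in_keys_iff lookup_add lookup_single)
        moreover have "a + expo i - expo k = a - expo k + expo i"
          using k by (intro poly_mapping_eqI) (auto simp: lookup_add lookup_minus lookup_single when_def)
        moreover have "k \<notin> J0 \<longleftrightarrow> k \<notin> J" using k J0 by auto
        ultimately show "?v k = shuffle_sign {i} J * ?u k" by simp
      qed
      finally have 2: "?l ?hd a = ?l (F J) a + (\<Sum>k\<in>{1..m} - {i}. ?u k)"
        by (simp add: distrib_left sum_distrib_left)
      show ?thesis using True iJ by (simp add: 1 2 sum_negf excess_def)
    next
      case False
      have "i \<notin> ?k (a - expo k)" for k using False by (simp add: in_keys_iff lookup_minus)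
      then have "?l ?dh a = 0" unfolding dh by (intro sum.neutral) auto
      then show ?thesis using False by (simp add: lookup_htpy excess_def in_keys_iff)
    qed
  next
    case False
    \<comment> \<open>Here \<open>?hd\<close> vanishes, and in \<open>?dh\<close> only differentiation in the variable \<open>i\<close> meets the new factor \<open>u\<^sub>i\<close>.\<close>
    have "?l ?dh a = (if i \<in> ?k a \<and> i \<in> ?k (a - expo i) then ?l (F J) (a - expo i + expo i) else 0)"
    proof -
      have "?l ?dh a = (\<Sum>k\<in>{i}. if k \<in> ?k a \<and> k \<notin> J then shuffle_sign {k} J *
        (if i \<in> insert k J \<and> i \<in> ?k (a - expo k) then shuffle_sign {i} (insert k J) *
        ?l (F (insert k J - {i})) (a - expo k + expo i) else 0) else 0)"
        unfolding dh using i False by (intro sum.mono_neutral_right) auto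
      then show ?thesis
        using False shuffle_sign_insert_right[of "{i}" J i] J by simp
    qed
    moreover have "i \<in> ?k a \<and> i \<in> ?k (a - expo i) \<longleftrightarrow> excess i J a"
      using False by (auto simp: excess_def in_keys_iff lookup_minus)
    moreover have "a - expo i + expo i = a" if "excess i J a"
      using that False by (intro poly_mapping_eqI)
        (auto simp: excess_def lookup_add lookup_minus lookup_single when_def in_keys_iff)
    ultimately show ?thesis using False by (cases "excess i J a") (simp_all only: lookup_htpy simp_thms if_True if_False add_0_right)
  qed
  then show "?l (?dh + ?hd) a = ?l (F J - koszul_trunc i F J) a"
    by (simp add: lookup_add lookup_minus lookup_trunc)
qed

lemma mvar_carrier: "i \<in> {1..m} \<Longrightarrow> mvar i \<in> carrier (poly_ring m)"
  by (simp add: mvar_def poly_carrier_iff)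

lemma koszul_htpy_closed:
  assumes "F \<in> ext_poly_carrier m" "i \<in> {1..m}"
  shows "koszul_htpy i F \<in> ext_poly_carrier m"
proof (rule ext_polyI)
  fix J
  show "koszul_htpy i F J \<in> carrier (poly_ring m)"
    unfolding poly_carrier_iff
  proof
    fix a assume "a \<in> keys (koszul_htpy i F J)"
    then have "a + expo i \<in> keys (F (J - {i}))"
      by (auto simp: in_keys_iff lookup_htpy split: if_splits)
    then have "keys (a + expo i) \<subseteq> {1..m}"
      using ext_poly_coeff[OF assms(1), of "J - {i}"] unfolding poly_carrier_iff by blast
    then show "keys a \<subseteq> {1..m}" by (simp add: keys_plus_nat)
  qed
  assume "\<not> J \<subseteq> {1..m}"
  then have "\<not> J - {i} \<subseteq> {1..m}" using assms(2) by auto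
  then have "F (J - {i}) = 0" by (rule ext_poly_outside[OF assms(1)])
  then show "koszul_htpy i F J = 0"
    by (intro poly_mapping_eqI) (simp add: lookup_htpy)
qed

lemma koszul_trunc_closed:
  assumes "F \<in> ext_poly_carrier m" shows "koszul_trunc i F \<in> ext_poly_carrier m"
proof (rule ext_polyI)
  fix J
  have "keys (koszul_trunc i F J) \<subseteq> keys (F J)"
    by (auto simp: in_keys_iff lookup_trunc split: if_splits)
  then show "koszul_trunc i F J \<in> carrier (poly_ring m)"
    using ext_poly_coeff[OF assms, of J] unfolding poly_carrier_iff by blast
  assume "\<not> J \<subseteq> {1..m}"
  then have "F J = 0" by (rule ext_poly_outside[OF assms(1)])
  then show "koszul_trunc i F J = 0" by (intro poly_mapping_eqI) (simp add: lookup_trunc)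
qed

context complex_on begin

lemma koszul_diff_koszul_of:
  "F \<in> ext_poly_carrier m \<Longrightarrow> koszul_diff m K (koszul_of F) = koszul_of (ext_deriv m mvar F)"
  unfolding koszul_diff_def by (rule koszul_of_ext_deriv) (rule mvar_carrier)

lemma koszul_diff_graded: "graded_diff_ring (koszul m K) (koszul_deg m K) (koszul_diff m K) 1"
  unfolding koszul_diff_def
proof (rule koszul_derivation)
  fix i a assume "a \<in> keys (mvar i)"
  then show "2 * int (monomial_degree a) = 1 + 1" by (simp add: mvar_def monomial_degree_def)
qed (simp_all add: mvar_carrier)

text \<open>
  The prefix \<open>kd\<close> marks notions relative to \<open>d\<close>, and \<open>kp\<close> below those relative to \<open>d'\<close>.
\<close>

sublocale kd: graded_diff_ring "koszul m K" "koszul_deg m K" "koszul_diff m K" 1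
  by (rule koszul_diff_graded)

text \<open>
  The homotopy formula holds modulo the Stanley-Reisner ideal for a form whose differential is only
  zero modulo that ideal, because the homotopy preserves the ideal.
\<close>

lemma koszul_trunc_class:
  assumes F: "F \<in> ext_poly_carrier m" "koszul_of F \<in> kd.cocycles" and i: "i \<in> {1..m}"
  shows "koszul_of (koszul_trunc i F) \<in> kd.cocycles \<and> kd.cls (koszul_of (koszul_trunc i F)) = kd.cls (koszul_of F)"
proof -
  let ?D = "ext_deriv m mvar" let ?h = "koszul_htpy i F"
  have DF: "?D F \<in> ext_poly_carrier m"
    using mvar_carrier F(1) by (rule ext_deriv_closed)
  have h: "?h \<in> ext_poly_carrier m" by (rule koszul_htpy_closed[OF F(1) i])
  have Dh: "?D ?h \<in> ext_poly_carrier m" using mvar_carrier h by (rule ext_deriv_closed)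
  have t: "koszul_trunc i F \<in> ext_poly_carrier m" by (rule koszul_trunc_closed[OF F(1)])
  have "koszul_of (?D F) = koszul_of (\<lambda>J. 0)"
    using F by (simp add: kd.cocycles_def koszul_diff_koszul_of koszul_of_zero)
  then have z: "lookup (?D F J) a = 0" if "J \<subseteq> {1..m}" "keys a \<in> K" for J a
    using koszul_of_eq_iff[OF DF ext_poly_zero] that by simp
  have sum: "(\<lambda>J. ?D ?h J + koszul_trunc i F J) \<in> ext_poly_carrier m"
    by (rule ext_poly_add[OF Dh t])
  have "koszul_of F = koszul_of (\<lambda>J. ?D ?h J + koszul_trunc i F J)"
  proof (subst koszul_of_eq_iff[OF F(1) sum], intro allI impI)
    fix J and a :: "nat \<Rightarrow>\<^sub>0 nat"
    assume J: "J \<subseteq> {1..m}" and a: "keys a \<in> K"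
    have hz: "lookup (koszul_htpy i (?D F) J) a = 0"
    proof (cases "i \<in> keys a")
      case True
      then have "keys (a + expo i) = keys a" by (auto simp: keys_plus_nat)
      then have "lookup (?D F (J - {i})) (a + expo i) = 0" using J a by (intro z) auto
      then show ?thesis by (simp add: lookup_htpy)
    qed (simp add: lookup_htpy)
    have fin: "finite J" using J finite_subset by blast
    show "lookup (F J) a = lookup (?D ?h J + koszul_trunc i F J) a"
      using arg_cong[OF koszul_homotopy[OF fin i, of F], of "\<lambda>p. lookup p a"] hz
      by (simp add: lookup_add lookup_minus)
  qed
  also have "\<dots> = koszul_diff m K (koszul_of ?h) \<oplus>\<^bsub>koszul m K\<^esub> koszul_of (koszul_trunc i F)"
    using h t Dh by (simp add: koszul_diff_koszul_of koszul_of_add)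
  finally have eq: "koszul_of F = koszul_diff m K (koszul_of ?h) \<oplus>\<^bsub>koszul m K\<^esub> koszul_of (koszul_trunc i F)" .
  have b: "koszul_diff m K (koszul_of ?h) \<in> kd.cocycles" by (rule kd.boundary_cocycle[OF koszul_of_closed[OF h]])
  have tc: "koszul_of (koszul_trunc i F) \<in> carrier (koszul m K)" by (rule koszul_of_closed[OF t])
  have "koszul_diff m K (koszul_of (koszul_trunc i F)) = \<zero>\<^bsub>koszul m K\<^esub>"
  proof -
    have "koszul_diff m K (koszul_of F) = koszul_diff m K (koszul_diff m K (koszul_of ?h)) \<oplus>\<^bsub>koszul m K\<^esub>
        koszul_diff m K (koszul_of (koszul_trunc i F))"
      unfolding eq using b tc by (intro kd.diff_add) (auto simp: kd.cocycle_carrier)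
    then show ?thesis
      using F(2) tc kd.diff_diff[OF koszul_of_closed[OF h]] by (simp add: kd.cocycles_def kd.diff_closed)
  qed
  then have tz: "koszul_of (koszul_trunc i F) \<in> kd.cocycles" using tc by (simp add: kd.cocycles_def)
  moreover have "kd.cls (koszul_of F) = kd.cls (koszul_of (koszul_trunc i F))"
  proof -
    interpret H: ring kd.H by (rule kd.cohomology_is_ring)
    show ?thesis
      unfolding eq kd.class_add[OF b tz] kd.class_boundary[OF koszul_of_closed[OF h]]
      using kd.class_closed[OF tz] by simp
  qed
  ultimately show ?thesis by simp
qed

text \<open>
  The projections for different variables preserve each other's images, so they can be applied one
  after the other.
\<close>

lemma squarefree_representative:
  assumes "x \<in> kd.cocycles"
  obtains G where "G \<in> ext_poly_carrier m" "koszul_of G \<in> kd.cocycles" "kd.cls (koszul_of G) = kd.cls x"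
    "\<And>J a. lookup (G J) a \<noteq> 0 \<Longrightarrow> keys a \<subseteq> {1..m} \<and>
        a = face_monomial (keys a) \<and> J \<inter> keys a = {}"
proof -
  obtain F where F: "F \<in> ext_poly_carrier m" "x = koszul_of F"
    using koszul_of_surj kd.cocycle_carrier[OF assms] by metis
  have "\<exists>G. G \<in> ext_poly_carrier m \<and> koszul_of G \<in> kd.cocycles \<and> kd.cls (koszul_of G) = kd.cls x \<and>
      (\<forall>i\<in>T. \<forall>J a. excess i J a \<longrightarrow> lookup (G J) a = 0)"
    if "finite T" "T \<subseteq> {1..m}" for T
    using that
  proof (induction T)
    case empty
    then show ?case using F assms by blast
  next
    case (insert i T)
    then obtain G where G: "G \<in> ext_poly_carrier m" "koszul_of G \<in> kd.cocycles" "kd.cls (koszul_of G) = kd.cls x"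
      "\<And>k J a. k \<in> T \<Longrightarrow> excess k J a \<Longrightarrow> lookup (G J) a = 0" by blast
    have i: "i \<in> {1..m}" using insert by blast
    show ?case
      by (rule exI[of _ "koszul_trunc i G"])
        (use koszul_trunc_closed[OF G(1)] koszul_trunc_class[OF G(1,2) i] G(3,4)
          in \<open>auto simp: lookup_trunc\<close>)
  qed
  from this[of "{1..m}"] obtain G where G: "G \<in> ext_poly_carrier m" "koszul_of G \<in> kd.cocycles"
    "kd.cls (koszul_of G) = kd.cls x"
    "\<And>k J a. k \<in> {1..m} \<Longrightarrow> excess k J a \<Longrightarrow> lookup (G J) a = 0" by auto
  show thesis
  proof (rule that[OF G(1-3)])
    fix J a assume nz: "lookup (G J) a \<noteq> 0"
    have keys: "keys a \<subseteq> {1..m}"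
      using ext_poly_coeff[OF G(1), of J] nz unfolding poly_carrier_iff by (auto simp: in_keys_iff)
    have ne: "\<not> excess k J a" if "k \<in> keys a" for k
      using G(4)[of k J a] nz keys that by blast
    have "lookup a k = 1" if "k \<in> keys a" for k
      using ne[OF that] that by (auto simp: excess_def in_keys_iff)
    then have "a = face_monomial (keys a)"
      by (intro poly_mapping_eqI) (auto simp: lookup_face_monomial in_keys_iff)
    moreover have "J \<inter> keys a = {}" using ne by (auto simp: excess_def)
    ultimately show "keys a \<subseteq> {1..m} \<and> a = face_monomial (keys a) \<and>
        J \<inter> keys a = {}" using keys by blast
  qed
qed

end

section \<open>Reduced cochains of full subcomplexes\<close>

lemma face_monomial_remove:
  assumes "finite L" "k \<in> L" shows "face_monomial L - expo k = face_monomial (L - {k})"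
  using assms by (intro poly_mapping_eqI) (auto simp: lookup_minus lookup_face_monomial lookup_single when_def)

text \<open>
  The sign comparison behind the chain map property, with \<open>M = L \<union> {k}\<close> for the simplex \<open>L\<close> that is
  enlarged.
\<close>

lemma sign_coboundary:
  assumes "finite I" "M \<subseteq> I" "k \<in> M"
  shows "shuffle_sign {k} (I - M) * shuffle_sign (M - {k}) I = shuffle_sign {k} M * shuffle_sign M I"
proof -
  have fin: "finite M" "finite (I - M)" using assms finite_subset by auto
  have "shuffle_sign M I = shuffle_sign {k} I * shuffle_sign (M - {k}) I"
    using shuffle_sign_insert_left[of "M - {k}" I k] fin assms by (simp add: insert_absorb)
  moreover have "shuffle_sign {k} I = shuffle_sign {k} M * shuffle_sign {k} (I - M)"
    using shuffle_sign_Un_right[of "{k}" M "I - M"] fin assms by (simp add: Un_absorb1)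
  ultimately show ?thesis by simp
qed

text \<open>
  The sign comparison for \<open>d'\<close>: removing \<open>i\<close> from the index set of \<open>eps_set\<close> changes that sign by one
  factor for each element of \<open>L\<close> above \<open>i\<close>, while moving \<open>i\<close> to the front of \<open>J\<close> instead of \<open>J \<union> L\<close>
  saves one factor for each element of \<open>L\<close> below \<open>i\<close>.  Together these are \<open>card L\<close> factors.
\<close>

lemma sign_restriction:
  assumes "finite J" "finite L" "J \<inter> L = {}" "i \<notin> J" "i \<notin> L"
  shows "shuffle_sign {i} J * shuffle_sign L (insert i (J \<union> L))
    = (- 1) ^ card L * shuffle_sign {i} (insert i (J \<union> L)) * shuffle_sign L (J \<union> L)"
proof -
  have "shuffle_sign L (insert i (J \<union> L)) = shuffle_sign L {i} * shuffle_sign L (J \<union> L)"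
    using assms shuffle_sign_insert_right[of L "J \<union> L" i] by simp
  moreover have "shuffle_sign L {i} = (- 1) ^ card L * shuffle_sign {i} L"
    using shuffle_sign_swap[of L "{i}"] assms by simp
  moreover have "shuffle_sign {i} (insert i (J \<union> L)) = shuffle_sign {i} J * shuffle_sign {i} L"
    using assms shuffle_sign_insert_right[of "{i}" "J \<union> L" i] shuffle_sign_Un_right[of "{i}" J L] by simp
  ultimately show ?thesis by simp
qed

lemma cochain_carrier_iff:
  "c \<in> carrier (cochain_group X p) \<longleftrightarrow> (\<forall>L. c L \<noteq> 0 \<longrightarrow> L \<in> X \<and> int (card L) = p + 1)"
  by (simp add: cochain_group_def)

definition cochain_cocycle :: "nat set set \<Rightarrow> int \<Rightarrow> (nat set \<Rightarrow> int) \<Rightarrow> bool" where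
  "cochain_cocycle X p c \<longleftrightarrow> c \<in> carrier (cochain_group X p) \<and> coboundary X c = (\<lambda>L. 0)"

lemma reduced_class_eq: "reduced_class X p c = (\<lambda>b L. b L + c L) ` coboundaries X p"
  by (auto simp: reduced_class_def r_coset_def cochain_group_def)

lemma reduced_cohomology_carrier:
  "carrier (reduced_cohomology X p) = reduced_class X p ` {c. cochain_cocycle X p c}"
  by (auto simp: reduced_cohomology_def FactGroup_def RCOSETS_def r_coset_def
      cochain_group_def cochain_cocycle_def reduced_class_def)

lemma coboundary_add:
  "coboundary X (\<lambda>L. b L + c L) = (\<lambda>L. coboundary X b L + coboundary X c L)"
  by (auto simp: coboundary_def sum.distrib algebra_simps)

lemma coboundary_uminus: "coboundary X (\<lambda>L. - b L) = (\<lambda>L. - coboundary X b L)"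
  by (auto simp: coboundary_def sum_negf)

lemma cochain_add:
  assumes "b \<in> carrier (cochain_group X p)" "c \<in> carrier (cochain_group X p)"
  shows "(\<lambda>L. b L + c L) \<in> carrier (cochain_group X p)"
  unfolding cochain_carrier_iff
proof (intro allI impI)
  fix L assume "b L + c L \<noteq> 0"
  then have "b L \<noteq> 0 \<or> c L \<noteq> 0" by auto
  then show "L \<in> X \<and> int (card L) = p + 1" using assms unfolding cochain_carrier_iff by blast
qed

lemma coboundaries_closed:
  "(\<lambda>L. 0) \<in> coboundaries X p"
  "b \<in> coboundaries X p \<Longrightarrow> b' \<in> coboundaries X p \<Longrightarrow> (\<lambda>L. b L + b' L) \<in> coboundaries X p"
  "b \<in> coboundaries X p \<Longrightarrow> (\<lambda>L. - b L) \<in> coboundaries X p"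
proof -
  show "(\<lambda>L. 0) \<in> coboundaries X p" unfolding coboundaries_def
    by (rule image_eqI[of _ _ "\<lambda>L. 0"]) (auto simp: coboundary_def cochain_carrier_iff)
  show "(\<lambda>L. b L + b' L) \<in> coboundaries X p" if "b \<in> coboundaries X p" "b' \<in> coboundaries X p"
    using that unfolding coboundaries_def
    by (auto simp: coboundary_add[symmetric] cochain_add intro!: imageI)
  show "(\<lambda>L. - b L) \<in> coboundaries X p" if "b \<in> coboundaries X p"
    using that unfolding coboundaries_def
    by (auto simp: coboundary_uminus[symmetric] cochain_carrier_iff intro!: imageI)
qed

lemma reduced_class_shift:
  assumes "b \<in> coboundaries X p"
  shows "reduced_class X p (\<lambda>L. b L + c L) = reduced_class X p c"
  unfolding reduced_class_eq
proof (intro equalityI subsetI)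
  fix x assume "x \<in> (\<lambda>b' L. b' L + (b L + c L)) ` coboundaries X p"
  then obtain b' where "b' \<in> coboundaries X p" "x = (\<lambda>L. b' L + (b L + c L))" by blast
  then show "x \<in> (\<lambda>b L. b L + c L) ` coboundaries X p"
    using coboundaries_closed(2)[OF _ assms, of b']
    by (intro image_eqI[of _ _ "\<lambda>L. b' L + b L"]) auto
next
  fix x assume "x \<in> (\<lambda>b L. b L + c L) ` coboundaries X p"
  then obtain b' where "b' \<in> coboundaries X p" "x = (\<lambda>L. b' L + c L)" by blast
  then show "x \<in> (\<lambda>b' L. b' L + (b L + c L)) ` coboundaries X p"
    using coboundaries_closed(2)[OF _ coboundaries_closed(3)[OF assms], of b']
    by (intro image_eqI[of _ _ "\<lambda>L. b' L + - b L"]) auto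
qed

lemma induced_eq:
  assumes "A \<noteq> {}" "\<And>c. c \<in> A \<Longrightarrow> f c = v" shows "induced f A = v"
proof -
  have "f ` A = {v}" using assms by auto
  then show ?thesis by (simp add: induced_def)
qed

text \<open>
  The form in which well-definedness of an induced map is used: the value must not change when a
  coboundary is added.
\<close>

lemma induced_reduced_class:
  assumes "\<And>b. b \<in> coboundaries X p \<Longrightarrow> f (\<lambda>L. b L + c L) = v"
  shows "induced f (reduced_class X p c) = v"
proof (rule induced_eq)
  show "reduced_class X p c \<noteq> {}" using coboundaries_closed(1)[of X p] by (auto simp: reduced_class_eq)
qed (use assms in \<open>auto simp: reduced_class_eq\<close>)

lemma restrict_cochain_coboundary:
  assumes "Y \<subseteq> X" "\<And>M i. M \<in> Y \<Longrightarrow> M - {i} \<in> Y"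
  shows "coboundary Y (restrict_cochain Y c) = restrict_cochain Y (coboundary X c)"
  using assms by (auto simp: fun_eq_iff coboundary_def restrict_cochain_def intro!: sum.cong)

lemma restrict_cochain_closed:
  "c \<in> carrier (cochain_group X p) \<Longrightarrow> restrict_cochain Y c \<in> carrier (cochain_group Y p)"
  by (auto simp: cochain_carrier_iff restrict_cochain_def)

lemma psi_reduced_class:
  assumes K: "\<And>M k. M \<in> K \<Longrightarrow> M - {k} \<in> K"
  shows "psi K p i I (reduced_class (full_subcomplex K I) p c)
    = reduced_class (full_subcomplex K (I - {i})) p (restrict_cochain (full_subcomplex K (I - {i})) c)"
  unfolding psi_def
proof (rule induced_reduced_class)
  let ?X = "full_subcomplex K I" let ?Y = "full_subcomplex K (I - {i})"
  fix b assume "b \<in> coboundaries ?X p"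
  then obtain b' where b': "b' \<in> carrier (cochain_group ?X (p - 1))" "b = coboundary ?X b'"
    by (auto simp: coboundaries_def)
  have "restrict_cochain ?Y b = coboundary ?Y (restrict_cochain ?Y b')"
    unfolding b'(2) using K
    by (intro restrict_cochain_coboundary[symmetric]) (auto simp: full_subcomplex_def)
  then have b: "restrict_cochain ?Y b \<in> coboundaries ?Y p"
    using restrict_cochain_closed[OF b'(1)] by (auto simp: coboundaries_def)
  have "restrict_cochain ?Y (\<lambda>L. b L + c L) = (\<lambda>L. restrict_cochain ?Y b L + restrict_cochain ?Y c L)"
    by (auto simp: restrict_cochain_def)
  then show "reduced_class ?Y p (restrict_cochain ?Y (\<lambda>L. b L + c L))
      = reduced_class ?Y p (restrict_cochain ?Y c)"
    using reduced_class_shift[OF b] by simp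
qed

section \<open>Hochster cochains in the Koszul algebra\<close>

context complex_on begin

text \<open>
  A form with polynomial coefficients that represents \<open>hochster_cochain\<close>.  The coefficient of \<open>u\<^sub>J\<close> is
  concentrated on the simplex \<open>I - J\<close>.
\<close>

definition hochster_poly :: "nat set \<Rightarrow> (nat set \<Rightarrow> int) \<Rightarrow> mpoly ext" where
  "hochster_poly I c J = (if J \<subseteq> I \<and> I - J \<in> K
     then single (face_monomial (I - J)) (c (I - J) * shuffle_sign (I - J) I) else 0)"

lemma lookup_hochster_poly:
  "lookup (hochster_poly I c J) a = (if J \<subseteq> I \<and> I - J \<in> K \<and> a = face_monomial (I - J)
    then c (I - J) * shuffle_sign (I - J) I else 0)"
  by (auto simp: hochster_poly_def lookup_single when_def)

lemma hochster_poly_closed: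
  assumes "I \<subseteq> {1..m}" shows "hochster_poly I c \<in> ext_poly_carrier m"
proof (rule ext_polyI)
  fix J
  show "hochster_poly I c J \<in> carrier (poly_ring m)"
    using assms face_finite
    by (auto simp: hochster_poly_def poly_carrier_iff keys_face_monomial)
  show "hochster_poly I c J = 0" if "\<not> J \<subseteq> {1..m}"
    using that assms by (auto simp: hochster_poly_def)
qed

lemma finite_faces: "finite K"
  using complex finite_subset[of K "Pow {1..m}"] by (auto simp: simplicial_complex_def)

lemma hochster_cochain_eq:
  assumes I: "I \<subseteq> {1..m}" shows "hochster_cochain m K I c = koszul_of (hochster_poly I c)"
proof -
  let ?X = "full_subcomplex K I"
  let ?e = "\<lambda>L A. if A = I - L then single (face_monomial L) 1 else (0 :: mpoly)"
  let ?k = "\<lambda>L. c L * eps_set L I"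
  have finI: "finite I" using I finite_subset by blast
  have L: "L \<subseteq> I" "L \<in> K" "finite L" if "L \<in> ?X" for L
    using that face_finite by (auto simp: full_subcomplex_def)
  have e: "?e L \<in> ext_poly_carrier m" if "L \<in> ?X" for L
    by (rule ext_polyI) (use L[OF that] I in \<open>auto simp: poly_carrier_iff keys_face_monomial\<close>)
  have ke: "(\<lambda>A. of_int (?k L) * ?e L A) \<in> ext_poly_carrier m" if "L \<in> ?X" for L
    by (rule ext_polyI)
      (use ext_poly_coeff[OF e[OF that]] ext_poly_outside[OF e[OF that]] in \<open>auto simp: poly_carrier_of_int_mult simp del: of_int_mult\<close>)
  have elem: "koszul_elem m K (I - L) L = koszul_of (?e L)" if "L \<in> ?X" for L
    using L[OF that] by (auto simp: koszul_elem_def koszul_of_def prod_mvar face_class_zero fun_eq_iff restrict_def)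
  have "hochster_cochain m K I c = (\<Oplus>\<^bsub>koszul m K\<^esub>L\<in>?X. koszul_of (\<lambda>A. of_int (?k L) * ?e L A))"
    unfolding hochster_cochain_def
  proof (rule kd.add.finprod_cong', rule refl, rule funcsetI)
    fix L assume L: "L \<in> ?X"
    show "koszul_of (\<lambda>A. of_int (?k L) * ?e L A) \<in> carrier (koszul m K)" by (rule koszul_of_closed[OF ke[OF L]])
    show "[?k L] \<cdot>\<^bsub>koszul m K\<^esub> koszul_elem m K (I - L) L = koszul_of (\<lambda>A. of_int (?k L) * ?e L A)"
      unfolding elem[OF L] by (rule koszul_of_int_mult[OF e[OF L]])
  qed
  also have "\<dots> = koszul_of (\<lambda>A. \<Sum>L\<in>?X. of_int (?k L) * ?e L A)" by (rule koszul_of_finsum) (rule ke)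
  also have "(\<lambda>A. \<Sum>L\<in>?X. of_int (?k L) * ?e L A) = hochster_poly I c"
  proof (rule HOL.ext, rule poly_mapping_eqI)
    fix A a
    have finX: "finite ?X" using finite_faces by (simp add: full_subcomplex_def)
    have "lookup (\<Sum>L\<in>?X. of_int (?k L) * ?e L A) a
        = (\<Sum>L\<in>?X. if L = I - A \<and> A \<subseteq> I \<and> a = face_monomial L then ?k L else 0)"
      unfolding lookup_sum
    proof (rule sum.cong[OF refl])
      fix L assume "L \<in> ?X"
      then have "A = I - L \<longleftrightarrow> L = I - A \<and> A \<subseteq> I" using L(1) by blast
      then show "lookup (of_int (?k L) * ?e L A) a
          = (if L = I - A \<and> A \<subseteq> I \<and> a = face_monomial L then ?k L else 0)"
        by (auto simp: lookup_single when_def simp del: of_int_mult)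
    qed
    also have "\<dots> = (\<Sum>L\<in>?X. if L = I - A then (if A \<subseteq> I \<and> a = face_monomial L then ?k L else 0) else 0)"
      by (intro sum.cong) auto
    also have "\<dots> = (if I - A \<in> ?X then (if A \<subseteq> I \<and> a = face_monomial (I - A) then ?k (I - A) else 0) else 0)"
      using finX by simp
    also have "\<dots> = lookup (hochster_poly I c A) a"
      using finI by (auto simp: lookup_hochster_poly full_subcomplex_def eps_set_eq_shuffle_sign)
    finally show "lookup (\<Sum>L\<in>?X. of_int (?k L) * ?e L A) a
        = lookup (hochster_poly I c A) a" .
  qed
  finally show ?thesis .
qed

lemma hochster_poly_add:
  "hochster_poly I (\<lambda>L. b L + c L) = (\<lambda>J. hochster_poly I b J + hochster_poly I c J)"
  by (auto simp: hochster_poly_def single_add distrib_right)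

lemma hochster_chain_map:
  assumes I: "I \<subseteq> {1..m}"
  shows "koszul_diff m K (koszul_of (hochster_poly I c))
    = koszul_of (hochster_poly I (coboundary (full_subcomplex K I) c))"
proof -
  let ?l = lookup
  note h = hochster_poly_closed[OF I]
  have finI: "finite I" using I finite_subset by blast
  have Dh: "ext_deriv m mvar (hochster_poly I c) \<in> ext_poly_carrier m"
    using mvar_carrier h by (rule ext_deriv_closed)
  have "koszul_of (ext_deriv m mvar (hochster_poly I c))
    = koszul_of (hochster_poly I (coboundary (full_subcomplex K I) c))"
  proof (subst koszul_of_eq_iff[OF Dh h], intro allI impI)
    fix J and a :: "nat \<Rightarrow>\<^sub>0 nat"
    assume J: "J \<subseteq> {1..m}" and aK: "keys a \<in> K"
    let ?t = "\<lambda>k. if k \<in> keys a \<and> k \<notin> J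
        then shuffle_sign {k} J * ?l (hochster_poly I c (insert k J)) (a - expo k) else 0"
    have D: "?l (ext_deriv m mvar (hochster_poly I c) J) a = (\<Sum>k\<in>{1..m}. ?t k)"
      by (rule lookup_koszul_deriv)
    show "?l (ext_deriv m mvar (hochster_poly I c) J) a
      = ?l (hochster_poly I (coboundary (full_subcomplex K I) c) J) a"
    proof (cases "J \<subseteq> I \<and> a = face_monomial (I - J)")
      case True
      let ?M = "I - J"
      have M: "finite ?M" "keys a = ?M" "?M \<in> K" "I - ?M = J"
        using True finI aK by (auto simp: keys_face_monomial)
      have "(\<Sum>k\<in>{1..m}. ?t k) = (\<Sum>k\<in>?M. eps k ?M * c (?M - {k}) * shuffle_sign ?M I)"
      proof (rule sum.mono_neutral_cong_right)
        fix k assume k: "k \<in> ?M"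
        have e: "I - insert k J = ?M - {k}" by auto
        have "?M - {k} \<in> K" by (rule face_down[OF M(3)]) blast
        then have "?t k = shuffle_sign {k} J * (c (?M - {k}) * shuffle_sign (?M - {k}) I)"
          using k True M face_monomial_remove[OF M(1) k] by (simp add: lookup_hochster_poly e)
        also have "\<dots> = eps k ?M * c (?M - {k}) * shuffle_sign ?M I"
          using arg_cong[OF sign_coboundary[OF finI _ k], of "\<lambda>x. c (?M - {k}) * x"] M(4)
          by (simp add: eps_eq_shuffle_sign algebra_simps)
        finally show "?t k = eps k ?M * c (?M - {k}) * shuffle_sign ?M I" .
      qed (use I M in auto)
      then show ?thesis
        unfolding D using True M
        by (simp add: lookup_hochster_poly coboundary_def full_subcomplex_def sum_distrib_right)
    next
      case False
      have "?t k = 0" for k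
      proof (rule ccontr)
        assume "?t k \<noteq> 0"
        then have k: "k \<in> keys a" "k \<notin> J" "insert k J \<subseteq> I" "a - expo k = face_monomial (I - insert k J)"
          by (auto simp: lookup_hochster_poly split: if_splits)
        have "a = (a - expo k) + expo k"
          using k(1) by (intro poly_mapping_eqI)
            (auto simp: lookup_add lookup_minus lookup_single when_def in_keys_iff)
        also have "\<dots> = face_monomial (I - J)"
          unfolding k(4) using k(2,3) finI
          by (intro poly_mapping_eqI) (auto simp: lookup_add lookup_face_monomial lookup_single when_def)
        finally show False using False k(3) by blast
      qed
      then show ?thesis unfolding D using False by (auto simp: lookup_hochster_poly)
    qed
  qed
  then show ?thesis using koszul_diff_koszul_of[OF h] by simp
qed

lemma hochster_cocycle:
  assumes "I \<subseteq> {1..m}" "cochain_cocycle (full_subcomplex K I) p c"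
  shows "koszul_of (hochster_poly I c) \<in> kd.cocycles"
proof -
  have "hochster_poly I (\<lambda>L. 0) = (\<lambda>J. 0)" by (auto simp: hochster_poly_def)
  then show ?thesis
    using assms hochster_chain_map[of I c] koszul_of_closed[OF hochster_poly_closed, of I c]
    by (simp add: kd.cocycles_def cochain_cocycle_def koszul_of_zero)
qed

lemma hochster_summand_class:
  assumes I: "I \<subseteq> {1..m}" and c: "cochain_cocycle (full_subcomplex K I) p c"
  shows "hochster_summand m K I (reduced_class (full_subcomplex K I) p c)
    = kd.cls (koszul_of (hochster_poly I c))"
  unfolding hochster_summand_def
proof (rule induced_reduced_class)
  interpret H: ring kd.H by (rule kd.cohomology_is_ring)
  fix b assume "b \<in> coboundaries (full_subcomplex K I) p"
  then obtain b' where b: "b = coboundary (full_subcomplex K I) b'" by (auto simp: coboundaries_def)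
  let ?B = "koszul_of (hochster_poly I b')"
  have B: "?B \<in> carrier (koszul m K)" by (rule koszul_of_closed[OF hochster_poly_closed[OF I]])
  have "hochster_cochain m K I (\<lambda>L. b L + c L)
      = koszul_diff m K ?B \<oplus>\<^bsub>koszul m K\<^esub> koszul_of (hochster_poly I c)"
    by (simp add: hochster_cochain_eq[OF I] hochster_poly_add koszul_of_add hochster_poly_closed[OF I]
        hochster_chain_map[OF I] b)
  then show "kd.cls (hochster_cochain m K I (\<lambda>L. b L + c L)) = kd.cls (koszul_of (hochster_poly I c))"
    using kd.class_add[OF kd.boundary_cocycle[OF B] hochster_cocycle[OF I c]]
      kd.class_closed[OF hochster_cocycle[OF I c]] kd.class_boundary[OF B] by simp
qed

end

section \<open>The differential on cohomology\<close>

context complex_on begin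

text \<open>
  The derivation \<open>d'\<close> of the Koszul algebra with \<open>u\<^sub>i \<mapsto> 1\<close>.
\<close>

definition koszul_dprime :: "(nat set \<Rightarrow> mpoly set) \<Rightarrow> nat set \<Rightarrow> mpoly set" where
  "koszul_dprime = exterior_derivation m (face_ring m K) (\<lambda>i. fc 1)"

lemma koszul_dprime_koszul_of:
  "F \<in> ext_poly_carrier m \<Longrightarrow> koszul_dprime (koszul_of F) = koszul_of (ext_deriv m (\<lambda>i. 1) F)"
  unfolding koszul_dprime_def by (rule koszul_of_ext_deriv) (rule poly_carrier_zero_one)

lemma koszul_dprime_graded:
  "graded_diff_ring (koszul m K) (koszul_deg m K) koszul_dprime (- 1)"
  unfolding koszul_dprime_def
proof (rule koszul_derivation)
  fix i a assume "a \<in> keys (1 :: mpoly)"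
  then show "2 * int (monomial_degree a) = - 1 + 1" by (simp add: monomial_degree_def)
qed (simp_all add: poly_carrier_zero_one)

sublocale kp: graded_diff_ring "koszul m K" "koszul_deg m K" koszul_dprime "- 1"
  by (rule koszul_dprime_graded)

lemma koszul_diffs_anticommute:
  assumes "x \<in> carrier (koszul m K)"
  shows "koszul_diff m K (koszul_dprime x) = \<ominus>\<^bsub>koszul m K\<^esub> koszul_dprime (koszul_diff m K x)"
proof -
  obtain F where F: "F \<in> ext_poly_carrier m" "x = koszul_of F" using koszul_of_surj[OF assms] by blast
  let ?d = "ext_deriv m mvar" and ?p = "ext_deriv m (\<lambda>i. 1)"
  have d: "?d G \<in> ext_poly_carrier m" if "G \<in> ext_poly_carrier m" for G
    using mvar_carrier that by (rule ext_deriv_closed)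
  have p: "?p G \<in> ext_poly_carrier m" if "G \<in> ext_poly_carrier m" for G
    using poly_carrier_zero_one(2) that by (rule ext_deriv_closed)
  have "?d (?p F) = (\<lambda>J. - ?p (?d F) J)"
  proof
    fix J
    show "?d (?p F) J = - ?p (?d F) J"
    proof (cases "finite J")
      case True
      then show ?thesis by (rule ext_deriv_anticommute)
    next
      case False
      then show ?thesis
        using ext_poly_finite[OF d[OF p[OF F(1)]] False] ext_poly_finite[OF p[OF d[OF F(1)]] False] by simp
    qed
  qed
  then show ?thesis
    by (simp add: F koszul_diff_koszul_of koszul_dprime_koszul_of d p koszul_of_minus)
qed

text \<open>
  This is the formula that defines \<open>d_prime\<close>, at the level of cochains.
\<close>

lemma hochster_dprime:
  assumes I: "I \<subseteq> {1..m}" and c: "c \<in> carrier (cochain_group (full_subcomplex K I) p)"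
  shows "koszul_dprime (koszul_of (hochster_poly I c)) = (\<Oplus>\<^bsub>koszul m K\<^esub>i\<in>I.
    [((- 1) ^ nat (p + 1) * eps i I)] \<cdot>\<^bsub>koszul m K\<^esub>
      koszul_of (hochster_poly (I - {i}) (restrict_cochain (full_subcomplex K (I - {i})) c)))"
proof -
  let ?r = "\<lambda>i. restrict_cochain (full_subcomplex K (I - {i})) c"
  let ?k = "\<lambda>i. (- 1) ^ nat (p + 1) * eps i I"
  have finI: "finite I" using I finite_subset by blast
  have h: "hochster_poly (I - {i}) (?r i) \<in> ext_poly_carrier m" for i
    by (rule hochster_poly_closed) (use I in blast)
  have kh: "(\<lambda>J. of_int (?k i) * hochster_poly (I - {i}) (?r i) J) \<in> ext_poly_carrier m" for i
    by (rule ext_polyI)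
      (use ext_poly_coeff[OF h] ext_poly_outside[OF h] in
        \<open>auto simp: poly_carrier_of_int_mult simp del: of_int_mult\<close>)
  have "(\<Oplus>\<^bsub>koszul m K\<^esub>i\<in>I. [?k i] \<cdot>\<^bsub>koszul m K\<^esub> koszul_of (hochster_poly (I - {i}) (?r i)))
      = (\<Oplus>\<^bsub>koszul m K\<^esub>i\<in>I. koszul_of (\<lambda>J. of_int (?k i) * hochster_poly (I - {i}) (?r i) J))"
    by (simp only: koszul_of_int_mult[OF h])
  also have "\<dots> = koszul_of (\<lambda>J. \<Sum>i\<in>I. of_int (?k i) * hochster_poly (I - {i}) (?r i) J)"
    by (rule koszul_of_finsum) (rule kh)
  also have "(\<lambda>J. \<Sum>i\<in>I. of_int (?k i) * hochster_poly (I - {i}) (?r i) J)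
      = ext_deriv m (\<lambda>i. 1) (hochster_poly I c)"
  proof
    fix J
    have "ext_deriv m (\<lambda>i. 1) (hochster_poly I c) J
        = (\<Sum>i\<in>I. ext_partial i (hochster_poly I c) J)"
      unfolding ext_deriv_def using I
      by (intro sum.mono_neutral_cong_right) (auto simp: ext_partial_def hochster_poly_def)
    also have "\<dots> = (\<Sum>i\<in>I. of_int (?k i) * hochster_poly (I - {i}) (?r i) J)"
    proof (rule sum.cong[OF refl])
      fix i assume i: "i \<in> I"
      show "ext_partial i (hochster_poly I c) J = of_int (?k i) * hochster_poly (I - {i}) (?r i) J"
      proof (cases "i \<notin> J \<and> J \<subseteq> I \<and> I - insert i J \<in> K")
        case True
        define L where "L = I - insert i J"
        have L: "finite J" "finite L" "J \<inter> L = {}" "i \<notin> J" "i \<notin> L" "I = insert i (J \<union> L)"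
          "I - {i} = J \<union> L" "I - {i} - J = L" "L \<in> K"
          using True i finI finite_subset by (auto simp: L_def)
        have s: "shuffle_sign {i} J * (c L * shuffle_sign L I) = ?k i * (c L * shuffle_sign L (J \<union> L))"
        proof (cases "c L = 0")
          case False
          then have "nat (p + 1) = card L" using c by (auto simp: cochain_carrier_iff)
          then show ?thesis
            using arg_cong[OF sign_restriction[OF L(1-5)], of "\<lambda>x. c L * x"] L(6)
            by (simp add: eps_eq_shuffle_sign algebra_simps)
        qed simp
        have r: "?r i L = c L" using L(7,9) by (auto simp: restrict_cochain_def full_subcomplex_def)
        have 1: "ext_partial i (hochster_poly I c) J
          = of_int (shuffle_sign {i} J) * single (face_monomial L) (c L * shuffle_sign L I)"
          using True i by (simp add: ext_partial_def hochster_poly_def L_def)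
        have 2: "hochster_poly (I - {i}) (?r i) J
          = single (face_monomial L) (c L * shuffle_sign L (J \<union> L))"
          unfolding hochster_poly_def L(8) L(7)[symmetric] r using True L(9) by auto
        show ?thesis
          unfolding 1 2
        proof (rule poly_mapping_eqI)
          fix a
          show "lookup (of_int (shuffle_sign {i} J) * single (face_monomial L) (c L * shuffle_sign L I)) a
            = lookup (of_int (?k i) * single (face_monomial L) (c L * shuffle_sign L (J \<union> L))) a"
            unfolding lookup_of_int_times lookup_single when_def using s by simp
        qed
      next
        case False
        have "I - {i} - J = I - insert i J" by auto
        then show ?thesis using False i by (auto simp: ext_partial_def hochster_poly_def)
      qed
    qed
    finally show "(\<Sum>i\<in>I. of_int (?k i) * hochster_poly (I - {i}) (?r i) J)
        = ext_deriv m (\<lambda>i. 1) (hochster_poly I c) J" ..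
  qed
  finally show ?thesis using koszul_dprime_koszul_of[OF hochster_poly_closed[OF I]] by simp
qed

lemma restrict_cocycle:
  assumes "cochain_cocycle (full_subcomplex K I) p c"
  shows "cochain_cocycle (full_subcomplex K (I - {i})) p (restrict_cochain (full_subcomplex K (I - {i})) c)"
proof -
  have "coboundary (full_subcomplex K (I - {i})) (restrict_cochain (full_subcomplex K (I - {i})) c)
      = restrict_cochain (full_subcomplex K (I - {i})) (coboundary (full_subcomplex K I) c)"
  proof (rule restrict_cochain_coboundary)
    show "M - {k} \<in> full_subcomplex K (I - {i})" if "M \<in> full_subcomplex K (I - {i})" for M k
      using that face_down[of M "M - {k}"] by (auto simp: full_subcomplex_def)
  qed (auto simp: full_subcomplex_def)
  then show ?thesis
    using assms restrict_cochain_closed by (auto simp: cochain_cocycle_def restrict_cochain_def)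
qed

text \<open>
  A choice of cocycles in the reduced classes of a family \<open>y\<close>.  It converts statements about
  families of cosets into statements about cochains.
\<close>

definition representatives ::
    "(nat set \<times> int \<Rightarrow> (nat set \<Rightarrow> int) set) \<Rightarrow> (nat set \<times> int \<Rightarrow> nat set \<Rightarrow> int) \<Rightarrow> bool" where
  "representatives y c \<longleftrightarrow> (\<forall>I\<in>Pow {1..m}. \<forall>p\<in>{-1..<int m}.
     cochain_cocycle (full_subcomplex K I) p (c (I, p)) \<and>
     y (I, p) = reduced_class (full_subcomplex K I) p (c (I, p)))"

lemma representatives_exist:
  assumes "y \<in> hochster_sum m K" obtains c where "representatives y c"
proof -
  have "\<exists>c. cochain_cocycle (full_subcomplex K I) p c \<and> y (I, p) = reduced_class (full_subcomplex K I) p c"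
    if "I \<in> Pow {1..m}" "p \<in> {-1..<int m}" for I p
  proof -
    have "y (I, p) \<in> carrier (reduced_cohomology (full_subcomplex K I) p)"
      using PiE_mem[OF assms[unfolded hochster_sum_def], of "(I, p)"] that by simp
    then show ?thesis by (auto simp: reduced_cohomology_carrier)
  qed
  then have "\<forall>q\<in>Pow {1..m} \<times> {-1..<int m}. \<exists>c. cochain_cocycle (full_subcomplex K (fst q)) (snd q) c \<and>
      y q = reduced_class (full_subcomplex K (fst q)) (snd q) c" by auto
  from bchoice[OF this] obtain c where "\<forall>q\<in>Pow {1..m} \<times> {-1..<int m}.
      cochain_cocycle (full_subcomplex K (fst q)) (snd q) (c q) \<and>
      y q = reduced_class (full_subcomplex K (fst q)) (snd q) (c q)" ..
  then have "representatives y c" by (simp add: representatives_def)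
  then show thesis by (rule that)
qed

definition hochster_total :: "(nat set \<times> int \<Rightarrow> nat set \<Rightarrow> int) \<Rightarrow> nat set \<Rightarrow> mpoly set" where
  "hochster_total c = (\<Oplus>\<^bsub>koszul m K\<^esub>I\<in>Pow {1..m}. \<Oplus>\<^bsub>koszul m K\<^esub>p\<in>{-1..<int m}.
     koszul_of (hochster_poly I (c (I, p))))"

lemma finsum_cong_class:
  assumes "\<And>i. i \<in> A \<Longrightarrow> f i = g i" "\<And>i. i \<in> A \<Longrightarrow> g i \<in> carrier kd.H"
  shows "finsum kd.H f A = finsum kd.H g A"
proof -
  interpret H: ring kd.H by (rule kd.cohomology_is_ring)
  show ?thesis by (rule H.add.finprod_cong') (use assms in auto)
qed

lemma representative_summand:
  assumes "representatives y c" "I \<in> Pow {1..m}" "p \<in> {-1..<int m}"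
  shows "cochain_cocycle (full_subcomplex K I) p (c (I, p))"
    and "y (I, p) = reduced_class (full_subcomplex K I) p (c (I, p))"
    and "koszul_of (hochster_poly I (c (I, p))) \<in> kd.cocycles"
proof -
  show 1: "cochain_cocycle (full_subcomplex K I) p (c (I, p))"
    and "y (I, p) = reduced_class (full_subcomplex K I) p (c (I, p))"
    using assms unfolding representatives_def by blast+
  show "koszul_of (hochster_poly I (c (I, p))) \<in> kd.cocycles"
    by (rule hochster_cocycle[OF _ 1]) (use assms(2) in simp)
qed

lemma hochster_total_cocycle:
  assumes "representatives y c" shows "hochster_total c \<in> kd.cocycles"
  unfolding hochster_total_def
  by (rule kd.cocycle_finsum)+ (rule representative_summand(3)[OF assms])

lemma hochster_iso_class:
  assumes "representatives y c" shows "hochster_iso m K y = kd.cls (hochster_total c)"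
proof -
  interpret H: ring kd.H by (rule kd.cohomology_is_ring)
  note Z = representative_summand(3)[OF assms]
  have cl: "kd.cls (koszul_of (hochster_poly I (c (I, p)))) \<in> carrier kd.H"
    if "I \<in> Pow {1..m}" "p \<in> {-1..<int m}" for I p
    by (rule kd.class_closed[OF Z[OF that]])
  have "kd.cls (hochster_total c) = (\<Oplus>\<^bsub>kd.H\<^esub>I\<in>Pow {1..m}.
      kd.cls (\<Oplus>\<^bsub>koszul m K\<^esub>p\<in>{-1..<int m}. koszul_of (hochster_poly I (c (I, p)))))"
    unfolding hochster_total_def by (rule kd.class_finsum) (rule kd.cocycle_finsum, rule Z)
  also have "\<dots> = hochster_iso m K y"
    unfolding hochster_iso_def H_ZK_def
  proof (rule finsum_cong_class)
    fix I assume I: "I \<in> Pow {1..m}"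
    have s: "hochster_summand m K I (y (I, p)) = kd.cls (koszul_of (hochster_poly I (c (I, p))))"
      if "p \<in> {-1..<int m}" for p
      unfolding representative_summand(2)[OF assms I that]
      by (rule hochster_summand_class[OF _ representative_summand(1)[OF assms I that]]) (use I in simp)
    have "kd.cls (\<Oplus>\<^bsub>koszul m K\<^esub>p\<in>{-1..<int m}. koszul_of (hochster_poly I (c (I, p))))
        = (\<Oplus>\<^bsub>kd.H\<^esub>p\<in>{-1..<int m}. kd.cls (koszul_of (hochster_poly I (c (I, p)))))"
      by (rule kd.class_finsum) (rule Z[OF I])
    also have "\<dots> = (\<Oplus>\<^bsub>kd.H\<^esub>p\<in>{-1..<int m}. hochster_summand m K I (y (I, p)))"
      by (rule finsum_cong_class) (simp_all only: s cl[OF I])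
    finally show "kd.cls (\<Oplus>\<^bsub>koszul m K\<^esub>p\<in>{-1..<int m}. koszul_of (hochster_poly I (c (I, p))))
        = (\<Oplus>\<^bsub>kd.H\<^esub>p\<in>{-1..<int m}. hochster_summand m K I (y (I, p)))" .
    show "(\<Oplus>\<^bsub>kd.H\<^esub>p\<in>{-1..<int m}. hochster_summand m K I (y (I, p))) \<in> carrier kd.H"
      by (rule H.finsum_closed, rule funcsetI) (simp only: s cl[OF I])
  qed
  finally show ?thesis ..
qed

lemma hochster_formula_class:
  assumes "representatives y c"
  shows "(\<Oplus>\<^bsub>H_ZK m K\<^esub>I\<in>Pow {1..m}. \<Oplus>\<^bsub>H_ZK m K\<^esub>p\<in>{-1..<int m}. \<Oplus>\<^bsub>H_ZK m K\<^esub>i\<in>I.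
       [((- 1) ^ nat (p + 1) * eps i I)] \<cdot>\<^bsub>H_ZK m K\<^esub>
         (hochster_summand m K (I - {i}) (psi K p i I (y (I, p)))))
    = kd.cls (koszul_dprime (hochster_total c))"
proof -
  interpret H: ring kd.H by (rule kd.cohomology_is_ring)
  let ?I = "Pow {1..m}" and ?P = "{-1..<int m}"
  let ?k = "\<lambda>I p i. (- 1) ^ nat (p + 1) * eps i I"
  let ?r = "\<lambda>I p i. koszul_of (hochster_poly (I - {i}) (restrict_cochain (full_subcomplex K (I - {i})) (c (I, p))))"
  let ?s = "\<lambda>I p i. [?k I p i] \<cdot>\<^bsub>kd.H\<^esub> (hochster_summand m K (I - {i}) (psi K p i I (y (I, p))))"
  have hc: "koszul_of (hochster_poly I (c (I, p))) \<in> carrier (koszul m K)" if "I \<in> ?I" "p \<in> ?P" for I p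
    by (rule kd.cocycle_carrier[OF representative_summand(3)[OF assms that]])
  have r: "?r I p i \<in> kd.cocycles" "hochster_summand m K (I - {i}) (psi K p i I (y (I, p))) = kd.cls (?r I p i)"
    if I: "I \<in> ?I" "p \<in> ?P" for I p i
  proof -
    have sub: "I - {i} \<subseteq> {1..m}" using I(1) by blast
    note rc = restrict_cocycle[OF representative_summand(1)[OF assms I], of i]
    show "?r I p i \<in> kd.cocycles" by (rule hochster_cocycle[OF sub rc])
    have psi: "psi K p i I (reduced_class (full_subcomplex K I) p c')
        = reduced_class (full_subcomplex K (I - {i})) p (restrict_cochain (full_subcomplex K (I - {i})) c')" for c'
      by (rule psi_reduced_class, erule face_down, rule Diff_subset)
    show "hochster_summand m K (I - {i}) (psi K p i I (y (I, p))) = kd.cls (?r I p i)"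
      unfolding representative_summand(2)[OF assms I] psi
      by (rule hochster_summand_class[OF sub rc])
  qed
  have kr: "[?k I p i] \<cdot>\<^bsub>koszul m K\<^esub> ?r I p i \<in> kd.cocycles" if "I \<in> ?I" "p \<in> ?P" for I p i
  proof -
    have "subgroup kd.cocycles (add_monoid (koszul m K))"
      by (rule subring.axioms(1)[OF kd.cocycles_subring])
    then show ?thesis
      using kd.add.subgroup_int_pow_closed[of kd.cocycles "?r I p i" "?k I p i"] r(1)[OF that]
      by (simp add: add_pow_def)
  qed
  have step: "kd.cls (koszul_dprime (koszul_of (hochster_poly I (c (I, p))))) = (\<Oplus>\<^bsub>kd.H\<^esub>i\<in>I. ?s I p i)"
    and closed: "(\<Oplus>\<^bsub>kd.H\<^esub>i\<in>I. ?s I p i) \<in> carrier kd.H"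
    and cocycle: "koszul_dprime (koszul_of (hochster_poly I (c (I, p)))) \<in> kd.cocycles"
    if I: "I \<in> ?I" "p \<in> ?P" for I p
  proof -
    have "c (I, p) \<in> carrier (cochain_group (full_subcomplex K I) p)"
      using representative_summand(1)[OF assms I] by (simp add: cochain_cocycle_def)
    then have eq: "koszul_dprime (koszul_of (hochster_poly I (c (I, p))))
        = (\<Oplus>\<^bsub>koszul m K\<^esub>i\<in>I. [?k I p i] \<cdot>\<^bsub>koszul m K\<^esub> ?r I p i)"
      using I(1) by (intro hochster_dprime) auto
    show "koszul_dprime (koszul_of (hochster_poly I (c (I, p)))) \<in> kd.cocycles"
      unfolding eq by (rule kd.cocycle_finsum) (rule kr[OF I])
    have s: "?s I p i = kd.cls ([?k I p i] \<cdot>\<^bsub>koszul m K\<^esub> ?r I p i)" for i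
      unfolding r(2)[OF I] kd.class_int_mult[OF r(1)[OF I]] ..
    show "kd.cls (koszul_dprime (koszul_of (hochster_poly I (c (I, p))))) = (\<Oplus>\<^bsub>kd.H\<^esub>i\<in>I. ?s I p i)"
      unfolding eq s by (rule kd.class_finsum) (rule kr[OF I])
    show "(\<Oplus>\<^bsub>kd.H\<^esub>i\<in>I. ?s I p i) \<in> carrier kd.H"
      unfolding s by (rule H.finsum_closed, rule funcsetI) (rule kd.class_closed[OF kr[OF I]])
  qed
  have inner: "koszul_dprime (\<Oplus>\<^bsub>koszul m K\<^esub>p\<in>?P. koszul_of (hochster_poly I (c (I, p))))
      = (\<Oplus>\<^bsub>koszul m K\<^esub>p\<in>?P. koszul_dprime (koszul_of (hochster_poly I (c (I, p)))))" if "I \<in> ?I" for I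
    by (rule kp.diff_finsum) (rule hc[OF that])
  have innerZ: "koszul_dprime (\<Oplus>\<^bsub>koszul m K\<^esub>p\<in>?P. koszul_of (hochster_poly I (c (I, p)))) \<in> kd.cocycles"
    if "I \<in> ?I" for I
    unfolding inner[OF that] by (rule kd.cocycle_finsum) (rule cocycle[OF that])
  have "koszul_dprime (hochster_total c) = (\<Oplus>\<^bsub>koszul m K\<^esub>I\<in>?I.
      koszul_dprime (\<Oplus>\<^bsub>koszul m K\<^esub>p\<in>?P. koszul_of (hochster_poly I (c (I, p)))))"
    unfolding hochster_total_def
    by (rule kp.diff_finsum, rule kd.finsum_closed, rule funcsetI) (rule hc)
  then have "kd.cls (koszul_dprime (hochster_total c)) = (\<Oplus>\<^bsub>kd.H\<^esub>I\<in>?I.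
      kd.cls (koszul_dprime (\<Oplus>\<^bsub>koszul m K\<^esub>p\<in>?P. koszul_of (hochster_poly I (c (I, p))))))"
    using kd.class_finsum[of ?I, OF innerZ] by simp
  also have "\<dots> = (\<Oplus>\<^bsub>kd.H\<^esub>I\<in>?I. \<Oplus>\<^bsub>kd.H\<^esub>p\<in>?P. \<Oplus>\<^bsub>kd.H\<^esub>i\<in>I. ?s I p i)"
  proof (rule finsum_cong_class)
    fix I assume I: "I \<in> ?I"
    have "kd.cls (koszul_dprime (\<Oplus>\<^bsub>koszul m K\<^esub>p\<in>?P. koszul_of (hochster_poly I (c (I, p)))))
        = (\<Oplus>\<^bsub>kd.H\<^esub>p\<in>?P. kd.cls (koszul_dprime (koszul_of (hochster_poly I (c (I, p))))))"
      unfolding inner[OF I] by (rule kd.class_finsum) (rule cocycle[OF I])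
    also have "\<dots> = (\<Oplus>\<^bsub>kd.H\<^esub>p\<in>?P. \<Oplus>\<^bsub>kd.H\<^esub>i\<in>I. ?s I p i)"
      by (rule finsum_cong_class) (rule step[OF I], assumption, rule closed[OF I])
    finally show "kd.cls (koszul_dprime (\<Oplus>\<^bsub>koszul m K\<^esub>p\<in>?P. koszul_of (hochster_poly I (c (I, p)))))
        = (\<Oplus>\<^bsub>kd.H\<^esub>p\<in>?P. \<Oplus>\<^bsub>kd.H\<^esub>i\<in>I. ?s I p i)" .
    show "(\<Oplus>\<^bsub>kd.H\<^esub>p\<in>?P. \<Oplus>\<^bsub>kd.H\<^esub>i\<in>I. ?s I p i) \<in> carrier kd.H"
      by (rule H.finsum_closed, rule funcsetI) (rule closed[OF I])
  qed
  finally show ?thesis unfolding H_ZK_def ..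
qed

text \<open>
  The coefficient of \<open>u\<^bsub>I - M\<^esub> v\<^sub>M\<close> in the Koszul differential of \<open>G\<close> is, up to a sign that depends on \<open>M\<close>
  only, the value of the coboundary on \<open>M\<close>.
\<close>

lemma squarefree_coefficient_cocycle:
  assumes I: "I \<subseteq> {1..m}" and G: "G \<in> ext_poly_carrier m" "koszul_of G \<in> kd.cocycles"
  shows "cochain_cocycle (full_subcomplex K I) p (\<lambda>L. if L \<in> full_subcomplex K I \<and> int (card L) = p + 1
    then shuffle_sign L I * lookup (G (I - L)) (face_monomial L) else 0)"
    (is "cochain_cocycle ?X p ?c")
proof -
  have finI: "finite I" using I finite_subset by blast
  have "coboundary ?X ?c M = 0" for M
  proof (cases "M \<in> ?X \<and> int (card M) = p + 2")
    case False
    have "?c (M - {k}) = 0" if "M \<in> ?X" "k \<in> M" for k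
    proof -
      have "finite M" using that(1) face_finite by (auto simp: full_subcomplex_def)
      then have "card (M - {k}) + 1 = card M" using that(2) card_Suc_Diff1 by fastforce
      then show ?thesis using False that(1) by auto
    qed
    then show ?thesis unfolding coboundary_def by (auto intro!: sum.neutral)
  next
    case True
    have M: "M \<in> K" "M \<subseteq> I" "finite M" "M \<subseteq> {1..m}"
      using True face_finite face_subset by (auto simp: full_subcomplex_def)
    let ?J = "I - M" and ?l = "\<lambda>k. lookup (G (I - (M - {k}))) (face_monomial (M - {k}))"
    have DG: "ext_deriv m mvar G \<in> ext_poly_carrier m"
      using mvar_carrier G(1) by (rule ext_deriv_closed)
    have Dz: "koszul_of (ext_deriv m mvar G) = koszul_of (\<lambda>J. 0)"
      using G by (simp add: kd.cocycles_def koszul_diff_koszul_of koszul_of_zero)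
    have "lookup (ext_deriv m mvar G ?J) (face_monomial M) = 0"
    proof -
      have "?J \<subseteq> {1..m}" "keys (face_monomial M) \<in> K" using I M by (auto simp: keys_face_monomial)
      then show ?thesis
        using koszul_of_eq_iff[OF DG ext_poly_zero] Dz by simp
    qed
    moreover have "lookup (ext_deriv m mvar G ?J) (face_monomial M)
        = (\<Sum>k\<in>M. shuffle_sign {k} ?J * ?l k)"
      unfolding lookup_koszul_deriv
    proof (rule sum.mono_neutral_cong_right)
      fix k assume k: "k \<in> M"
      have "insert k ?J = I - (M - {k})" using k M(2) by auto
      then show "(if k \<in> keys (face_monomial M) \<and> k \<notin> ?J
          then shuffle_sign {k} ?J * lookup (G (insert k ?J)) (face_monomial M - expo k) else 0)
        = shuffle_sign {k} ?J * ?l k"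
        using k M face_monomial_remove[OF M(3) k] by (simp add: keys_face_monomial)
    qed (use M in \<open>auto simp: keys_face_monomial\<close>)
    ultimately have 0: "(\<Sum>k\<in>M. shuffle_sign {k} ?J * ?l k) = 0" by simp
    have "coboundary ?X ?c M = (\<Sum>k\<in>M. shuffle_sign M I * (shuffle_sign {k} ?J * ?l k))"
      unfolding coboundary_def using True
    proof (simp only: if_True simp_thms, intro sum.cong refl)
      fix k assume k: "k \<in> M"
      have "card (M - {k}) + 1 = card M" using M(3) k card_Suc_Diff1 by fastforce
      moreover have "M - {k} \<in> K" by (rule face_down[OF M(1)]) blast
      ultimately have "?c (M - {k}) = shuffle_sign (M - {k}) I * ?l k"
        using True M(2) by (auto simp: full_subcomplex_def)
      moreover have "shuffle_sign {k} M * shuffle_sign (M - {k}) I = shuffle_sign M I * shuffle_sign {k} ?J"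
      proof -
        have "shuffle_sign {k} M * shuffle_sign (M - {k}) I = shuffle_sign {k} M *
            (shuffle_sign {k} ?J * (shuffle_sign {k} ?J * shuffle_sign (M - {k}) I))"
          by simp
        also have "\<dots> = shuffle_sign M I * shuffle_sign {k} ?J"
          unfolding sign_coboundary[OF finI M(2) k] by (simp add: mult.left_commute[of "shuffle_sign {k} ?J"])
        finally show ?thesis .
      qed
      ultimately show "eps k M * ?c (M - {k}) = shuffle_sign M I * (shuffle_sign {k} ?J * ?l k)"
        by (simp only: eps_eq_shuffle_sign mult.assoc[symmetric])
    qed
    then show ?thesis using 0 by (simp add: sum_distrib_left[symmetric])
  qed
  then show ?thesis by (auto simp: cochain_cocycle_def cochain_carrier_iff)
qed

text \<open>
  The squarefree representative of a class is the sum of its components in the multidegrees \<open>I\<close>, and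
  each component is the image of a simplicial cocycle.
\<close>

lemma hochster_surjective:
  assumes "x \<in> kd.cocycles"
  shows "\<exists>y\<in>hochster_sum m K. hochster_iso m K y = kd.cls x"
proof -
  obtain G where G: "G \<in> ext_poly_carrier m" "koszul_of G \<in> kd.cocycles" "kd.cls (koszul_of G) = kd.cls x"
    and sf: "\<And>J a. lookup (G J) a \<noteq> 0 \<Longrightarrow> keys a \<subseteq> {1..m} \<and>
        a = face_monomial (keys a) \<and> J \<inter> keys a = {}"
    using squarefree_representative[OF assms] by metis
  define c where "c = (\<lambda>(I, p) L. if L \<in> full_subcomplex K I \<and> int (card L) = p + 1
    then shuffle_sign L I * lookup (G (I - L)) (face_monomial L) else 0)"
  have coc: "cochain_cocycle (full_subcomplex K I) p (c (I, p))" if "I \<in> Pow {1..m}" for I p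
    unfolding c_def prod.case using squarefree_coefficient_cocycle[OF _ G(1,2), of I p] that by simp
  define y where "y = (\<lambda>(I, p)\<in>Pow {1..m} \<times> {-1..<int m}. reduced_class (full_subcomplex K I) p (c (I, p)))"
  have "representatives y c"
    unfolding representatives_def using coc by (auto simp: y_def)
  moreover have "y \<in> hochster_sum m K"
    unfolding hochster_sum_def y_def restrict_PiE_iff
    using coc by (auto simp: reduced_cohomology_carrier)
  moreover have "hochster_total c = koszul_of G"
  proof -
    let ?h = "\<lambda>I p. hochster_poly I (c (I, p))"
    have h: "?h I p \<in> ext_poly_carrier m" if "I \<in> Pow {1..m}" for I p
      by (rule hochster_poly_closed) (use that in simp)
    have hs: "(\<lambda>J. \<Sum>p\<in>{-1..<int m}. ?h I p J) \<in> ext_poly_carrier m" if "I \<in> Pow {1..m}" for I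
      by (rule ext_poly_sum) (rule h[OF that])
    have hss: "(\<lambda>J. \<Sum>I\<in>Pow {1..m}. \<Sum>p\<in>{-1..<int m}. ?h I p J) \<in> ext_poly_carrier m"
      by (rule ext_poly_sum) (rule hs)
    have "hochster_total c = (\<Oplus>\<^bsub>koszul m K\<^esub>I\<in>Pow {1..m}. koszul_of (\<lambda>J. \<Sum>p\<in>{-1..<int m}. ?h I p J))"
      unfolding hochster_total_def
    proof (rule kd.add.finprod_cong', rule refl, rule funcsetI)
      fix I assume I: "I \<in> Pow {1..m}"
      show "koszul_of (\<lambda>J. \<Sum>p\<in>{-1..<int m}. ?h I p J) \<in> carrier (koszul m K)" by (rule koszul_of_closed[OF hs[OF I]])
      show "(\<Oplus>\<^bsub>koszul m K\<^esub>p\<in>{-1..<int m}. koszul_of (?h I p)) = koszul_of (\<lambda>J. \<Sum>p\<in>{-1..<int m}. ?h I p J)"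
        by (rule koszul_of_finsum) (rule h[OF I])
    qed
    also have "\<dots> = koszul_of (\<lambda>J. \<Sum>I\<in>Pow {1..m}. \<Sum>p\<in>{-1..<int m}. ?h I p J)"
      by (rule koszul_of_finsum) (rule hs)
    also have "\<dots> = koszul_of G"
    proof (subst koszul_of_eq_iff[OF hss G(1)], intro allI impI)
      fix J and a :: "nat \<Rightarrow>\<^sub>0 nat"
      assume J: "J \<subseteq> {1..m}" and aK: "keys a \<in> K"
      let ?L = "keys a"
      let ?t = "\<lambda>I p. if J \<subseteq> I \<and> I - J \<in> K \<and> a = face_monomial (I - J)
        then c (I, p) (I - J) * shuffle_sign (I - J) I else 0"
      have "lookup (\<Sum>I\<in>Pow {1..m}. \<Sum>p\<in>{-1..<int m}. ?h I p J) a
          = (\<Sum>I\<in>Pow {1..m}. \<Sum>p\<in>{-1..<int m}. ?t I p)"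
        by (simp only: lookup_sum lookup_hochster_poly)
      also have "\<dots> = lookup (G J) a"
      proof (cases "a = face_monomial ?L \<and> J \<inter> ?L = {}")
        case True
        \<comment> \<open>The monomial \<open>u\<^sub>J v\<^sub>L\<close> occurs only for the multidegree \<open>J \<union> L\<close> and in the dimension of \<open>L\<close>.\<close>
        let ?I = "J \<union> ?L" and ?p = "int (card ?L) - 1"
        have L: "?L \<subseteq> {1..m}" "finite ?L" using face_subset[OF aK] by auto
        have IL: "?I - J = ?L" "?I - ?L = J" using True by auto
        have "card ?L \<le> m" using card_mono[OF _ L(1)] by simp
        then have p: "?p \<in> {-1..<int m}" by simp
        have "?t I p = 0" if I: "I \<in> Pow {1..m}" "I \<noteq> ?I" for I p
        proof -
          have "finite (I - J)" using I finite_subset by auto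
          then have "J \<subseteq> I \<Longrightarrow> a = face_monomial (I - J) \<Longrightarrow> I = ?I" by (auto simp: keys_face_monomial)
          then show ?thesis using I(2) by auto
        qed
        then have "(\<Sum>I\<in>Pow {1..m}. \<Sum>p\<in>{-1..<int m}. ?t I p) = (\<Sum>I\<in>{?I}. \<Sum>p\<in>{-1..<int m}. ?t I p)"
          using J L by (intro sum.mono_neutral_right) auto
        also have "\<dots> = (\<Sum>p\<in>{-1..<int m}. ?t ?I p)" by simp
        also have "\<dots> = (\<Sum>p\<in>{-1..<int m}. if p = ?p then lookup (G J) a else 0)"
        proof (rule sum.cong[OF refl])
          fix p
          have La: "face_monomial ?L = a" using True by simp
          have "c (?I, p) ?L = (if p = ?p then shuffle_sign ?L ?I * lookup (G J) a else 0)"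
            using aK by (auto simp: c_def full_subcomplex_def IL La)
          then show "?t ?I p = (if p = ?p then lookup (G J) a else 0)"
            unfolding IL La using aK by simp
        qed
        also have "\<dots> = lookup (G J) a" using p by simp
        finally show ?thesis .
      next
        case False
        have "?t I p = 0" if I: "I \<in> Pow {1..m}" for I p
        proof -
          have "finite (I - J)" using I finite_subset by auto
          then have "a = face_monomial (I - J) \<Longrightarrow> a = face_monomial ?L \<and> J \<inter> ?L = {}" by (auto simp: keys_face_monomial)
          then show ?thesis using False by auto
        qed
        moreover have "lookup (G J) a = 0" using sf[of J a] False by blast
        ultimately show ?thesis by simp
      qed
      finally show "lookup (\<Sum>I\<in>Pow {1..m}. \<Sum>p\<in>{-1..<int m}. ?h I p J) a
          = lookup (G J) a" .
    qed
    finally show ?thesis .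
  qed
  ultimately show ?thesis using hochster_iso_class G(3) by metis
qed

text \<open>
  The definition of \<open>d_prime\<close> chooses a preimage under \<open>hochster_iso\<close>.  For each choice the formula
  yields the class of \<open>d'\<close> of a Koszul cocycle \<open>?t\<close> cohomologous to \<open>x\<close>, and \<open>d'\<close> respects cohomologous
  cocycles because it anticommutes with \<open>d\<close>.
\<close>

lemma d_prime_class:
  assumes x: "x \<in> kd.cocycles"
  shows "d_prime m K (kd.cls x) = kd.cls (koszul_dprime x)"
proof -
  define y where "y = inv_into (hochster_sum m K) (hochster_iso m K) (kd.cls x)"
  have "kd.cls x \<in> hochster_iso m K ` hochster_sum m K"
    using hochster_surjective[OF x] by (metis imageI)
  then have y: "y \<in> hochster_sum m K" "hochster_iso m K y = kd.cls x"
    unfolding y_def by (rule inv_into_into, rule f_inv_into_f)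
  obtain c where c: "representatives y c" using representatives_exist[OF y(1)] by blast
  let ?t = "hochster_total c"
  have t: "?t \<in> kd.cocycles" by (rule hochster_total_cocycle[OF c])
  have dp: "koszul_dprime z \<in> kd.cocycles" if "z \<in> kd.cocycles" for z
    using that koszul_diffs_anticommute[of z]
    by (auto simp: kd.cocycles_def kp.diff_closed kp.diff_zero)
  have "x \<ominus>\<^bsub>koszul m K\<^esub> ?t \<in> koszul_diff m K ` carrier (koszul m K)"
    using kd.class_eq_iff[OF x t] y(2) hochster_iso_class[OF c] by simp
  then obtain w where w: "w \<in> carrier (koszul m K)" "x \<ominus>\<^bsub>koszul m K\<^esub> ?t = koszul_diff m K w" by blast
  have xc: "x \<in> carrier (koszul m K)" "?t \<in> carrier (koszul m K)" using x t kd.cocycle_carrier by auto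
  have "koszul_dprime x \<ominus>\<^bsub>koszul m K\<^esub> koszul_dprime ?t = koszul_dprime (x \<ominus>\<^bsub>koszul m K\<^esub> ?t)"
    using xc by (simp add: a_minus_def kp.diff_add kp.diff_minus)
  also have "\<dots> = koszul_diff m K (\<ominus>\<^bsub>koszul m K\<^esub> koszul_dprime w)"
    using koszul_diffs_anticommute[OF w(1)] w
    by (simp add: kd.diff_minus kp.diff_closed kd.diff_closed)
  finally have "koszul_dprime x \<ominus>\<^bsub>koszul m K\<^esub> koszul_dprime ?t \<in> koszul_diff m K ` carrier (koszul m K)"
    using w(1) by (simp add: kp.diff_closed)
  then have "kd.cls (koszul_dprime x) = kd.cls (koszul_dprime ?t)"
    using kd.class_eq_iff[OF dp[OF x] dp[OF t]] by simp
  then show ?thesis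
    unfolding d_prime_def Let_def y_def[symmetric] hochster_formula_class[OF c] by simp
qed

theorem H_ZK_graded_diff_ring: "graded_diff_ring (H_ZK m K) (H_ZK_deg m K) (d_prime m K) (- 1)"
  unfolding H_ZK_def H_ZK_deg_def
  by (rule kd.cohomology_graded_diff_ring[OF koszul_dprime_graded])
    (simp_all add: koszul_diffs_anticommute d_prime_class)

end

theorem theorem4p4:
  fixes m :: nat and K :: "nat set set"
  assumes "simplicial_complex m K"
  shows "cdga (H_ZK m K) (H_ZK_deg m K) (d_prime m K)
    \<and> graded_comm_ring (HH_ZK m K) (HH_ZK_deg m K)
    \<and> ideal (d_prime m K ` carrier (H_ZK m K)) (cocycle_ring (H_ZK m K) (d_prime m K))
    \<and> (\<forall>\<alpha>\<in>carrier (cocycle_ring (H_ZK m K) (d_prime m K)).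
        \<forall>\<beta>\<in>carrier (cocycle_ring (H_ZK m K) (d_prime m K)).
          cohomology_class (H_ZK m K) (d_prime m K) \<alpha> \<otimes>\<^bsub>HH_ZK m K\<^esub>
            cohomology_class (H_ZK m K) (d_prime m K) \<beta>
          = cohomology_class (H_ZK m K) (d_prime m K) (\<alpha> \<otimes>\<^bsub>H_ZK m K\<^esub> \<beta>))"
proof -
  interpret complex_on m K by (rule complex_on.intro) (rule assms)
  interpret hd: graded_diff_ring "H_ZK m K" "H_ZK_deg m K" "d_prime m K" "- 1"
    by (rule H_ZK_graded_diff_ring)
  show ?thesis
    using H_ZK_graded_diff_ring hd.cohomology_graded_comm_ring hd.boundaries_ideal hd.class_mult
    by (simp add: cdga_iff_graded_diff_ring HH_ZK_def HH_ZK_deg_def hd.cocycle_ring_eq)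
qed

end
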